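(* Let $N\ge 2$, $1\le p<+\infty$ and $0\le\alpha<(p-1)/p$, and let $G\subset\mathbb{R}^N$ be a bounded Lipschitz domain. Let $A\subseteq\partial G$ be a relatively open subset of $\partial G$ with positive $(N-1)$-dimensional measure and such that the (exterior) unit normal vector $\nu(x)$ is continuous on $A$. Then there exists a positive constant $\eta_{p,\alpha}(A,G)$ such that $$\|\mathbf{v}\|_{L^p(G)}\le \eta_{p,\alpha}(A,G)^{-1}\,\|\delta_{\partial G}^{\alpha}\,D\mathbf{v}\|_{L^p(G)}$$ for any vector function $\mathbf{v}:G\to \mathrm{span}_{x\in A}\,\nu(x)\subseteq\mathbb{R}^N$ belonging to $W^{1,p}_{\alpha}(G)$ such that $\langle\mathbf{v},\nu\rangle=0$ a.e. on $A$.
   Context: $\delta_{\partial G}(x)$ denotes the distance of $x\in G$ to $\partial G$. $\mathrm{span}_{x\in A}\,\nu(x)$ is the linear subspace of $\mathbb{R}^N$ spanned by the vectors $\nu(x)$, $x\in A$. $D\mathbf{v}$ is the (weak) Jacobian matrix of $\mathbf{v}=(v_1,\dots,v_N)$; weighted norms are computed entrywise: $\|\delta_{\partial G}^{\alpha}D\mathbf{v}\|_{L^p(G)}=\big(\sum_{i,j=1}^N\|\delta_{\partial G}^{\alpha}\,\partial_j v_i\|_{L^p(G)}^p\big)^{1/p}$, and similarly $\|\mathbf{v}\|_{L^p(G)}=\big(\sum_i\|v_i\|_{L^p(G)}^p\big)^{1/p}$. $W^{1,p}_{\alpha}(G)$ is the weighted Sobolev space with norm $\|\mathbf{v}\|_{L^p(G)}+\|\delta_{\partial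 G}^{\alpha}D\mathbf{v}\|_{L^p(G)}$. Values of $\mathbf{v}$ on $A$ are understood in the sense of traces; a.e. on $A$ is with respect to $(N-1)$-dimensional measure. *)

theory Defs
  imports "HOL-Analysis.Analysis"
begin

section \<open>Hausdorff measure\<close>

text \<open>The normalisation makes the \<open>s\<close>-dimensional measure of an \<open>s\<close>-dimensional flat agree with
  its Lebesgue measure when \<open>s\<close> is a positive integer. The definition is meant for \<open>s > 0\<close> only: since
  \<open>0 powr 0 = 0\<close>, it does not give the counting measure for \<open>s = 0\<close>. The coverings are by bounded
  sets because \<^const>\<open>diameter\<close> is meaningless for unbounded ones.\<close>

definition hausdorff_covers :: "real \<Rightarrow> 'a::metric_space set \<Rightarrow> (nat \<Rightarrow> 'a set) set" where
  "hausdorff_covers \<delta> E = {C. E \<subseteq> (\<Union>i. C i) \<and> (\<forall>i. bounded (C i) \<and> diameter (C i) \<le> \<delta>)}"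

definition hausdorff_weight :: "real \<Rightarrow> 'a::metric_space set \<Rightarrow> ennreal" where
  "hausdorff_weight s C = ennreal (unit_ball_vol s * (diameter C / 2) powr s)"

definition hausdorff_premeasure :: "real \<Rightarrow> real \<Rightarrow> 'a::metric_space set \<Rightarrow> ennreal" where
  "hausdorff_premeasure s \<delta> E = (INF C\<in>hausdorff_covers \<delta> E. \<Sum>i. hausdorff_weight s (C i))"

definition hausdorff_outer :: "real \<Rightarrow> 'a::metric_space set \<Rightarrow> ennreal" where
  "hausdorff_outer s E = (SUP \<delta>\<in>{0<..}. hausdorff_premeasure s \<delta> E)"

definition hausdorff_measure :: "real \<Rightarrow> 'a::metric_space measure" where
  "hausdorff_measure s = measure_of UNIV (sets borel) (hausdorff_outer s)"

text \<open>\<^const>\<open>measure_of\<close> would collapse to the zero measure if \<^const>\<open>hausdorff_outer\<close> were not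
  countably additive on the Borel sets, so this is established first.\<close>

lemma hausdorff_weight_empty [simp]: "hausdorff_weight s {} = 0"
  by (simp add: hausdorff_weight_def)

lemma hausdorff_premeasure_empty:
  assumes "\<delta> > 0" shows "hausdorff_premeasure s \<delta> {} = 0"
proof -
  have "(\<lambda>i. {}) \<in> hausdorff_covers \<delta> ({} :: 'a set)"
    using assms by (simp add: hausdorff_covers_def)
  then have "hausdorff_premeasure s \<delta> ({} :: 'a set) \<le> (\<Sum>i::nat. hausdorff_weight s ({} :: 'a set))"
    unfolding hausdorff_premeasure_def by (intro INF_lower2) auto
  then show ?thesis by simp
qed

lemma hausdorff_premeasure_mono:
  "A \<subseteq> B \<Longrightarrow> hausdorff_premeasure s \<delta> A \<le> hausdorff_premeasure s \<delta> B"
  unfolding hausdorff_premeasure_def by (intro INF_superset_mono) (auto simp: hausdorff_covers_def)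

lemma hausdorff_premeasure_antimono:
  "\<delta> \<le> \<delta>' \<Longrightarrow> hausdorff_premeasure s \<delta>' A \<le> hausdorff_premeasure s \<delta> A"
  unfolding hausdorff_premeasure_def
  by (intro INF_superset_mono) (auto simp: hausdorff_covers_def intro: order_trans)

lemma hausdorff_premeasure_UN:
  fixes A :: "nat \<Rightarrow> 'a::metric_space set"
  shows "hausdorff_premeasure s \<delta> (\<Union>i. A i) \<le> (\<Sum>i. hausdorff_premeasure s \<delta> (A i))"
proof (cases "(\<Sum>i. hausdorff_premeasure s \<delta> (A i)) = top")
  case False
  show ?thesis
  proof (rule ennreal_le_epsilon)
    fix e :: real assume e: "0 < e"
    define b where "b = (\<lambda>n. ennreal (e * (1/2) ^ Suc n))"
    have "\<exists>C\<in>hausdorff_covers \<delta> (A n). (\<Sum>i. hausdorff_weight s (C i))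
          < hausdorff_premeasure s \<delta> (A n) + b n" for n
    proof -
      have "hausdorff_premeasure s \<delta> (A n) \<noteq> top"
        using False ennreal_suminf_lessD less_top by blast
      then have "hausdorff_premeasure s \<delta> (A n) < hausdorff_premeasure s \<delta> (A n) + b n"
        using e by (simp add: b_def ennreal_less_top)
      then show ?thesis
        unfolding hausdorff_premeasure_def by (simp add: INF_less_iff)
    qed
    then obtain C where C: "\<And>n. C n \<in> hausdorff_covers \<delta> (A n)"
      and lt: "\<And>n. (\<Sum>i. hausdorff_weight s (C n i)) < hausdorff_premeasure s \<delta> (A n) + b n"
      by metis
    define D where "D = (\<lambda>k. case prod_decode k of (n, i) \<Rightarrow> C n i)"
    have D: "D \<in> hausdorff_covers \<delta> (\<Union>i. A i)"
    proof -
      have "\<exists>k. x \<in> D k" if x: "x \<in> A n" for x n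
      proof -
        obtain i where "x \<in> C n i"
          using C[of n] x unfolding hausdorff_covers_def by blast
        then show ?thesis
          by (intro exI[of _ "prod_encode (n, i)"]) (simp add: D_def)
      qed
      then show ?thesis
        using C by (auto simp: hausdorff_covers_def D_def split: prod.split)
    qed
    have "hausdorff_premeasure s \<delta> (\<Union>i. A i) \<le> (\<Sum>k. hausdorff_weight s (D k))"
      unfolding hausdorff_premeasure_def by (rule INF_lower[OF D])
    also have "\<dots> = (\<Sum>n. \<Sum>i. hausdorff_weight s (C n i))"
      using suminf_ennreal_2dimen[of "\<lambda>n. \<Sum>i. hausdorff_weight s (C n i)" "\<lambda>(n, i). hausdorff_weight s (C n i)"]
      by (simp add: D_def case_prod_beta)
    also have "\<dots> \<le> (\<Sum>n. hausdorff_premeasure s \<delta> (A n) + b n)"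
      using lt by (intro suminf_le) (auto intro: less_imp_le)
    also have "\<dots> = (\<Sum>n. hausdorff_premeasure s \<delta> (A n)) + (\<Sum>n. b n)"
      by (intro suminf_add[symmetric]) auto
    also have "(\<Sum>n. b n) = ennreal e"
      unfolding b_def
      by (rule suminf_ennreal_eq) (use e power_half_series sums_mult[of "\<lambda>n. (1/2) ^ Suc n" 1 e] in auto)
    finally show "hausdorff_premeasure s \<delta> (\<Union>i. A i)
        \<le> (\<Sum>i. hausdorff_premeasure s \<delta> (A i)) + ennreal e" .
  qed
qed simp

lemma hausdorff_outer_empty [simp]: "hausdorff_outer s {} = 0"
  by (simp add: hausdorff_outer_def hausdorff_premeasure_empty)

lemma hausdorff_outer_mono: "A \<subseteq> B \<Longrightarrow> hausdorff_outer s A \<le> hausdorff_outer s B"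
  unfolding hausdorff_outer_def by (intro SUP_mono) (auto intro: hausdorff_premeasure_mono)

lemma hausdorff_outer_UN:
  fixes A :: "nat \<Rightarrow> 'a::metric_space set"
  shows "hausdorff_outer s (\<Union>i. A i) \<le> (\<Sum>i. hausdorff_outer s (A i))"
  unfolding hausdorff_outer_def[of s "\<Union>i. A i"]
proof (rule SUP_least)
  fix \<delta> :: real assume "\<delta> \<in> {0<..}"
  have "hausdorff_premeasure s \<delta> (\<Union>i. A i) \<le> (\<Sum>i. hausdorff_premeasure s \<delta> (A i))"
    by (rule hausdorff_premeasure_UN)
  also have "\<dots> \<le> (\<Sum>i. hausdorff_outer s (A i))"
    using \<open>\<delta> \<in> {0<..}\<close> by (intro suminf_le) (auto simp: hausdorff_outer_def intro: SUP_upper)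
  finally show "hausdorff_premeasure s \<delta> (\<Union>i. A i) \<le> (\<Sum>i. hausdorff_outer s (A i))" .
qed

lemma hausdorff_outer_Un: "hausdorff_outer s (A \<union> B) \<le> hausdorff_outer s A + hausdorff_outer s B"
proof -
  have "A \<union> B = (\<Union>i. binaryset A B i)"
    by (simp add: UN_binaryset_eq)
  then have "hausdorff_outer s (A \<union> B) \<le> (\<Sum>i. hausdorff_outer s (binaryset A B i))"
    using hausdorff_outer_UN by metis
  also have "\<dots> = hausdorff_outer s A + hausdorff_outer s B"
    by (simp add: suminf_binaryset_eq)
  finally show ?thesis .
qed

lemma hausdorff_outer_space: "outer_measure_space UNIV (hausdorff_outer s)"
  by (simp add: outer_measure_space_def positive_def increasing_def countably_subadditive_def
      hausdorff_outer_mono hausdorff_outer_UN)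

lemma hausdorff_outer_separated:
  assumes "e > 0" and sep: "\<And>x y. x \<in> A \<Longrightarrow> y \<in> B \<Longrightarrow> e \<le> dist x y"
  shows "hausdorff_outer s A + hausdorff_outer s B \<le> hausdorff_outer s (A \<union> B)"
proof -
  have pre: "hausdorff_premeasure s \<delta> A + hausdorff_premeasure s \<delta> B \<le> hausdorff_premeasure s \<delta> (A \<union> B)"
    if "\<delta> < e" for \<delta>
    unfolding hausdorff_premeasure_def[of s \<delta> "A \<union> B"]
  proof (rule INF_greatest)
    fix C assume C: "C \<in> hausdorff_covers \<delta> (A \<union> B)"
    have one: "C i \<inter> A = {} \<or> C i \<inter> B = {}" for i
    proof (rule ccontr)
      assume "\<not> ?thesis"
      then obtain x y where xy: "x \<in> C i" "x \<in> A" "y \<in> C i" "y \<in> B" by blast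
      have "bounded (C i)" "diameter (C i) \<le> \<delta>"
        using C by (auto simp: hausdorff_covers_def)
      then have "dist x y \<le> \<delta>"
        using diameter_bounded_bound[of "C i" x y] xy by linarith
      with sep[of x y] xy \<open>\<delta> < e\<close> show False by auto
    qed
    define D where "D = (\<lambda>S i. if C i \<inter> S = {} then {} else C i)"
    have DA: "D A \<in> hausdorff_covers \<delta> A" and DB: "D B \<in> hausdorff_covers \<delta> B"
    proof -
      have "\<delta> \<ge> 0"
        using C diameter_ge_0[of "C 0"] unfolding hausdorff_covers_def
        by (metis (mono_tags, lifting) mem_Collect_eq order_trans)
      then have "bounded (D S i) \<and> diameter (D S i) \<le> \<delta>" for S i
        using C by (simp add: hausdorff_covers_def D_def)
      moreover have "S \<subseteq> (\<Union>i. D S i)" if S: "S \<subseteq> A \<union> B" for S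
      proof
        fix x assume "x \<in> S"
        then obtain i where "x \<in> C i"
          using C S unfolding hausdorff_covers_def by blast
        then have "x \<in> D S i" using \<open>x \<in> S\<close> by (auto simp: D_def)
        then show "x \<in> (\<Union>i. D S i)" by blast
      qed
      ultimately show "D A \<in> hausdorff_covers \<delta> A" "D B \<in> hausdorff_covers \<delta> B"
        by (simp_all add: hausdorff_covers_def)
    qed
    have "hausdorff_premeasure s \<delta> A + hausdorff_premeasure s \<delta> B
        \<le> (\<Sum>i. hausdorff_weight s (D A i)) + (\<Sum>i. hausdorff_weight s (D B i))"
      unfolding hausdorff_premeasure_def by (intro add_mono INF_lower DA DB)
    also have "\<dots> = (\<Sum>i. hausdorff_weight s (D A i) + hausdorff_weight s (D B i))"
      by (intro suminf_add) auto
    also have "\<dots> \<le> (\<Sum>i. hausdorff_weight s (C i))"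
    proof (intro suminf_le)
      fix i show "hausdorff_weight s (D A i) + hausdorff_weight s (D B i) \<le> hausdorff_weight s (C i)"
        using one[of i] by (auto simp: D_def)
    qed auto
    finally show "hausdorff_premeasure s \<delta> A + hausdorff_premeasure s \<delta> B
        \<le> (\<Sum>i. hausdorff_weight s (C i))" .
  qed
  have small: "hausdorff_premeasure s \<delta> A + hausdorff_premeasure s \<delta>' B \<le> hausdorff_outer s (A \<union> B)"
    if "\<delta> > 0" "\<delta>' > 0" for \<delta> \<delta>'
  proof -
    define d where "d = min (min \<delta> \<delta>') (e / 2)"
    have d: "d > 0" "d < e" "d \<le> \<delta>" "d \<le> \<delta>'"
      using that \<open>e > 0\<close> by (auto simp: d_def)
    have "hausdorff_premeasure s \<delta> A + hausdorff_premeasure s \<delta>' B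
        \<le> hausdorff_premeasure s d A + hausdorff_premeasure s d B"
      using d by (intro add_mono hausdorff_premeasure_antimono)
    also have "\<dots> \<le> hausdorff_premeasure s d (A \<union> B)"
      by (rule pre) (use d in auto)
    also have "\<dots> \<le> hausdorff_outer s (A \<union> B)"
      unfolding hausdorff_outer_def using d by (intro SUP_upper) auto
    finally show ?thesis .
  qed
  have "hausdorff_outer s A + hausdorff_outer s B
      = (SUP \<delta>\<in>{0<..}. hausdorff_premeasure s \<delta> A + hausdorff_outer s B)"
    unfolding hausdorff_outer_def[of s A] by (rule ennreal_SUP_add_left[symmetric]) auto
  also have "\<dots> = (SUP \<delta>\<in>{0<..}. SUP \<delta>'\<in>{0<..}. hausdorff_premeasure s \<delta> A + hausdorff_premeasure s \<delta>' B)"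
    unfolding hausdorff_outer_def[of s B] by (intro SUP_cong refl ennreal_SUP_add_right) auto
  also have "\<dots> \<le> hausdorff_outer s (A \<union> B)"
    by (intro SUP_least small) auto
  finally show ?thesis .
qed

lemma hausdorff_outer_separated_sum:
  fixes R :: "nat \<Rightarrow> 'a::metric_space set"
  assumes "\<And>m n. m < n \<Longrightarrow> \<exists>e>0. \<forall>x\<in>R m. \<forall>y\<in>R n. e \<le> dist x y"
  shows "(\<Sum>k<K. hausdorff_outer s (R k)) \<le> hausdorff_outer s (\<Union>k<K. R k)"
proof (induction K)
  case (Suc K)
  obtain e where e: "\<And>m. m < K \<Longrightarrow> e m > 0 \<and> (\<forall>x\<in>R m. \<forall>y\<in>R K. e m \<le> dist x y)"
    using assms[of _ K] by metis
  define d where "d = Min (insert 1 (e ` {..<K}))"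
  have "d > 0" using e by (auto simp: d_def)
  moreover have "d \<le> dist x y" if x: "x \<in> (\<Union>k<K. R k)" and y: "y \<in> R K" for x y
  proof -
    obtain m where m: "m < K" "x \<in> R m" using x by auto
    have "d \<le> e m" unfolding d_def using m by (intro Min_le) auto
    also have "\<dots> \<le> dist x y" using e[OF m(1)] m y by blast
    finally show ?thesis .
  qed
  ultimately have "hausdorff_outer s (\<Union>k<K. R k) + hausdorff_outer s (R K)
      \<le> hausdorff_outer s ((\<Union>k<K. R k) \<union> R K)"
    by (rule hausdorff_outer_separated)
  moreover have "(\<Union>k<K. R k) \<union> R K = (\<Union>k<Suc K. R k)"
    by (auto simp: lessThan_Suc)
  ultimately show ?case
    using Suc.IH by (simp add: add.commute) (meson add_left_mono order_trans)
qed simp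

lemma hausdorff_outer_closed:
  fixes F T :: "'a::metric_space set"
  assumes "closed F"
  shows "hausdorff_outer s (T \<inter> F) + hausdorff_outer s (T - F) = hausdorff_outer s T"
proof (rule antisym)
  let ?h = "hausdorff_outer s :: 'a set \<Rightarrow> ennreal"
  have "?h ((T \<inter> F) \<union> (T - F)) \<le> ?h (T \<inter> F) + ?h (T - F)"
    by (rule hausdorff_outer_Un)
  then show "?h T \<le> ?h (T \<inter> F) + ?h (T - F)"
    by (simp add: Int_Diff_Un)
  show "?h (T \<inter> F) + ?h (T - F) \<le> ?h T"
  proof (cases "F = {} \<or> ?h T = top")
    case False
    then have "F \<noteq> {}" and fin: "?h T < top" by (simp_all add: top.not_eq_extremum)
    define t where "t = (\<lambda>n. {x \<in> T. 1 / (real n + 1) \<le> infdist x F})"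
    define R where "R = (\<lambda>n. t (Suc n) - t n)"
    have RT: "R n \<subseteq> T" for n by (auto simp: R_def t_def)
    have sepR: "\<exists>e>0. \<forall>x\<in>R m. \<forall>y\<in>R n. e \<le> dist x y" if "m + 2 \<le> n" for m n
    proof (intro exI[of _ "1 / (real m + 2) - 1 / (real m + 3)"] conjI ballI)
      show "0 < 1 / (real m + 2) - 1 / (real m + 3)"
        using frac_less2[of 1 1 "real m + 2" "real m + 3"] by simp
      fix x y assume "x \<in> R m" "y \<in> R n"
      then have x: "1 / (real m + 2) \<le> infdist x F" and y: "infdist y F < 1 / (real n + 1)"
        by (auto simp: R_def t_def add.commute)
      have "1 / (real n + 1) \<le> 1 / (real m + 3)"
        using that by (intro divide_left_mono) auto
      moreover have "infdist x F \<le> infdist y F + dist x y"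
        by (rule infdist_triangle)
      ultimately show "1 / (real m + 2) - 1 / (real m + 3) \<le> dist x y"
        using x y by linarith
    qed
    have parity: "(\<Sum>k<K. ?h (R (2 * k + c))) \<le> ?h T" for K c
    proof -
      have "(\<Sum>k<K. ?h (R (2 * k + c))) \<le> ?h (\<Union>k<K. R (2 * k + c))"
        by (rule hausdorff_outer_separated_sum) (rule sepR, simp)
      also have "\<dots> \<le> ?h T"
        using RT by (intro hausdorff_outer_mono) auto
      finally show ?thesis .
    qed
    have dbl: "(\<Sum>n<2 * K. ?h (R n)) = (\<Sum>k<K. ?h (R (2 * k + 0))) + (\<Sum>k<K. ?h (R (2 * k + 1)))" for K
      by (induction K) (auto simp: ac_simps)
    have part: "(\<Sum>n<K. ?h (R n)) \<le> ?h T + ?h T" for K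
    proof -
      have "(\<Sum>n<K. ?h (R n)) \<le> (\<Sum>n<2 * K. ?h (R n))"
        by (intro sum_mono2) auto
      also have "\<dots> \<le> ?h T + ?h T"
        unfolding dbl by (intro add_mono parity)
      finally show ?thesis .
    qed
    have total: "(\<Sum>n. ?h (R n)) < top"
    proof -
      have "(\<Sum>n. ?h (R n)) \<le> ?h T + ?h T"
        by (intro suminf_le_const part) auto
      also have "\<dots> < top" using fin by simp
      finally show ?thesis .
    qed
    have diff: "T - F \<subseteq> t n \<union> (\<Union>i. R (i + n))" for n
    proof
      fix x assume x: "x \<in> T - F"
      then have "infdist x F > 0"
        using \<open>closed F\<close> \<open>F \<noteq> {}\<close> in_closed_iff_infdist_zero[of F x] infdist_nonneg[of x F] by force
      then obtain N where "inverse (real (Suc N)) < infdist x F"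
        using reals_Archimedean by blast
      then have N: "x \<in> t N" using x by (auto simp: t_def inverse_eq_divide add.commute)
      show "x \<in> t n \<union> (\<Union>i. R (i + n))"
      proof (cases "x \<in> t n")
        case False
        define L where "L = (LEAST k. x \<in> t k)"
        have L: "x \<in> t L" unfolding L_def by (rule LeastI[of _ N]) (rule N)
        have "n < L"
        proof (rule ccontr)
          assume "\<not> n < L"
          then have "1 / (real n + 1) \<le> 1 / (real L + 1)" by (intro divide_left_mono) auto
          then have "x \<in> t n" using L by (auto simp: t_def)
          with False show False ..
        qed
        then obtain i where i: "L = Suc (i + n)"
          using less_imp_Suc_add by (metis add.commute)
        have "x \<notin> t (i + n)" using not_less_Least[of "i + n" "\<lambda>k. x \<in> t k"] i L_def by auto
        then show ?thesis using L i by (auto simp: R_def)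
      qed simp
    qed
    have step: "?h (T \<inter> F) + ?h (T - F) + (\<Sum>i<n. ?h (R i)) \<le> ?h T + (\<Sum>i. ?h (R i))" for n
    proof -
      have "?h (T \<inter> F) + ?h (t n) \<le> ?h ((T \<inter> F) \<union> t n)"
      proof (rule hausdorff_outer_separated[of "1 / (real n + 1)"])
        fix x y assume "x \<in> T \<inter> F" "y \<in> t n"
        then have "1 / (real n + 1) \<le> infdist y F" "infdist y F \<le> dist y x"
          by (auto simp: t_def intro: infdist_le)
        then show "1 / (real n + 1) \<le> dist x y" by (simp add: dist_commute)
      qed auto
      also have "\<dots> \<le> ?h T" by (intro hausdorff_outer_mono) (auto simp: t_def)
      finally have 1: "?h (T \<inter> F) + ?h (t n) \<le> ?h T" .
      have "?h (T - F) \<le> ?h (t n \<union> (\<Union>i. R (i + n)))"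
        by (rule hausdorff_outer_mono[OF diff])
      also have "\<dots> \<le> ?h (t n) + ?h (\<Union>i. R (i + n))"
        by (rule hausdorff_outer_Un)
      also have "\<dots> \<le> ?h (t n) + (\<Sum>i. ?h (R (i + n)))"
        by (intro add_left_mono hausdorff_outer_UN)
      finally have 2: "?h (T - F) \<le> ?h (t n) + (\<Sum>i. ?h (R (i + n)))" .
      have 3: "(\<Sum>i. ?h (R i)) = (\<Sum>i. ?h (R (i + n))) + (\<Sum>i<n. ?h (R i))"
        by (rule suminf_offset) auto
      have "?h (T \<inter> F) + ?h (T - F) + (\<Sum>i<n. ?h (R i))
          \<le> ?h (T \<inter> F) + (?h (t n) + (\<Sum>i. ?h (R (i + n)))) + (\<Sum>i<n. ?h (R i))"
        using 2 by (intro add_mono) auto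
      also have "\<dots> = (?h (T \<inter> F) + ?h (t n)) + (\<Sum>i. ?h (R i))"
        unfolding 3 by (simp add: ac_simps)
      also have "\<dots> \<le> ?h T + (\<Sum>i. ?h (R i))"
        by (intro add_right_mono 1)
      finally show ?thesis .
    qed
    have "(\<lambda>n. ?h (T \<inter> F) + ?h (T - F) + (\<Sum>i<n. ?h (R i)))
        \<longlonglongrightarrow> ?h (T \<inter> F) + ?h (T - F) + (\<Sum>i. ?h (R i))"
      by (intro tendsto_add tendsto_const summable_LIMSEQ) auto
    then have "?h (T \<inter> F) + ?h (T - F) + (\<Sum>i. ?h (R i)) \<le> ?h T + (\<Sum>i. ?h (R i))"
      by (rule Lim_bounded) (use step in auto)
    then show ?thesis
      using total ennreal_add_left_cancel_le[of "\<Sum>i. ?h (R i)" "?h (T \<inter> F) + ?h (T - F)" "?h T"]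
      by (metis add.commute infinity_ennreal_def less_irrefl)
  qed auto
qed

lemma space_hausdorff_measure [simp]: "space (hausdorff_measure s) = UNIV"
  and sets_hausdorff_measure [simp, measurable_cong]: "sets (hausdorff_measure s) = sets borel"
  using sets.sigma_sets_eq[of borel] by (simp_all add: hausdorff_measure_def)

lemma emeasure_hausdorff_measure:
  fixes B :: "'a::metric_space set"
  assumes "B \<in> sets borel"
  shows "emeasure (hausdorff_measure s) B = hausdorff_outer s B"
proof -
  define L where "L = lambda_system UNIV (UNIV :: 'a set set) (hausdorff_outer s)"
  have "sigma_algebra (UNIV :: 'a set) UNIV"
    using sigma_algebra_Pow[of "UNIV :: 'a set"] by simp
  then have L: "measure_space UNIV L (hausdorff_outer s)"
    unfolding L_def by (rule sigma_algebra.caratheodory_lemma) (rule hausdorff_outer_space)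
  have sub: "sets (borel :: 'a measure) \<subseteq> L"
  proof -
    have "Collect closed \<subseteq> L"
      using hausdorff_outer_closed by (auto simp: L_def lambda_system_def Int_commute Diff_eq)
    moreover have "sigma_algebra UNIV L" using L by (simp add: measure_space_def)
    ultimately show ?thesis
      by (simp add: borel_eq_closed sigma_algebra.sigma_sets_subset)
  qed
  have "measure_space UNIV (sets (borel :: 'a measure)) (hausdorff_outer s)"
    by (rule measure_down[OF L _ sub])
       (metis sets.sigma_algebra_axioms space_borel)
  then show ?thesis
    unfolding hausdorff_measure_def
    by (intro emeasure_measure_of_sigma) (use assms in \<open>auto simp: measure_space_def\<close>)
qed


section \<open>Lipschitz domains and their normals\<close>

text \<open>In the chart with axis \<open>e\<close>, the point \<open>y\<close> has height \<open>y \<bullet> e\<close> over its orthogonal projection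
  \<open>y - (y \<bullet> e) *\<^sub>R e\<close> to the hyperplane orthogonal to \<open>e\<close>, on which \<open>\<gamma>\<close> is Lipschitz; the values
  of \<open>\<gamma>\<close> outside this hyperplane are irrelevant. The following function is negative below the
  graph of \<open>\<gamma>\<close> and positive above it.\<close>

definition graph_height :: "real^'n \<Rightarrow> (real^'n \<Rightarrow> real) \<Rightarrow> real^'n \<Rightarrow> real" where
  "graph_height e \<gamma> y = y \<bullet> e - \<gamma> (y - (y \<bullet> e) *\<^sub>R e)"

definition lipschitz_chart ::
    "(real^'n) set \<Rightarrow> (real^'n) set \<Rightarrow> real^'n \<Rightarrow> (real^'n \<Rightarrow> real) \<Rightarrow> bool" where
  "lipschitz_chart G U e \<gamma> \<longleftrightarrow>
     open U \<and> norm e = 1 \<and> (\<exists>L. L-lipschitz_on {z. z \<bullet> e = 0} \<gamma>) \<and>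
     G \<inter> U = {y \<in> U. graph_height e \<gamma> y < 0}"

definition bounded_lipschitz_domain :: "(real^'n) set \<Rightarrow> bool" where
  "bounded_lipschitz_domain G \<longleftrightarrow>
     open G \<and> connected G \<and> G \<noteq> {} \<and> bounded G \<and>
     (\<forall>x\<in>frontier G. \<exists>U e \<gamma>. x \<in> U \<and> lipschitz_chart G U e \<gamma>)"

text \<open>The exterior unit normal exists at those boundary points where the graph is differentiable;
  it is the normalised gradient \<open>(- \<nabla>\<gamma>, 1)\<close> of the height function. The gradient \<open>w\<close> satisfies
  \<open>w \<bullet> e = 1\<close>, so it does not vanish.\<close>

definition exterior_unit_normal :: "(real^'n) set \<Rightarrow> real^'n \<Rightarrow> real^'n \<Rightarrow> bool" where
  "exterior_unit_normal G x n \<longleftrightarrow>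
     x \<in> frontier G \<and>
     (\<exists>U e \<gamma> w. x \<in> U \<and> lipschitz_chart G U e \<gamma> \<and>
        (graph_height e \<gamma> has_derivative (\<lambda>h. w \<bullet> h)) (at x) \<and> n = w /\<^sub>R norm w)"


section \<open>Weak derivatives and weighted Sobolev spaces\<close>

fun Ck :: "nat \<Rightarrow> (real^'n \<Rightarrow> real) \<Rightarrow> bool" where
  "Ck 0 f = continuous_on UNIV f"
| "Ck (Suc k) f = ((\<forall>x. f differentiable (at x)) \<and>
     (\<forall>j. Ck k (\<lambda>x. frechet_derivative f (at x) (axis j 1))))"

definition smooth :: "(real^'n \<Rightarrow> real) \<Rightarrow> bool" where
  "smooth f \<longleftrightarrow> (\<forall>k. Ck k f)"

definition test_function :: "(real^'n) set \<Rightarrow> (real^'n \<Rightarrow> real) \<Rightarrow> bool" where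
  "test_function G \<phi> \<longleftrightarrow> smooth \<phi> \<and> compact (closure {x. \<phi> x \<noteq> 0}) \<and> closure {x. \<phi> x \<noteq> 0} \<subseteq> G"

definition locally_integrable :: "(real^'n) set \<Rightarrow> (real^'n \<Rightarrow> real) \<Rightarrow> bool" where
  "locally_integrable G f \<longleftrightarrow> (\<forall>K. compact K \<and> K \<subseteq> G \<longrightarrow> set_integrable lebesgue K f)"

text \<open>The entry \<open>V x $ i $ j\<close> is the weak partial derivative of the \<open>i\<close>-th component in direction \<open>j\<close>.\<close>

definition weak_jacobian ::
    "(real^'n) set \<Rightarrow> (real^'n \<Rightarrow> real^'n) \<Rightarrow> (real^'n \<Rightarrow> real^'n^'n) \<Rightarrow> bool" where
  "weak_jacobian G v V \<longleftrightarrow>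
     (\<forall>i. locally_integrable G (\<lambda>x. v x $ i)) \<and>
     (\<forall>i j. locally_integrable G (\<lambda>x. V x $ i $ j)) \<and>
     (\<forall>\<phi> i j. test_function G \<phi> \<longrightarrow>
        (LINT x:G|lebesgue. v x $ i * frechet_derivative \<phi> (at x) (axis j 1)) =
        - (LINT x:G|lebesgue. V x $ i $ j * \<phi> x))"

definition in_Lp :: "real \<Rightarrow> (real^'n) set \<Rightarrow> (real^'n \<Rightarrow> real) \<Rightarrow> bool" where
  "in_Lp p G f \<longleftrightarrow> f \<in> borel_measurable (lebesgue_on G) \<and>
     integrable (lebesgue_on G) (\<lambda>x. \<bar>f x\<bar> powr p)"

definition Lp_norm :: "real \<Rightarrow> (real^'n) set \<Rightarrow> (real^'n \<Rightarrow> real) \<Rightarrow> real" where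
  "Lp_norm p G f = (LINT x|lebesgue_on G. \<bar>f x\<bar> powr p) powr (1 / p)"

definition vector_Lp_norm :: "real \<Rightarrow> (real^'n) set \<Rightarrow> (real^'n \<Rightarrow> real^'n) \<Rightarrow> real" where
  "vector_Lp_norm p G v = (\<Sum>i\<in>UNIV. Lp_norm p G (\<lambda>x. v x $ i) powr p) powr (1 / p)"

definition boundary_weight :: "real \<Rightarrow> (real^'n) set \<Rightarrow> real^'n \<Rightarrow> real" where
  "boundary_weight \<alpha> G x = infdist x (frontier G) powr \<alpha>"

definition weighted_matrix_Lp_norm ::
    "real \<Rightarrow> real \<Rightarrow> (real^'n) set \<Rightarrow> (real^'n \<Rightarrow> real^'n^'n) \<Rightarrow> real" where
  "weighted_matrix_Lp_norm p \<alpha> G V =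
     (\<Sum>i\<in>UNIV. \<Sum>j\<in>UNIV. Lp_norm p G (\<lambda>x. boundary_weight \<alpha> G x * V x $ i $ j) powr p) powr (1 / p)"

definition weighted_sobolev :: "real \<Rightarrow> real \<Rightarrow> (real^'n) set \<Rightarrow> (real^'n \<Rightarrow> real^'n) set" where
  "weighted_sobolev p \<alpha> G =
     {v. (\<forall>i. in_Lp p G (\<lambda>x. v x $ i)) \<and>
         (\<exists>V. weak_jacobian G v V \<and>
              (\<forall>i j. in_Lp p G (\<lambda>x. boundary_weight \<alpha> G x * V x $ i $ j)))}"


section \<open>Traces\<close>

text \<open>The trace operator is the continuous extension to \<open>W\<^sup>1\<^sup>,\<^sup>1(G)\<close>, with values in \<open>L\<^sup>1\<close> of the boundary,
  of the restriction to \<open>frontier G\<close> of functions that are smooth up to the boundary. It applies to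
  the weighted spaces with \<open>\<alpha> < (p - 1) / p\<close>, which embed in \<open>W\<^sup>1\<^sup>,\<^sup>1(G)\<close> by the Hoelder inequality.\<close>

definition has_trace :: "(real^'n) set \<Rightarrow> (real^'n \<Rightarrow> real^'n) \<Rightarrow> (real^'n \<Rightarrow> real^'n) \<Rightarrow> bool" where
  "has_trace G v g \<longleftrightarrow>
     g \<in> borel_measurable borel \<and>
     (\<exists>V. weak_jacobian G v V \<and>
       (\<exists>u :: nat \<Rightarrow> real^'n \<Rightarrow> real^'n.
          (\<forall>k i. smooth (\<lambda>x. u k x $ i)) \<and>
          (\<lambda>k. \<integral>\<^sup>+x\<in>G. ennreal (norm (u k x - v x)) \<partial>lebesgue) \<longlonglongrightarrow> 0 \<and>
          (\<lambda>k. \<integral>\<^sup>+x\<in>G. ennreal (norm (jacobian (u k) (at x) - V x)) \<partial>lebesgue) \<longlonglongrightarrow> 0 \<and>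
          (\<lambda>k. \<integral>\<^sup>+x\<in>frontier G. ennreal (norm (u k x - g x))
                 \<partial>hausdorff_measure (real CARD('n) - 1)) \<longlonglongrightarrow> 0))"

end

theory Submission
  imports Defs "HOL-Computational_Algebra.Polynomial"
begin

text \<open>Everything is reduced to integration along parallel segments. If the segment from \<open>y\<close> to
  \<open>y + l y *\<^sub>R h\<close> has its points at distance at least \<open>\<kappa> (l y - t)\<close> from the boundary, then Hoelder's
  inequality on the segment absorbs the weight, because \<open>\<alpha> p / (p - 1) < 1\<close>, and Tonelli's theorem with
  translation invariance bounds the \<open>L\<^sup>p\<close> norm of the increment of \<open>v\<close> by the weighted energy of its Jacobian.
  With translations this gives a Poincare inequality on small balls; moving points of the domain inwards
  along the axis of a chart transports it to neighbourhoods of boundary points, and connectedness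
  and compactness of the closure of \<open>G\<close> give it on the whole of \<open>G\<close>, with a constant \<open>c\<close> in the span of the normals.
  Segments that run up to the graph compare \<open>v\<close> with its trace, so that \<open>c \<bullet> \<nu> x\<close> is controlled by the
  energy for \<open>x \<in> A\<close>. Finitely many \<open>\<nu> x\<close> span, so the energy controls \<open>c\<close>, hence \<open>v\<close>. No surface
  parametrisation is needed: pushing the Lebesgue measure of a boundary layer forward along the axis of
  a chart gives a measure dominated by the Hausdorff measure.\<close>

section \<open>Weighted integrals along segments\<close>

text \<open>The approximants that define the trace converge only in the unweighted space W^{1,1},
  whereas the inequality is weighted and has exponent p. The limit is therefore taken before any
  power or weight appears: on almost every segment the increment of v is bounded by the plain
  integral of |V|, and only then does Hoelder's inequality bring in the weight. The length
  \<open>l y\<close> may vary with y, so that one estimate serves both translations (constant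
  length, far end in G) and vertical paths up to the graph (far end on the frontier, where the trace
  is read off). The argument is direct: each constant is fixed before \<open>v\<close> is given. The
  constant vector c is a value v z at a well chosen point, not a mean, and so lies in the span of
  the normals by itself. The theorem, \<open>weighted_sobolev\<close> and \<open>has_trace\<close>
  each bring a weak Jacobian of their own, which is why its uniqueness is proved; the estimates then
  run on Borel representatives.\<close>

lemma nn_integral_Holder:
  fixes f g :: "'a \<Rightarrow> real"
  assumes pq: "1 < p" "1 < q" "1 / p + 1 / q = 1"
    and [measurable]: "f \<in> borel_measurable M" "g \<in> borel_measurable M"
    and nn: "\<And>x. 0 \<le> f x" "\<And>x. 0 \<le> g x" and A: "0 \<le> A" and B: "0 \<le> B"
    and fA: "(\<integral>\<^sup>+x. ennreal (f x powr p) \<partial>M) \<le> ennreal A"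
    and gB: "(\<integral>\<^sup>+x. ennreal (g x powr q) \<partial>M) \<le> ennreal B"
  shows "(\<integral>\<^sup>+x. ennreal (f x * g x) \<partial>M) \<le> ennreal (A powr (1 / p) * B powr (1 / q))"
proof -
  have zero: "AE x in M. h x = 0"
    if "(\<integral>\<^sup>+x. ennreal (h x powr r) \<partial>M) \<le> ennreal 0" "h \<in> borel_measurable M" "\<And>x. 0 \<le> h x"
    for h :: "'a \<Rightarrow> real" and r
  proof -
    have [measurable]: "h \<in> borel_measurable M" by fact
    have "(\<integral>\<^sup>+x. ennreal (h x powr r) \<partial>M) = 0" using that(1) by simp
    then have "AE x in M. ennreal (h x powr r) = 0" by (subst (asm) nn_integral_0_iff_AE) auto
    then show ?thesis using that(3) by (auto simp: ennreal_eq_0_iff dest: antisym)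
  qed
  \<comment> \<open>The normalisation below divides by roots of \<open>A\<close> and
    \<open>B\<close>, so the degenerate bounds are settled separately: there one factor vanishes
    almost everywhere.\<close>
  consider "A = 0" | "B = 0" | "A > 0" "B > 0" using A B by linarith
  then show ?thesis
  proof cases
    case 1
    then have "AE x in M. f x = 0" using zero[of f p] fA nn by simp
    then have "(\<integral>\<^sup>+x. ennreal (f x * g x) \<partial>M) = 0"
      by (subst nn_integral_0_iff_AE) auto
    then show ?thesis by simp
  next
    case 2
    then have "AE x in M. g x = 0" using zero[of g q] gB nn by simp
    then have "(\<integral>\<^sup>+x. ennreal (f x * g x) \<partial>M) = 0"
      by (subst nn_integral_0_iff_AE) auto
    then show ?thesis by simp
  next
    case 3
    define a b where "a = A powr (1 / p)" and "b = B powr (1 / q)"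
    have ab: "a > 0" "b > 0" "a powr p = A" "b powr q = B"
      using 3 pq by (auto simp: a_def b_def powr_powr)
    \<comment> \<open>Young's inequality for f / a and g / b, where a^p = A and b^q = B; after
      integration the two terms add up to a b (1/p + 1/q) = a b.\<close>
    have pt: "f x * g x \<le> a * b / (p * A) * f x powr p + a * b / (q * B) * g x powr q" for x
    proof -
      have "(f x / a) * (g x / b) \<le> (f x / a) powr p / p + (g x / b) powr q / q"
        using Youngs_inequality[OF pq, of "f x / a" "g x / b"] nn[of x] ab by simp
      also have "\<dots> = f x powr p / (A * p) + g x powr q / (B * q)"
        using nn[of x] ab by (simp add: powr_divide)
      finally have "a * b * ((f x / a) * (g x / b)) \<le> a * b * (f x powr p / (A * p) + g x powr q / (B * q))"
        using ab by (intro mult_left_mono) auto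
      then show ?thesis using ab by (simp add: field_simps)
    qed
    have "(\<integral>\<^sup>+x. ennreal (f x * g x) \<partial>M)
       \<le> (\<integral>\<^sup>+x. ennreal (a * b / (p * A)) * ennreal (f x powr p)
             + ennreal (a * b / (q * B)) * ennreal (g x powr q) \<partial>M)"
      using pt ab pq 3 by (intro nn_integral_mono) (simp flip: ennreal_mult ennreal_plus)
    also have "\<dots> = ennreal (a * b / (p * A)) * (\<integral>\<^sup>+x. ennreal (f x powr p) \<partial>M)
             + ennreal (a * b / (q * B)) * (\<integral>\<^sup>+x. ennreal (g x powr q) \<partial>M)"
      by (simp add: nn_integral_add nn_integral_cmult)
    also have "\<dots> \<le> ennreal (a * b / (p * A)) * ennreal A + ennreal (a * b / (q * B)) * ennreal B"
      by (intro add_mono mult_left_mono fA gB) auto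
    also have "\<dots> = ennreal (a * b / p + a * b / q)"
      using ab pq 3 by (simp flip: ennreal_mult ennreal_plus)
    also have "a * b / p + a * b / q = a * b * (1 / p + 1 / q)" by (simp add: algebra_simps)
    finally show ?thesis using pq by (simp add: a_def b_def)
  qed
qed

section \<open>Tonelli's theorem for families of parallel segments\<close>

lemma nn_integral_lborel_shift:
  fixes F :: "'a::euclidean_space \<Rightarrow> ennreal"
  assumes [measurable]: "F \<in> borel_measurable borel"
  shows "(\<integral>\<^sup>+x. F (x + c) \<partial>lborel) = (\<integral>\<^sup>+x. F x \<partial>lborel)"
proof -
  have "(\<integral>\<^sup>+x. F x \<partial>lborel) = (\<integral>\<^sup>+x. F x \<partial>distr lborel borel ((+) c))"
    by (simp add: lborel_distr_plus)
  also have "\<dots> = (\<integral>\<^sup>+x. F (c + x) \<partial>lborel)"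
    by (subst nn_integral_distr) auto
  finally show ?thesis by (simp add: add.commute)
qed

text \<open>For fixed t the shift by t h preserves Lebesgue measure and moves the relevant y into G,
  so Tonelli leaves one copy of the integral over G for each t in {0..R}. The set \<open>S\<close>
  and the length \<open>l\<close> are traded for this range of t beforehand, so that the integrand
  whose order is exchanged involves only F and G.\<close>

lemma nn_integral_shear:
  fixes F :: "'a::euclidean_space \<Rightarrow> ennreal"
  assumes [measurable]: "F \<in> borel_measurable borel" and "open G"
    and seg: "\<And>y t. y \<in> S \<Longrightarrow> 0 \<le> t \<Longrightarrow> t < l y \<Longrightarrow> y + t *\<^sub>R h \<in> G"
    and le: "\<And>y. y \<in> S \<Longrightarrow> l y \<le> R" and "0 \<le> R"
  shows "(\<integral>\<^sup>+y\<in>S. (\<integral>\<^sup>+t\<in>{0..<l y}. F (y + t *\<^sub>R h) \<partial>lborel) \<partial>lborel) \<le> ennreal R * (\<integral>\<^sup>+x\<in>G. F x \<partial>lborel)"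
proof -
  have [measurable]: "G \<in> sets borel" using \<open>open G\<close> by simp
  define f where "f x = F x * indicator G x" for x
  have [measurable]: "f \<in> borel_measurable borel" unfolding f_def by measurable
  have "(\<integral>\<^sup>+y\<in>S. (\<integral>\<^sup>+t\<in>{0..<l y}. F (y + t *\<^sub>R h) \<partial>lborel) \<partial>lborel)
      \<le> (\<integral>\<^sup>+y. (\<integral>\<^sup>+t. f (y + t *\<^sub>R h) * indicator {0..R} t \<partial>lborel) \<partial>lborel)"
  proof (intro nn_integral_mono)
    fix y :: 'a
    show "(\<integral>\<^sup>+t\<in>{0..<l y}. F (y + t *\<^sub>R h) \<partial>lborel) * indicator S y
       \<le> (\<integral>\<^sup>+t. f (y + t *\<^sub>R h) * indicator {0..R} t \<partial>lborel)"
    proof (cases "y \<in> S")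
      case True
      have "(\<integral>\<^sup>+t\<in>{0..<l y}. F (y + t *\<^sub>R h) \<partial>lborel) \<le> (\<integral>\<^sup>+t. f (y + t *\<^sub>R h) * indicator {0..R} t \<partial>lborel)"
        using seg[OF True] le[OF True] by (intro nn_integral_mono) (auto simp: f_def indicator_def)
      then show ?thesis using True by simp
    qed simp
  qed
  also have "\<dots> = (\<integral>\<^sup>+t. (\<integral>\<^sup>+y. f (y + t *\<^sub>R h) * indicator {0..R} t \<partial>lborel) \<partial>lborel)"
    by (rule lborel_pair.Fubini') measurable
  also have "\<dots> = (\<integral>\<^sup>+t. (\<integral>\<^sup>+x. f x \<partial>lborel) * indicator {0..R} t \<partial>lborel)"
    by (intro nn_integral_cong) (simp add: nn_integral_multc nn_integral_lborel_shift)
  also have "\<dots> = (\<integral>\<^sup>+x. f x \<partial>lborel) * ennreal R"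
    using \<open>0 \<le> R\<close> by (simp add: nn_integral_cmult_indicator)
  finally show ?thesis by (simp add: f_def mult.commute)
qed

text \<open>With \<beta> = \<alpha> p / (p - 1) this is the integral of (\<kappa> s)^(-\<beta>) over
  0 < s < R, raised to the power p - 1 = p / q with q conjugate to p: the factor that Hoelder's
  inequality splits off on a segment.\<close>

definition line_const :: "real \<Rightarrow> real \<Rightarrow> real \<Rightarrow> real \<Rightarrow> real" where
  "line_const p \<alpha> \<kappa> R =
     (\<kappa> powr (- (\<alpha> * p / (p - 1))) * (R powr (1 - \<alpha> * p / (p - 1)) / (1 - \<alpha> * p / (p - 1)))) powr (p - 1)"

text \<open>The meaning of the bound on \<alpha>: the negative power of the distance that Hoelder's
  inequality produces is integrable up to the boundary.\<close>

lemma weight_exponent_less_1: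
  assumes "1 < (p::real)" "\<alpha> < (p - 1) / p"
  shows "\<alpha> * p / (p - 1) < 1"
  using assms by (simp add: field_simps)

lemma line_const_pos:
  assumes "1 < p" "\<alpha> < (p - 1) / p" "0 < \<kappa>" "0 < R"
  shows "0 < line_const p \<alpha> \<kappa> R"
proof -
  have "0 < \<kappa> powr (- (\<alpha> * p / (p - 1))) * (R powr (1 - \<alpha> * p / (p - 1)) / (1 - \<alpha> * p / (p - 1)))"
    using weight_exponent_less_1[OF assms(1,2)] assms(3,4)
    by (intro mult_pos_pos divide_pos_pos) auto
  then show ?thesis unfolding line_const_def by (metis powr_gt_zero less_irrefl)
qed

lemma nn_integral_powr_reflected:
  fixes \<beta> :: real
  assumes "0 \<le> \<beta>" "\<beta> < 1" "0 < \<kappa>" "0 \<le> l" "l \<le> R"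
  shows "(\<integral>\<^sup>+t\<in>{0..<l}. ennreal ((\<kappa> * (l - t)) powr (- \<beta>)) \<partial>lborel)
     \<le> ennreal (\<kappa> powr (- \<beta>) * (R powr (1 - \<beta>) / (1 - \<beta>)))"
proof -
  have "((\<lambda>x. x powr (-\<beta>)) has_integral l powr (1 - \<beta>) / (1 - \<beta>)) {0..l}"
    using has_integral_powr_from_0[of "-\<beta>" l] assms by simp
  then have I: "(\<integral>\<^sup>+x. ennreal (indicat_real {0..l} x * x powr (-\<beta>)) \<partial>lborel) = ennreal (l powr (1 - \<beta>) / (1 - \<beta>))"
    by (rule nn_integral_has_integral_lebesgue[rotated]) auto
  have "(\<integral>\<^sup>+t\<in>{0..<l}. ennreal ((\<kappa> * (l - t)) powr (- \<beta>)) \<partial>lborel)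
      \<le> (\<integral>\<^sup>+t. ennreal (\<kappa> powr (-\<beta>)) * ennreal (indicat_real {0..l} (l + (-1) * t) * (l + (-1) * t) powr (-\<beta>)) \<partial>lborel)"
    using assms by (intro nn_integral_mono) (auto simp: indicator_def powr_mult simp flip: ennreal_mult)
  also have "\<dots> = ennreal (\<kappa> powr (-\<beta>)) * (\<integral>\<^sup>+t. ennreal (indicat_real {0..l} (l + (-1) * t) * (l + (-1) * t) powr (-\<beta>)) \<partial>lborel)"
    by (rule nn_integral_cmult) measurable
  also have "(\<integral>\<^sup>+t. ennreal (indicat_real {0..l} (l + (-1) * t) * (l + (-1) * t) powr (-\<beta>)) \<partial>lborel)
     = (\<integral>\<^sup>+x. ennreal (indicat_real {0..l} x * x powr (-\<beta>)) \<partial>lborel)"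
    by (subst nn_integral_real_affine[where c="-1" and t=l]) auto
  also have "ennreal (\<kappa> powr (-\<beta>)) * \<dots> = ennreal (\<kappa> powr (- \<beta>) * (l powr (1 - \<beta>) / (1 - \<beta>)))"
    unfolding I using assms by (simp flip: ennreal_mult)
  also have "\<dots> \<le> ennreal (\<kappa> powr (- \<beta>) * (R powr (1 - \<beta>) / (1 - \<beta>)))"
    using assms by (intro ennreal_leI mult_left_mono divide_right_mono powr_mono2) auto
  finally show ?thesis .
qed

text \<open>Splitting a = (d^\<alpha> a) d^(-\<alpha>) and applying Hoelder isolates the weighted
  integrand; the lower bound on d then replaces the second factor by an explicit power of l - t with
  integrable q-th power. In the application \<open>x\<close> is the length of an increment and
  \<open>H\<close> that of the direction vector.\<close>

lemma weighted_line_bound: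
  fixes a d :: "real \<Rightarrow> real"
  assumes p: "1 < p" and \<alpha>: "0 \<le> \<alpha>" "\<alpha> < (p - 1) / p" and "0 < \<kappa>" "0 \<le> l" "l \<le> R" "0 < R" "0 \<le> H"
    and [measurable]: "a \<in> borel_measurable borel" "d \<in> borel_measurable borel"
    and a: "\<And>t. 0 \<le> a t"
    and d: "\<And>t. 0 \<le> t \<Longrightarrow> t < l \<Longrightarrow> \<kappa> * (l - t) \<le> d t"
    and x: "0 \<le> x" "ennreal x \<le> ennreal H * (\<integral>\<^sup>+t\<in>{0..<l}. ennreal (a t) \<partial>lborel)"
  shows "ennreal (x powr p) \<le> ennreal (H powr p * line_const p \<alpha> \<kappa> R)
           * (\<integral>\<^sup>+t\<in>{0..<l}. ennreal ((d t powr \<alpha> * a t) powr p) \<partial>lborel)"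
    (is "_ \<le> ennreal ?C * ?I")
proof -
  define q where "q = p / (p - 1)"
  have q: "1 < q" "1 / p + 1 / q = 1" using p by (auto simp: q_def field_simps)
  define \<beta> where "\<beta> = \<alpha> * p / (p - 1)"
  have \<beta>: "0 \<le> \<beta>" "\<beta> < 1" using weight_exponent_less_1[OF p \<alpha>(2)] \<alpha> p by (auto simp: \<beta>_def)
  define K where "K = \<kappa> powr (- \<beta>) * (R powr (1 - \<beta>) / (1 - \<beta>))"
  have K: "K > 0" using \<beta> assms by (simp add: K_def)
  have lc: "line_const p \<alpha> \<kappa> R = K powr (p - 1)" by (simp add: line_const_def K_def \<beta>_def)
  show ?thesis
  proof (cases "?I = \<infinity>")
    case True
    then show ?thesis
    \<comment> \<open>In the extended reals 0 * \<infinity> = 0, so an infinite integral does not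
      settle \<open>H = 0\<close>; there \<open>x\<close> itself is 0.\<close>
    proof (cases "H = 0")
      case True
      then show ?thesis using x by simp
    next
      case False
      then have "?C > 0" using line_const_pos[OF p \<alpha>(2) \<open>0 < \<kappa>\<close> \<open>0 < R\<close>] \<open>0 \<le> H\<close> by simp
      then have "ennreal ?C \<noteq> 0" by (metis ennreal_eq_0_iff not_le)
      then have "ennreal ?C * ?I = \<infinity>" using True by (simp add: ennreal_mult_top)
      then show ?thesis by simp
    qed
  next
    case False
    then obtain A where A: "A \<ge> 0" "?I = ennreal A" by (cases ?I) auto
    define f where "f t = (d t powr \<alpha> * a t) * indicator {0..<l} t" for t
    define g where "g t = (\<kappa> * (l - t)) powr (-\<alpha>) * indicator {0..<l} t" for t
    have "(\<integral>\<^sup>+t. ennreal (f t * g t) \<partial>lborel) \<le> ennreal (A powr (1 / p) * K powr (1 / q))"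
    proof (rule nn_integral_Holder[OF p q])
      show "f \<in> borel_measurable lborel" "g \<in> borel_measurable lborel"
        unfolding f_def g_def by measurable
      show "0 \<le> f t" "0 \<le> g t" for t by (auto simp: f_def g_def a)
      have "(\<integral>\<^sup>+t. ennreal (f t powr p) \<partial>lborel) = ?I"
        by (intro nn_integral_cong) (auto simp: f_def indicator_def)
      then show "(\<integral>\<^sup>+t. ennreal (f t powr p) \<partial>lborel) \<le> ennreal A" using A by simp
      have "(\<integral>\<^sup>+t. ennreal (g t powr q) \<partial>lborel) = (\<integral>\<^sup>+t\<in>{0..<l}. ennreal ((\<kappa> * (l - t)) powr (- \<beta>)) \<partial>lborel)"
        using \<open>0 < \<kappa>\<close> by (intro nn_integral_cong) (auto simp: g_def indicator_def powr_powr q_def \<beta>_def)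
      also have "\<dots> \<le> ennreal K"
        unfolding K_def using \<beta> assms by (intro nn_integral_powr_reflected) auto
      finally show "(\<integral>\<^sup>+t. ennreal (g t powr q) \<partial>lborel) \<le> ennreal K" .
    qed (use A K in auto)
    moreover have "(\<integral>\<^sup>+t\<in>{0..<l}. ennreal (a t) \<partial>lborel) \<le> (\<integral>\<^sup>+t. ennreal (f t * g t) \<partial>lborel)"
    proof (intro nn_integral_mono)
      fix t
      show "ennreal (a t) * indicator {0..<l} t \<le> ennreal (f t * g t)"
      proof (cases "0 \<le> t \<and> t < l")
        case True
        then have pos: "0 < \<kappa> * (l - t)" using \<open>0 < \<kappa>\<close> by simp
        have "(\<kappa> * (l - t)) powr \<alpha> \<le> d t powr \<alpha>" using d[of t] True pos \<alpha> by (intro powr_mono2) auto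
        then have "1 \<le> d t powr \<alpha> * (\<kappa> * (l - t)) powr (- \<alpha>)"
          using pos by (simp only: powr_minus divide_inverse[symmetric] le_divide_eq_1_pos powr_gt_zero)
        then have "a t * 1 \<le> a t * (d t powr \<alpha> * (\<kappa> * (l - t)) powr (- \<alpha>))"
          using a by (intro mult_left_mono)
        then show ?thesis using True by (auto simp: f_def g_def indicator_def ac_simps intro!: ennreal_leI)
      qed (auto simp: indicator_def)
    qed
    ultimately have "ennreal x \<le> ennreal H * ennreal (A powr (1 / p) * K powr (1 / q))"
      using x(2) by (meson mult_left_mono order_trans zero_le)
    then have "x \<le> H * (A powr (1 / p) * K powr (1 / q))"
      using \<open>0 \<le> H\<close> by (simp flip: ennreal_mult)
    then have "x powr p \<le> (H * (A powr (1 / p) * K powr (1 / q))) powr p"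
      using x p by (intro powr_mono2) auto
    also have "\<dots> = H powr p * (A * K powr (p / q))"
      using p A \<open>0 \<le> H\<close> by (simp add: powr_mult powr_powr)
    also have "p / q = p - 1" using p by (simp add: q_def)
    finally have "ennreal (x powr p) \<le> ennreal (H powr p * (A * K powr (p - 1)))" by (rule ennreal_leI)
    then show ?thesis
      unfolding A(2) lc using A(1) by (simp add: mult.assoc mult.left_commute mult.commute flip: ennreal_mult)
  qed
qed

text \<open>The interior part of \<open>has_trace\<close>, in the form that line integrals need: v
  and V are Borel on the whole space, so that shifts stay measurable, and the approximants are
  continuously differentiable. The convergence is unweighted and in L^1.\<close>

definition smooth_approx ::
    "(real^'n) set \<Rightarrow> (real^'n \<Rightarrow> real^'n) \<Rightarrow> (real^'n \<Rightarrow> real^'n^'n) \<Rightarrow> (nat \<Rightarrow> real^'n \<Rightarrow> real^'n) \<Rightarrow> bool" where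
  "smooth_approx G v V u \<longleftrightarrow>
     v \<in> borel_measurable borel \<and> V \<in> borel_measurable borel \<and>
     (\<forall>k x. u k differentiable (at x)) \<and> (\<forall>k. continuous_on UNIV (\<lambda>x. jacobian (u k) (at x))) \<and>
     (\<lambda>k. \<integral>\<^sup>+x\<in>G. ennreal (norm (u k x - v x)) \<partial>lborel) \<longlonglongrightarrow> 0 \<and>
     (\<lambda>k. \<integral>\<^sup>+x\<in>G. ennreal (norm (jacobian (u k) (at x) - V x)) \<partial>lborel) \<longlonglongrightarrow> 0"

definition weighted_energy :: "real \<Rightarrow> real \<Rightarrow> (real^'n) set \<Rightarrow> (real^'n \<Rightarrow> real^'n^'n) \<Rightarrow> ennreal" where
  "weighted_energy p \<alpha> G V = (\<integral>\<^sup>+x\<in>G. ennreal ((boundary_weight \<alpha> G x * norm (V x)) powr p) \<partial>lborel)"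

lemma borel_measurable_infdist [measurable]:
  "(\<lambda>x. infdist x A) \<in> borel_measurable borel"
  by (intro borel_measurable_continuous_onI continuous_intros)

lemma borel_measurable_boundary_weight [measurable]:
  "boundary_weight \<alpha> G \<in> borel_measurable borel"
  unfolding boundary_weight_def[abs_def] by measurable

lemma norm_matrix_vector_mult_le:
  fixes A :: "real^'n^'m"
  shows "norm (A *v x) \<le> norm A * norm x"
proof -
  have "\<bar>(A *v x) $ i\<bar> \<le> norm (A $ i) * norm x" for i
    using Cauchy_Schwarz_ineq2[of "A $ i" x] by (simp add: matrix_vector_mult_def inner_vec_def)
  then have "L2_set (\<lambda>i. norm ((A *v x) $ i)) UNIV \<le> L2_set (\<lambda>i. norm (A $ i) * norm x) UNIV"
    by (intro L2_set_mono) auto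
  also have "\<dots> = L2_set (\<lambda>i. norm (A $ i)) UNIV * norm x"
    by (simp add: L2_set_left_distrib)
  finally show ?thesis by (simp add: norm_vec_def)
qed

text \<open>Fundamental theorem of calculus along the segment. The interval is half open because in
  the applications the far end may lie on the frontier, outside G.\<close>

lemma norm_increment_le_line_integral:
  fixes u :: "real^'n \<Rightarrow> real^'m"
  assumes diff: "\<And>x. u differentiable (at x)" and cont: "continuous_on UNIV (\<lambda>x. jacobian u (at x))"
    and "0 \<le> l"
  shows "ennreal (norm (u (y + l *\<^sub>R h) - u y))
     \<le> ennreal (norm h) * (\<integral>\<^sup>+t\<in>{0..<l}. ennreal (norm (jacobian u (at (y + t *\<^sub>R h)))) \<partial>lborel)"
proof -
  define f where "f t = jacobian u (at (y + t *\<^sub>R h)) *v h" for t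
  define g where "g t = norm (jacobian u (at (y + t *\<^sub>R h)))" for t
  have deriv: "((\<lambda>t. u (y + t *\<^sub>R h)) has_vector_derivative f t) (at t within {0..l})" for t
  proof -
    have D: "(u has_derivative (\<lambda>x. jacobian u (at (y + t *\<^sub>R h)) *v x)) (at (y + t *\<^sub>R h))"
      using diff jacobian_works by blast
    have "((\<lambda>t. y + t *\<^sub>R h) has_derivative (\<lambda>s. s *\<^sub>R h)) (at t within {0..l})"
      by (auto intro!: derivative_eq_intros)
    from has_derivative_compose[OF this D] show ?thesis
      unfolding has_vector_derivative_def f_def by (simp add: matrix_vector_mult_scaleR)
  qed
  have jc: "continuous_on {0..l} (\<lambda>t. jacobian u (at (y + t *\<^sub>R h)))"
    by (rule continuous_on_compose2[OF cont]) (auto intro!: continuous_intros)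
  have I: "(f has_integral (u (y + l *\<^sub>R h) - u y)) {0..l}"
    using fundamental_theorem_of_calculus[of 0 l "\<lambda>t. u (y + t *\<^sub>R h)" f] deriv \<open>0 \<le> l\<close> by simp
  have gi: "(\<lambda>t. norm h * g t) integrable_on {0..l}"
    unfolding g_def by (intro integrable_continuous_real continuous_intros jc)
  have "norm (integral {0..l} f) \<le> integral {0..l} (\<lambda>t. norm h * g t)"
    using I gi norm_matrix_vector_mult_le
    by (intro integral_norm_bound_integral) (auto simp: f_def g_def mult.commute has_integral_integrable)
  then have 1: "norm (u (y + l *\<^sub>R h) - u y) \<le> integral {0..l} (\<lambda>t. norm h * g t)"
    using I by (simp add: integral_unique)
  have [measurable]: "g \<in> borel_measurable borel"
    unfolding g_def using cont
    by (intro borel_measurable_continuous_onI continuous_intros continuous_on_compose2[OF cont]) auto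
  have "ennreal (integral {0..l} (\<lambda>t. norm h * g t))
      = (\<integral>\<^sup>+t. ennreal (indicat_real {0..l} t * (norm h * g t)) \<partial>lborel)"
    by (rule nn_integral_has_integral_lebesgue[OF _ integrable_integral[OF gi], symmetric]) (simp add: g_def)
  also have "\<dots> = (\<integral>\<^sup>+t. ennreal (norm h) * (ennreal (g t) * indicator {0..<l} t) \<partial>lborel)"
  proof (intro nn_integral_cong_AE)
    have "AE t in lborel. t \<noteq> l" by (rule AE_lborel_singleton)
    then show "AE t in lborel. ennreal (indicat_real {0..l} t * (norm h * g t))
        = ennreal (norm h) * (ennreal (g t) * indicator {0..<l} t)"
      by eventually_elim (auto simp: indicator_def ennreal_mult g_def)
  qed
  also have "\<dots> = ennreal (norm h) * (\<integral>\<^sup>+t\<in>{0..<l}. ennreal (g t) \<partial>lborel)"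
    by (rule nn_integral_cmult) measurable
  finally have 2: "ennreal (integral {0..l} (\<lambda>t. norm h * g t))
      = ennreal (norm h) * (\<integral>\<^sup>+t\<in>{0..<l}. ennreal (g t) \<partial>lborel)" .
  show ?thesis using ennreal_leI[OF 1] unfolding 2 unfolding g_def .
qed

text \<open>Truncated subtraction does it: the integral of X - J is at most that of
  \<open>a k\<close>, hence 0, and no subsequence has to be extracted. Finiteness of X matters
  because top - top is top in \<open>ennreal\<close>; J may be infinite.\<close>

lemma AE_le_of_nn_integral_tendsto_0:
  fixes X J :: "'a \<Rightarrow> ennreal" and a :: "nat \<Rightarrow> 'a \<Rightarrow> ennreal"
  assumes [measurable]: "X \<in> borel_measurable M" "J \<in> borel_measurable M"
    and fin: "\<And>x. X x \<noteq> top"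
    and le: "\<And>k x. x \<in> space M \<Longrightarrow> X x \<le> J x + a k x"
    and lim: "(\<lambda>k. \<integral>\<^sup>+x. a k x \<partial>M) \<longlonglongrightarrow> 0"
  shows "AE x in M. X x \<le> J x"
proof -
  have "(\<integral>\<^sup>+x. X x - J x \<partial>M) \<le> (\<integral>\<^sup>+x. a k x \<partial>M)" for k
    using le fin by (intro nn_integral_mono) (simp add: ennreal_minus_le_iff add.commute)
  then have "(\<integral>\<^sup>+x. X x - J x \<partial>M) \<le> 0"
    by (intro LIMSEQ_le_const[OF lim]) auto
  then have "AE x in M. X x - J x = 0"
    by (subst nn_integral_0_iff_AE[symmetric]) auto
  then show ?thesis by eventually_elim (simp add: ennreal_minus_eq_0)
qed

lemma measurable_line_integral:
  fixes F :: "'a::euclidean_space \<Rightarrow> ennreal" and l :: "'a \<Rightarrow> real"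
  assumes [measurable]: "F \<in> borel_measurable borel" "l \<in> borel_measurable borel"
  shows "(\<lambda>y. \<integral>\<^sup>+t\<in>{0..<l y}. F (y + t *\<^sub>R h) \<partial>lborel) \<in> borel_measurable borel"
proof -
  have "(\<lambda>y. \<integral>\<^sup>+t. F (y + t *\<^sub>R h) * (if 0 \<le> t \<and> t < l y then 1 else 0) \<partial>lborel) \<in> borel_measurable borel"
    by measurable
  moreover have "(if 0 \<le> t \<and> t < l y then 1 else 0) = (indicator {0..<l y} t :: ennreal)" for t y
    by (auto simp: indicator_def)
  ultimately show ?thesis by simp
qed

text \<open>\<open>w y\<close> plays the role of the value of v at the far end of the segment. That
  \<open>u k\<close> converges to it is an assumption, because the far end may be an interior point,
  where the value is that of v, or a boundary point, where it is that of the trace.\<close>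

lemma line_estimate:
  fixes v w :: "real^'n \<Rightarrow> real^'n"
  assumes p: "1 < p" and \<alpha>: "0 \<le> \<alpha>" "\<alpha> < (p - 1) / p" and "open G"
    and [measurable]: "S \<in> sets borel" and "S \<subseteq> G"
    and [measurable]: "l \<in> borel_measurable borel" "w \<in> borel_measurable borel"
    and l: "\<And>y. y \<in> S \<Longrightarrow> 0 \<le> l y \<and> l y \<le> R" and "0 < R" "0 < \<kappa>"
    and seg: "\<And>y t. y \<in> S \<Longrightarrow> 0 \<le> t \<Longrightarrow> t < l y \<Longrightarrow>
       y + t *\<^sub>R h \<in> G \<and> \<kappa> * (l y - t) \<le> infdist (y + t *\<^sub>R h) (frontier G)"
    and app: "smooth_approx G v V u"
    and lim: "(\<lambda>k. \<integral>\<^sup>+y\<in>S. ennreal (norm (u k (y + l y *\<^sub>R h) - w y)) \<partial>lborel) \<longlonglongrightarrow> 0"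
  shows "(\<integral>\<^sup>+y\<in>S. ennreal (norm (w y - v y) powr p) \<partial>lborel)
     \<le> ennreal (norm h powr p * line_const p \<alpha> \<kappa> R * R) * weighted_energy p \<alpha> G V"
proof -
  have [measurable]: "G \<in> sets borel" using \<open>open G\<close> by simp
  have [measurable]: "v \<in> borel_measurable borel" "V \<in> borel_measurable borel"
    and diff: "\<And>k x. u k differentiable (at x)"
    and cont: "\<And>k. continuous_on UNIV (\<lambda>x. jacobian (u k) (at x))"
    and lim1: "(\<lambda>k. \<integral>\<^sup>+x\<in>G. ennreal (norm (u k x - v x)) \<partial>lborel) \<longlonglongrightarrow> 0"
    and lim2: "(\<lambda>k. \<integral>\<^sup>+x\<in>G. ennreal (norm (jacobian (u k) (at x) - V x)) \<partial>lborel) \<longlonglongrightarrow> 0"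
    using app by (auto simp: smooth_approx_def)
  have [measurable]: "(\<lambda>x. jacobian (u k) (at x)) \<in> borel_measurable borel" for k
    using cont by (rule borel_measurable_continuous_onI)
  have [measurable]: "u k \<in> borel_measurable borel" for k
    using diff by (intro borel_measurable_continuous_onI) (auto intro!: continuous_at_imp_continuous_on differentiable_imp_continuous_within)
  define T where "T F y = (\<integral>\<^sup>+t\<in>{0..<l y}. F (y + t *\<^sub>R h) \<partial>lborel)" for F :: "real^'n \<Rightarrow> ennreal" and y
  have [measurable]: "T F \<in> borel_measurable borel" if "F \<in> borel_measurable borel" for F
    unfolding T_def using measurable_line_integral[OF that, of l h] by simp
  have shear: "(\<integral>\<^sup>+y\<in>S. T F y \<partial>lborel) \<le> ennreal R * (\<integral>\<^sup>+x\<in>G. F x \<partial>lborel)"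
    if "F \<in> borel_measurable borel" for F
    unfolding T_def using nn_integral_shear[OF that \<open>open G\<close>, of S l h R] seg l \<open>0 < R\<close> by auto
  define d where "d k x = ennreal (norm (jacobian (u k) (at x) - V x))" for k x
  have [measurable]: "d k \<in> borel_measurable borel" for k unfolding d_def by measurable
  \<comment> \<open>The error of replacing \<open>u k\<close> by its limit: at the far end, at the
    near end, and in the Jacobian along the segment. Each part tends to 0 in L^1 over
    \<open>S\<close>, the last one by the shear bound.\<close>
  define a where "a k y = ennreal (norm (u k (y + l y *\<^sub>R h) - w y)) + ennreal (norm (u k y - v y))
     + ennreal (norm h) * T (d k) y" for k y
  define J where "J y = ennreal (norm h) * T (\<lambda>x. ennreal (norm (V x))) y" for y
  have [measurable]: "a k \<in> borel_measurable borel" "J \<in> borel_measurable borel" for k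
    unfolding a_def J_def by measurable
  have pt: "ennreal (norm (w y - v y)) \<le> J y + a k y" if y: "y \<in> S" for y k
  proof -
    let ?D = "\<lambda>x. ennreal (norm (jacobian (u k) (at x)))"
    have "norm (w y - v y) \<le> norm (u k (y + l y *\<^sub>R h) - u k y) + norm (u k (y + l y *\<^sub>R h) - w y) + norm (u k y - v y)"
    proof -
      have "w y - v y = (u k (y + l y *\<^sub>R h) - u k y) - (u k (y + l y *\<^sub>R h) - w y) + (u k y - v y)" by simp
      then show ?thesis
        using norm_triangle_ineq[of "(u k (y + l y *\<^sub>R h) - u k y) - (u k (y + l y *\<^sub>R h) - w y)" "u k y - v y"]
          norm_triangle_ineq4[of "u k (y + l y *\<^sub>R h) - u k y" "u k (y + l y *\<^sub>R h) - w y"] by simp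
    qed
    then have "ennreal (norm (w y - v y)) \<le> ennreal (norm (u k (y + l y *\<^sub>R h) - u k y))
      + ennreal (norm (u k (y + l y *\<^sub>R h) - w y)) + ennreal (norm (u k y - v y))"
      by (simp flip: ennreal_plus add: ennreal_leI)
    moreover have "ennreal (norm (u k (y + l y *\<^sub>R h) - u k y)) \<le> ennreal (norm h) * T ?D y"
      unfolding T_def using l[OF y] by (intro norm_increment_le_line_integral diff cont) auto
    moreover have "T ?D y \<le> T (\<lambda>x. ennreal (norm (V x))) y + T (d k) y"
    proof -
      have "T ?D y \<le> (\<integral>\<^sup>+t. ennreal (norm (V (y + t *\<^sub>R h))) * indicator {0..<l y} t + d k (y + t *\<^sub>R h) * indicator {0..<l y} t \<partial>lborel)"
        unfolding T_def
      proof (intro nn_integral_mono)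
        fix t
        have "norm (jacobian (u k) (at (y + t *\<^sub>R h))) \<le> norm (V (y + t *\<^sub>R h)) + norm (jacobian (u k) (at (y + t *\<^sub>R h)) - V (y + t *\<^sub>R h))"
          by (simp add: norm_triangle_sub)
        then show "?D (y + t *\<^sub>R h) * indicator {0..<l y} t
          \<le> ennreal (norm (V (y + t *\<^sub>R h))) * indicator {0..<l y} t + d k (y + t *\<^sub>R h) * indicator {0..<l y} t"
          by (simp add: d_def indicator_def ennreal_leI flip: ennreal_plus)
      qed
      also have "\<dots> = T (\<lambda>x. ennreal (norm (V x))) y + T (d k) y"
        unfolding T_def by (rule nn_integral_add) measurable
      finally show ?thesis .
    qed
    ultimately have "ennreal (norm (w y - v y)) \<le> ennreal (norm h) * (T (\<lambda>x. ennreal (norm (V x))) y + T (d k) y)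
      + ennreal (norm (u k (y + l y *\<^sub>R h) - w y)) + ennreal (norm (u k y - v y))"
      by (meson add_right_mono mult_left_mono order_trans zero_le)
    then show ?thesis by (simp add: J_def a_def distrib_left ac_simps)
  qed
  have "(\<integral>\<^sup>+y. a k y * indicator S y \<partial>lborel) = (\<integral>\<^sup>+y\<in>S. ennreal (norm (u k (y + l y *\<^sub>R h) - w y)) \<partial>lborel)
     + (\<integral>\<^sup>+y\<in>S. ennreal (norm (u k y - v y)) \<partial>lborel) + ennreal (norm h) * (\<integral>\<^sup>+y\<in>S. T (d k) y \<partial>lborel)" for k
    unfolding a_def by (simp add: distrib_right nn_integral_add nn_integral_cmult mult.assoc)
  moreover have "(\<integral>\<^sup>+y\<in>S. ennreal (norm (u k y - v y)) \<partial>lborel) \<le> (\<integral>\<^sup>+y\<in>G. ennreal (norm (u k y - v y)) \<partial>lborel)" for k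
    using \<open>S \<subseteq> G\<close> by (intro nn_integral_mono) (auto simp: indicator_def)
  moreover have "ennreal (norm h) * (\<integral>\<^sup>+y\<in>S. T (d k) y \<partial>lborel) \<le> ennreal (norm h) * (ennreal R * (\<integral>\<^sup>+x\<in>G. d k x \<partial>lborel))" for k
    by (intro mult_left_mono shear) auto
  ultimately have le: "(\<integral>\<^sup>+y. a k y * indicator S y \<partial>lborel) \<le> (\<integral>\<^sup>+y\<in>S. ennreal (norm (u k (y + l y *\<^sub>R h) - w y)) \<partial>lborel)
     + (\<integral>\<^sup>+y\<in>G. ennreal (norm (u k y - v y)) \<partial>lborel) + ennreal (norm h) * (ennreal R * (\<integral>\<^sup>+x\<in>G. d k x \<partial>lborel))" (is "_ \<le> ?b k") for k
    by (simp add: add_mono)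
  have "?b \<longlonglongrightarrow> 0 + 0 + ennreal (norm h) * (ennreal R * 0)"
    unfolding d_def
    by (intro tendsto_add lim lim1 tendsto_mult_ennreal tendsto_const lim2) (auto simp: ennreal_top_mult)
  then have "?b \<longlonglongrightarrow> 0" by simp
  then have "(\<lambda>k. \<integral>\<^sup>+y. a k y * indicator S y \<partial>lborel) \<longlonglongrightarrow> 0"
    by (rule tendsto_sandwich[OF _ _ tendsto_const, rotated 2]) (auto intro!: always_eventually le)
  then have "AE y in lborel. ennreal (norm (w y - v y)) * indicator S y \<le> J y"
    by (rule AE_le_of_nn_integral_tendsto_0[rotated 4])
       (use pt in \<open>auto simp: indicator_def\<close>)
  \<comment> \<open>Hoelder is applied on almost every segment to the limit Jacobian; a weighted
    energy of \<open>u k\<close> never occurs.\<close>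
  then have ae: "AE y in lborel. ennreal (norm (w y - v y) powr p) * indicator S y
     \<le> ennreal (norm h powr p * line_const p \<alpha> \<kappa> R) *
        (T (\<lambda>x. ennreal ((boundary_weight \<alpha> G x * norm (V x)) powr p)) y * indicator S y)"
  proof eventually_elim
    case (elim y)
    show ?case
    proof (cases "y \<in> S")
      case True
      have "ennreal (norm (w y - v y) powr p) \<le> ennreal (norm h powr p * line_const p \<alpha> \<kappa> R) *
          (\<integral>\<^sup>+t\<in>{0..<l y}. ennreal ((infdist (y + t *\<^sub>R h) (frontier G) powr \<alpha> * norm (V (y + t *\<^sub>R h))) powr p) \<partial>lborel)"
        by (rule weighted_line_bound) (use True elim p \<alpha> l[OF True] \<open>0 < R\<close> \<open>0 < \<kappa>\<close> seg[OF True] in \<open>auto simp: J_def T_def\<close>)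
      then show ?thesis using True by (simp add: T_def boundary_weight_def)
    qed simp
  qed
  have [measurable]: "(\<lambda>x. ennreal ((boundary_weight \<alpha> G x * norm (V x)) powr p)) \<in> borel_measurable borel"
    by measurable
  have "(\<integral>\<^sup>+y\<in>S. ennreal (norm (w y - v y) powr p) \<partial>lborel)
      \<le> (\<integral>\<^sup>+y. ennreal (norm h powr p * line_const p \<alpha> \<kappa> R) *
        (T (\<lambda>x. ennreal ((boundary_weight \<alpha> G x * norm (V x)) powr p)) y * indicator S y) \<partial>lborel)"
    by (rule nn_integral_mono_AE) (rule ae)
  also have "\<dots> = ennreal (norm h powr p * line_const p \<alpha> \<kappa> R) *
      (\<integral>\<^sup>+y\<in>S. T (\<lambda>x. ennreal ((boundary_weight \<alpha> G x * norm (V x)) powr p)) y \<partial>lborel)"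
    by (rule nn_integral_cmult) measurable
  also have "\<dots> \<le> ennreal (norm h powr p * line_const p \<alpha> \<kappa> R) * (ennreal R * weighted_energy p \<alpha> G V)"
    unfolding weighted_energy_def by (intro mult_left_mono shear) auto
  also have "\<dots> = ennreal (norm h powr p * line_const p \<alpha> \<kappa> R * R) * weighted_energy p \<alpha> G V"
    using \<open>0 < R\<close> by (simp add: ennreal_mult' mult.assoc ac_simps)
  finally show ?thesis .
qed

section \<open>Projection along an axis and the Hausdorff measure\<close>

text \<open>The points that a shift by at most \<open>R\<close> along \<open>e\<close> moves into a set of diameter \<open>d\<close> lie in a tube covered by
  at most \<open>R / d + 1\<close> balls of radius \<open>2 * d\<close>; its measure is therefore of order \<open>d\<close> to the power \<open>DIM('a) - 1\<close>.\<close>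

lemma tube_cover_pos:
  fixes c e :: "'a::euclidean_space"
  assumes "norm e = 1" "0 < d" "d \<le> 1" "0 \<le> R"
  shows "\<exists>B\<in>sets borel. {y. \<exists>t\<in>{0..R}. norm (y + t *\<^sub>R e - c) \<le> d} \<subseteq> B \<and>
     emeasure lborel B \<le> ennreal ((R + 1) * unit_ball_vol (DIM('a)) * 2 ^ DIM('a) * d ^ (DIM('a) - 1))"
proof -
  define m where "m = nat \<lfloor>R / d\<rfloor>"
  have m: "real m \<le> R / d" using assms by (simp add: m_def)
  define B where "B = (\<Union>j\<le>m. cball (c - (real j * d) *\<^sub>R e) (2 * d))"
  have "{y. \<exists>t\<in>{0..R}. norm (y + t *\<^sub>R e - c) \<le> d} \<subseteq> B"
  proof clarify
    fix y t assume t: "t \<in> {0..R}" and y: "norm (y + t *\<^sub>R e - c) \<le> d"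
    define j where "j = nat \<lfloor>t / d\<rfloor>"
    have j: "j \<le> m" unfolding j_def m_def using t assms by (intro nat_mono floor_mono divide_right_mono) auto
    have "real j = of_int \<lfloor>t / d\<rfloor>" using t assms by (simp add: j_def)
    then have "real j \<le> t / d" "t / d < real j + 1" by linarith+
    then have r: "0 \<le> t - real j * d" "t - real j * d \<le> d" using assms by (auto simp: field_simps)
    have "c - (real j * d) *\<^sub>R e - y = (t - real j * d) *\<^sub>R e - (y + t *\<^sub>R e - c)"
      by (simp add: algebra_simps)
    also have "norm \<dots> \<le> (t - real j * d) + d"
      using norm_triangle_ineq4[of "(t - real j * d) *\<^sub>R e" "y + t *\<^sub>R e - c"] y r assms by simp
    finally have "y \<in> cball (c - (real j * d) *\<^sub>R e) (2 * d)"
      using r by (simp add: dist_norm)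
    then show "y \<in> B" using j by (auto simp: B_def)
  qed
  moreover have "emeasure lborel B \<le> ennreal ((R + 1) * unit_ball_vol (DIM('a)) * 2 ^ DIM('a) * d ^ (DIM('a) - 1))"
  proof -
    have "emeasure lborel B \<le> (\<Sum>j\<le>m. emeasure lborel (cball (c - (real j * d) *\<^sub>R e) (2 * d)))"
      unfolding B_def by (intro emeasure_subadditive_finite) auto
    also have "\<dots> = ennreal ((real m + 1) * (unit_ball_vol (DIM('a)) * (2 * d) ^ DIM('a)))"
      using assms by (simp add: emeasure_cball ennreal_mult' ennreal_of_nat_eq_real_of_nat add.commute flip: ennreal_plus)
    also have "\<dots> \<le> ennreal ((R / d + 1) * (unit_ball_vol (DIM('a)) * (2 * d) ^ DIM('a)))"
      using assms m by (intro ennreal_leI mult_right_mono) auto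
    also have "(R / d + 1) * (unit_ball_vol (DIM('a)) * (2 * d) ^ DIM('a))
        = (R + d) * unit_ball_vol (DIM('a)) * 2 ^ DIM('a) * d ^ (DIM('a) - 1)"
    proof -
      have "d ^ DIM('a) = d * d ^ (DIM('a) - 1)" using DIM_positive[where 'a='a] by (metis power_minus_mult mult.commute)
      moreover have "(R / d + 1) * d = R + d" using assms by (simp add: field_simps)
      ultimately show ?thesis by (simp add: power_mult_distrib ac_simps)
    qed
    also have "\<dots> \<le> (R + 1) * unit_ball_vol (DIM('a)) * 2 ^ DIM('a) * d ^ (DIM('a) - 1)"
      using assms by (intro mult_right_mono) auto
    finally show ?thesis using assms by (simp add: ennreal_leI)
  qed
  moreover have "B \<in> sets borel" by (simp add: B_def)
  ultimately show ?thesis by blast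
qed

text \<open>A covering set may be a single point, of diameter 0, and then the balls of radius
  \<open>2 * d\<close> degenerate. The tube is a segment in that case; intersecting the covers for
  radii tending to 0 gives a null set, since \<open>0 ^ (DIM('a) - 1)\<close> is 0 in dimension at
  least 2.\<close>

lemma tube_cover:
  fixes c e :: "'a::euclidean_space"
  assumes "norm e = 1" "0 \<le> d" "d \<le> 1" "0 \<le> R" and dim: "2 \<le> DIM('a)"
  shows "\<exists>B\<in>sets borel. {y. \<exists>t\<in>{0..R}. norm (y + t *\<^sub>R e - c) \<le> d} \<subseteq> B \<and>
     emeasure lborel B \<le> ennreal ((R + 1) * unit_ball_vol (DIM('a)) * 2 ^ DIM('a) * d ^ (DIM('a) - 1))"
proof (cases "d = 0")
  case True
  let ?T = "\<lambda>d. {y. \<exists>t\<in>{0..R}. norm (y + t *\<^sub>R e - c) \<le> d}"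
  let ?K = "(R + 1) * unit_ball_vol (DIM('a)) * 2 ^ DIM('a)"
  define s where "s k = 1 / (real k + 1)" for k
  have s: "0 < s k" "s k \<le> 1" for k by (auto simp: s_def)
  have "\<forall>k. \<exists>B. B \<in> sets borel \<and> ?T (s k) \<subseteq> B \<and> emeasure lborel B \<le> ennreal (?K * s k ^ (DIM('a) - 1))"
    unfolding Bex_def[symmetric] using tube_cover_pos[OF assms(1) s assms(4)] by (intro allI)
  from choice[OF this] obtain B where B: "\<And>k. B k \<in> sets borel" "\<And>k. ?T (s k) \<subseteq> B k"
    "\<And>k. emeasure lborel (B k) \<le> ennreal (?K * s k ^ (DIM('a) - 1))"
    by blast
  have sub: "?T 0 \<subseteq> (\<Inter>k. B k)"
  proof -
    have "?T 0 \<subseteq> ?T (s k)" for k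
      using less_imp_le[OF s(1)[of k]] by (intro Collect_mono impI) (erule bexE, rule bexI, rule order_trans)
    then show ?thesis using B(2) by blast
  qed
  have "emeasure lborel (\<Inter>k. B k) \<le> ennreal (?K * s k ^ (DIM('a) - 1))" for k
    using B(1) by (intro order_trans[OF emeasure_mono B(3)[of k]]) auto
  moreover have "(\<lambda>k. ennreal (?K * s k ^ (DIM('a) - 1))) \<longlonglongrightarrow> ennreal (?K * 0 ^ (DIM('a) - 1))"
  proof (intro tendsto_ennrealI tendsto_mult tendsto_const tendsto_power)
    show "s \<longlonglongrightarrow> 0" unfolding s_def[abs_def] using lim_inverse_n'[THEN LIMSEQ_Suc]
      by (simp add: add.commute)
  qed
  ultimately have "emeasure lborel (\<Inter>k. B k) \<le> ennreal (?K * 0 ^ (DIM('a) - 1))"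
    by (intro LIMSEQ_le_const) auto
  moreover have "(\<Inter>k. B k) \<in> sets borel" using B(1) by auto
  ultimately show ?thesis using sub True by blast
next
  case False
  then have "0 < d" using assms(2) by simp
  from tube_cover_pos[OF assms(1) this assms(3,4)] show ?thesis .
qed

text \<open>The constant of \<open>tube_cover\<close> divided by the normalisation in
  \<open>hausdorff_weight\<close>; the factor \<open>2 ^ (n - 1)\<close> undoes the halving of the
  diameter there.\<close>

definition projection_const :: "nat \<Rightarrow> real \<Rightarrow> real" where
  "projection_const n R = (R + 1) * unit_ball_vol (real n) * 2 ^ n * 2 ^ (n - 1) / unit_ball_vol (real n - 1)"

lemma projection_const_pos: "0 < n \<Longrightarrow> 0 \<le> R \<Longrightarrow> 0 < projection_const n R"
  by (simp add: projection_const_def)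

lemma hausdorff_weight_tube:
  assumes "2 \<le> n" "0 \<le> R" "bounded C"
  shows "ennreal ((R + 1) * unit_ball_vol (real n) * 2 ^ n * diameter C ^ (n - 1))
    = ennreal (projection_const n R) * hausdorff_weight (real n - 1) C"
proof -
  have d: "diameter C \<ge> 0" using diameter_ge_0 assms by blast
  have n: "real n - 1 = real (n - 1)" "0 < n - 1" using assms by auto
  then have pw: "(diameter C / 2) powr (real n - 1) = (diameter C / 2) ^ (n - 1)"
    using d by (simp only: n(1)) (rule powr_realpow', auto)
  have u: "unit_ball_vol (real n - 1) > 0" using assms by simp
  have "ennreal (projection_const n R) * hausdorff_weight (real n - 1) C
      = ennreal (projection_const n R * (unit_ball_vol (real n - 1) * (diameter C / 2) ^ (n - 1)))"
    unfolding hausdorff_weight_def pw using assms u d projection_const_pos[of n R]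
    by (intro ennreal_mult[symmetric]) auto
  also have "projection_const n R * (unit_ball_vol (real n - 1) * (diameter C / 2) ^ (n - 1))
     = (R + 1) * unit_ball_vol (real n) * 2 ^ n * diameter C ^ (n - 1)"
    unfolding projection_const_def using u by (simp add: power_divide)
  finally show ?thesis by (rule sym)
qed

text \<open>A covering of E pulls back to a covering by tubes, since \<open>l y\<close> lies in
  {0..R} however it depends on y. The premeasure at scale 1 suffices: it is a lower bound for the
  Hausdorff outer measure, and its covering sets have diameter at most 1, as
  \<open>tube_cover\<close> requires.\<close>

lemma emeasure_projection_le_hausdorff:
  fixes e :: "'a::euclidean_space"
  assumes e: "norm e = 1" and R: "0 \<le> R" and dim: "2 \<le> DIM('a)"
    and l: "\<And>y. y \<in> S \<Longrightarrow> 0 \<le> l y \<and> l y \<le> R"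
  shows "emeasure lborel {y \<in> S. y + l y *\<^sub>R e \<in> E}
     \<le> ennreal (projection_const DIM('a) R) * hausdorff_outer (real DIM('a) - 1) E"
proof -
  let ?C = "ennreal (projection_const DIM('a) R)" and ?s = "real DIM('a) - 1"
  have C0: "?C > 0" using projection_const_pos[of "DIM('a)" R] R by simp
  have "emeasure lborel {y \<in> S. y + l y *\<^sub>R e \<in> E} / ?C \<le> hausdorff_premeasure ?s 1 E"
    unfolding hausdorff_premeasure_def
  proof (rule INF_greatest)
    fix D assume D: "D \<in> hausdorff_covers 1 E"
    have "\<exists>B\<in>sets borel. {y \<in> S. y + l y *\<^sub>R e \<in> D i} \<subseteq> B \<and> emeasure lborel B \<le> ?C * hausdorff_weight ?s (D i)" for i
    proof (cases "D i = {}")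
      case False
      then obtain c where c: "c \<in> D i" by blast
      have bd: "bounded (D i)" "diameter (D i) \<le> 1" using D by (auto simp: hausdorff_covers_def)
      obtain B where B: "B \<in> sets borel" "{y. \<exists>t\<in>{0..R}. norm (y + t *\<^sub>R e - c) \<le> diameter (D i)} \<subseteq> B"
        "emeasure lborel B \<le> ennreal ((R + 1) * unit_ball_vol (DIM('a)) * 2 ^ DIM('a) * diameter (D i) ^ (DIM('a) - 1))"
        using tube_cover[OF e diameter_ge_0[OF bd(1)] bd(2) R dim] by blast
      have "{y \<in> S. y + l y *\<^sub>R e \<in> D i} \<subseteq> B"
      proof clarify
        fix y assume y: "y \<in> S" "y + l y *\<^sub>R e \<in> D i"
        have "norm (y + l y *\<^sub>R e - c) \<le> diameter (D i)"
          using diameter_bounded_bound[OF bd(1) y(2) c] by (simp add: dist_norm)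
        then show "y \<in> B" using l[OF y(1)] by (intro subsetD[OF B(2)] CollectI bexI[of _ "l y"]) auto
      qed
      then show ?thesis using B hausdorff_weight_tube[OF dim R bd(1)] by auto
    qed auto
    then have "\<forall>i. \<exists>B. B \<in> sets borel \<and> {y \<in> S. y + l y *\<^sub>R e \<in> D i} \<subseteq> B \<and> emeasure lborel B \<le> ?C * hausdorff_weight ?s (D i)"
      unfolding Bex_def[symmetric] by (intro allI)
    then obtain B where "\<forall>i. B i \<in> sets borel \<and> {y \<in> S. y + l y *\<^sub>R e \<in> D i} \<subseteq> B i \<and> emeasure lborel (B i) \<le> ?C * hausdorff_weight ?s (D i)"
      by (rule choice[THEN exE])
    then have B: "B i \<in> sets borel" "{y \<in> S. y + l y *\<^sub>R e \<in> D i} \<subseteq> B i"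
      "emeasure lborel (B i) \<le> ?C * hausdorff_weight ?s (D i)" for i
      by (simp_all only:)
    have "{y \<in> S. y + l y *\<^sub>R e \<in> E} \<subseteq> (\<Union>i. B i)"
      using D B(2) unfolding hausdorff_covers_def by blast
    then have "emeasure lborel {y \<in> S. y + l y *\<^sub>R e \<in> E} \<le> emeasure lborel (\<Union>i. B i)"
      using B(1) by (intro emeasure_mono) auto
    also have "\<dots> \<le> (\<Sum>i. emeasure lborel (B i))"
      using B(1) by (intro emeasure_subadditive_countably) auto
    also have "\<dots> \<le> (\<Sum>i. ?C * hausdorff_weight ?s (D i))"
      using B(3) by (intro suminf_le) auto
    also have "\<dots> = ?C * (\<Sum>i. hausdorff_weight ?s (D i))" by simp
    finally show "emeasure lborel {y \<in> S. y + l y *\<^sub>R e \<in> E} / ?C \<le> (\<Sum>i. hausdorff_weight ?s (D i))"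
      using C0 by (intro divide_le_posI_ennreal) (simp_all add: mult.commute)
  qed
  also have "\<dots> \<le> hausdorff_outer ?s E"
    unfolding hausdorff_outer_def by (intro SUP_upper) auto
  finally have "?C * (emeasure lborel {y \<in> S. y + l y *\<^sub>R e \<in> E} / ?C) \<le> ?C * hausdorff_outer ?s E"
    by (rule mult_left_mono) simp
  then show ?thesis using C0 by (simp add: ennreal_times_divide mult.commute[of ?C] mult_divide_eq_ennreal)
qed

text \<open>By the bound for sets, the image of Lebesgue measure on S under the projection is
  dominated, as a measure, by a multiple of Hausdorff measure on F, and integrals inherit this. It
  serves to carry L^1 convergence on the frontier over to a boundary layer.\<close>

lemma nn_integral_projection_le:
  fixes e :: "'a::euclidean_space"
  assumes e: "norm e = 1" and R: "0 \<le> R" and dim: "2 \<le> DIM('a)"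
    and l: "\<And>y. y \<in> S \<Longrightarrow> 0 \<le> l y \<and> l y \<le> R"
    and [measurable]: "S \<in> sets borel" "F \<in> sets borel" "l \<in> borel_measurable borel" "g \<in> borel_measurable borel"
    and F: "\<And>y. y \<in> S \<Longrightarrow> y + l y *\<^sub>R e \<in> F"
  shows "(\<integral>\<^sup>+y\<in>S. g (y + l y *\<^sub>R e) \<partial>lborel)
     \<le> ennreal (projection_const DIM('a) R) * (\<integral>\<^sup>+x\<in>F. g x \<partial>hausdorff_measure (real DIM('a) - 1))"
proof -
  let ?C = "ennreal (projection_const DIM('a) R)" and ?H = "hausdorff_measure (real DIM('a) - 1) :: 'a measure"
  define M where "M = distr (density lborel (indicator S)) borel (\<lambda>y. y + l y *\<^sub>R e)"
  define N where "N = scale_measure ?C (density ?H (indicator F))"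
  have sets: "sets M = sets N" by (simp add: M_def N_def)
  have "M \<le> N"
    unfolding le_measure[OF sets]
  proof
    fix A assume "A \<in> sets M"
    then have [measurable]: "A \<in> sets borel" by (simp add: M_def)
    have "(\<lambda>y. y + l y *\<^sub>R e) -` A \<in> sets borel"
      by (rule measurable_sets_borel[where M=borel]) measurable
    then have "emeasure M A = (\<integral>\<^sup>+y. indicator S y * indicator ((\<lambda>y. y + l y *\<^sub>R e) -` A) y \<partial>lborel)"
      by (simp add: M_def emeasure_distr emeasure_density)
    also have "\<dots> = (\<integral>\<^sup>+y. indicator {y \<in> S. y + l y *\<^sub>R e \<in> A \<inter> F} y \<partial>lborel)"
      using F by (intro nn_integral_cong) (auto simp: indicator_def)
    also have "\<dots> = emeasure lborel {y \<in> S. y + l y *\<^sub>R e \<in> A \<inter> F}"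
      by (rule nn_integral_indicator) measurable
    also have "\<dots> \<le> ?C * hausdorff_outer (real DIM('a) - 1) (A \<inter> F)"
      by (rule emeasure_projection_le_hausdorff[OF e R dim l])
    also have "hausdorff_outer (real DIM('a) - 1) (A \<inter> F) = emeasure ?H (A \<inter> F)"
      by (rule emeasure_hausdorff_measure[symmetric]) measurable
    also have "emeasure ?H (A \<inter> F) = (\<integral>\<^sup>+x. indicator F x * indicator A x \<partial>?H)"
      by (simp add: indicator_inter_arith[symmetric] Int_commute)
    also have "?C * \<dots> = emeasure N A"
      by (simp add: N_def emeasure_density)
    finally show "emeasure M A \<le> emeasure N A" .
  qed
  then have "nn_integral M g \<le> nn_integral N g"
    by (rule nn_integral_mono_measure[OF sets])
  moreover have "nn_integral M g = (\<integral>\<^sup>+y\<in>S. g (y + l y *\<^sub>R e) \<partial>lborel)"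
    by (simp add: M_def nn_integral_distr nn_integral_density mult.commute)
  moreover have "nn_integral N g = ?C * (\<integral>\<^sup>+x\<in>F. g x \<partial>?H)"
    by (simp add: N_def nn_integral_scale_measure nn_integral_density mult.commute)
  ultimately show ?thesis by simp
qed

section \<open>Boundary charts\<close>

lemma graph_height_shift:
  "norm e = 1 \<Longrightarrow> graph_height e \<gamma> (y + t *\<^sub>R e) = graph_height e \<gamma> y + t"
  by (simp add: graph_height_def inner_add_left dot_square_norm algebra_simps)

text \<open>Orthogonal projection to the hyperplane is nonexpansive, so \<gamma> after projection is
  L-Lipschitz on the whole space although \<gamma> is controlled only on the hyperplane; the summand
  1 comes from the axial coordinate.\<close>

lemma graph_height_lipschitz:
  fixes e :: "real^'n"
  assumes e: "norm e = 1" and L: "L-lipschitz_on {z. z \<bullet> e = 0} \<gamma>"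
  shows "\<bar>graph_height e \<gamma> y - graph_height e \<gamma> z\<bar> \<le> (1 + L) * norm (y - z)"
proof -
  define P where "P x = x - (x \<bullet> e) *\<^sub>R e" for x :: "real^'n"
  have ee: "e \<bullet> e = 1" using e by (simp add: dot_square_norm)
  have "P x \<bullet> e = 0" for x by (simp add: P_def inner_diff_left ee)
  then have "dist (\<gamma> (P y)) (\<gamma> (P z)) \<le> L * dist (P y) (P z)"
    using L by (intro lipschitz_onD[OF L]) auto
  moreover have "dist (P y) (P z) \<le> norm (y - z)"
  proof -
    define w where "w = y - z"
    have "P y - P z = w - (w \<bullet> e) *\<^sub>R e" by (simp add: P_def w_def algebra_simps)
    moreover have "(norm (w - (w \<bullet> e) *\<^sub>R e))\<^sup>2 \<le> (norm w)\<^sup>2"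
      by (simp add: power2_norm_eq_inner inner_diff_left inner_diff_right ee inner_commute algebra_simps)
    ultimately show ?thesis by (simp add: dist_norm w_def norm_le_square power2_norm_eq_inner abs_le_square_iff[symmetric])
  qed
  moreover have "L \<ge> 0" using L by (rule lipschitz_on_nonneg)
  moreover have "\<bar>(y - z) \<bullet> e\<bar> \<le> norm (y - z)"
    using Cauchy_Schwarz_ineq2[of "y - z" e] e by simp
  ultimately have "\<bar>(y - z) \<bullet> e\<bar> + dist (\<gamma> (P y)) (\<gamma> (P z)) \<le> norm (y - z) + L * norm (y - z)"
    by (smt (verit, best) mult_left_mono)
  moreover have "graph_height e \<gamma> y - graph_height e \<gamma> z = (y - z) \<bullet> e - (\<gamma> (P y) - \<gamma> (P z))"
    by (simp add: graph_height_def P_def inner_diff_left)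
  ultimately show ?thesis by (simp add: dist_real_def algebra_simps) 
qed

text \<open>The factor \<open>M\<close> is both a Lipschitz constant of the height \<open>h\<close> and the comparability constant of
  depth and distance to the boundary.\<close>

definition boundary_chart :: "(real^'n) set \<Rightarrow> real^'n \<Rightarrow> real^'n \<Rightarrow> (real^'n \<Rightarrow> real) \<Rightarrow> real \<Rightarrow> real \<Rightarrow> bool" where
  "boundary_chart G x e h M r \<longleftrightarrow> norm e = 1 \<and> 1 \<le> M \<and> 0 < r \<and> h x = 0 \<and>
     (\<forall>y z. \<bar>h y - h z\<bar> \<le> M * norm (y - z)) \<and> (\<forall>y t. h (y + t *\<^sub>R e) = h y + t) \<and>
     (\<forall>y\<in>ball x r. (y \<in> G \<longleftrightarrow> h y < 0) \<and> (y \<in> frontier G \<longleftrightarrow> h y = 0) \<and>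
        (y \<in> G \<longrightarrow> - h y \<le> M * infdist y (frontier G)))"

lemma boundary_chart_exists:
  fixes G :: "(real^'n) set"
  assumes G: "bounded_lipschitz_domain G" and x: "x \<in> frontier G"
  shows "\<exists>e h M r. boundary_chart G x e h M r"
proof -
  have "open G" using G by (simp add: bounded_lipschitz_domain_def)
  then have fr: "frontier G = closure G - G" by (simp add: frontier_def interior_open)
  obtain U e \<gamma> where "x \<in> U" and ch: "lipschitz_chart G U e \<gamma>"
    using G x unfolding bounded_lipschitz_domain_def by blast
  define h where "h = graph_height e \<gamma>"
  obtain L where U: "open U" and e: "norm e = 1" and L: "L-lipschitz_on {z. z \<bullet> e = 0} \<gamma>"
    and GU: "G \<inter> U = {y \<in> U. h y < 0}"
    using ch by (auto simp: lipschitz_chart_def h_def)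
  define M where "M = 1 + L"
  have M: "1 \<le> M" using lipschitz_on_nonneg[OF L] by (simp add: M_def)
  have lip: "\<bar>h y - h z\<bar> \<le> M * norm (y - z)" for y z
    using graph_height_lipschitz[OF e L] by (simp add: h_def M_def)
  have shift: "h (y + t *\<^sub>R e) = h y + t" for y t by (simp add: h_def graph_height_shift e)
  have inG: "y \<in> G \<longleftrightarrow> h y < 0" if "y \<in> U" for y using GU that by blast
  \<comment> \<open>A point of positive height has a neighbourhood free of G; a point of height 0 is
    approached by points of G from below along the axis.\<close>
  have frU: "y \<in> frontier G \<longleftrightarrow> h y = 0" if y: "y \<in> U" for y
  proof
    assume yf: "y \<in> frontier G"
    then have "0 \<le> h y" using fr inG[OF y] by auto
    moreover have "\<not> 0 < h y"
    proof
      assume pos: "0 < h y"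
      have "isCont h y"
      proof -
        have "M-lipschitz_on UNIV h"
          using lip M by (auto simp: lipschitz_on_def dist_norm)
        then have "continuous_on UNIV h" by (rule lipschitz_on_continuous_on)
        then show ?thesis by (simp add: continuous_on_eq_continuous_at)
      qed
      then have "eventually (\<lambda>z. 0 < h z) (nhds y)"
        using pos by (auto simp: isCont_def tendsto_at_iff_tendsto_nhds dest: order_tendstoD)
      moreover have "eventually (\<lambda>z. z \<in> U) (nhds y)" using U y by (rule eventually_nhds_in_open)
      ultimately have "eventually (\<lambda>z. 0 < h z \<and> z \<in> U) (nhds y)" by (rule eventually_conj)
      then obtain T where T: "open T" "y \<in> T" "\<And>z. z \<in> T \<Longrightarrow> 0 < h z \<and> z \<in> U"
        by (auto simp: eventually_nhds)
      have "y \<in> closure G" using yf fr by auto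
      then obtain z where "z \<in> G" "z \<in> T" using T(1,2) by (meson closure_iff_nhds_not_empty disjoint_iff order_refl)
      then show False using T(3)[of z] inG[of z] by auto
    qed
    ultimately show "h y = 0" by simp
  next
    assume h0: "h y = 0"
    then have "y \<notin> G" using inG[OF y] by simp
    moreover have "y \<in> closure G"
      unfolding closure_approachable
    proof (intro allI impI)
      fix d :: real assume "0 < d"
      obtain r where r: "0 < r" "ball y r \<subseteq> U" using U y open_contains_ball by blast
      define t where "t = min r d / 2"
      have t: "0 < t" "t < r" "t < d" using r \<open>0 < d\<close> by (auto simp: t_def)
      have "y + (-t) *\<^sub>R e \<in> U" using r t e by (intro subsetD[OF r(2)]) (simp add: dist_norm)
      moreover have "h (y + (-t) *\<^sub>R e) < 0" unfolding shift using h0 t by simp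
      ultimately have "y + (-t) *\<^sub>R e \<in> G" using inG by blast
      then show "\<exists>z\<in>G. dist z y < d" using t e by (intro bexI[of _ "y + (-t) *\<^sub>R e"]) (auto simp: dist_norm)
    qed
    ultimately show "y \<in> frontier G" using fr by simp
  qed
  obtain r where r: "0 < r" "ball x r \<subseteq> U" using U \<open>x \<in> U\<close> open_contains_ball by blast
  have hx: "h x = 0" using frU[OF \<open>x \<in> U\<close>] x by simp
  \<comment> \<open>The radius is halved for the sake of frontier points outside the chart: they are
    at least as far from y as the centre x is, and x has height 0.\<close>
  have dist: "- h y \<le> M * infdist y (frontier G)" if y: "y \<in> ball x (r / 2)" for y
  proof -
    have "- h y / M \<le> infdist y (frontier G)"
      unfolding infdist_def using x
    proof (simp, intro conjI impI cINF_greatest)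
      show "frontier G \<noteq> {}" using x by blast
      fix z assume z: "z \<in> frontier G"
      have "- h y \<le> M * dist y z"
      proof (cases "z \<in> U")
        case True
        then show ?thesis using lip[of z y] frU[OF True] z by (simp add: dist_norm norm_minus_commute)
      next
        case False
        then have "r \<le> dist x z" using r by (force simp: subset_iff)
        then have "dist x y \<le> dist y z" using y dist_triangle[of x z y] by simp
        then have "M * dist x y \<le> M * dist y z" using M by simp
        moreover have "- h y \<le> M * dist x y" using lip[of x y] hx by (simp add: dist_norm)
        ultimately show ?thesis by linarith
      qed
      then show "- (h y / M) \<le> dist y z" using M by (simp add: field_simps)
    qed auto
    then show ?thesis using M by (simp add: field_simps)
  qed
  have "boundary_chart G x e h M (r / 2)"
    unfolding boundary_chart_def
  proof (intro conjI allI ballI)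
    fix y assume y: "y \<in> ball x (r / 2)"
    then have "y \<in> U" using r by auto
    then show "(y \<in> G) = (h y < 0)" "(y \<in> frontier G) = (h y = 0)" using inG frU by auto
    show "y \<in> G \<longrightarrow> - h y \<le> M * infdist y (frontier G)" using dist[OF y] by simp
  qed (use e M r hx lip shift in auto)
  then show ?thesis by blast
qed

section \<open>The weighted Poincare inequality\<close>

lemma powr_add_le:
  fixes a b p :: real
  assumes "0 \<le> a" "0 \<le> b" "0 \<le> p"
  shows "(a + b) powr p \<le> 2 powr p * (a powr p + b powr p)"
proof -
  have "(a + b) powr p \<le> (2 * max a b) powr p" using assms by (intro powr_mono2) auto
  also have "\<dots> = 2 powr p * max a b powr p" using assms by (simp add: powr_mult)
  also have "max a b powr p \<le> a powr p + b powr p" by (cases "a \<le> b") auto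
  finally show ?thesis by simp
qed

lemma norm_diff_powr_le:
  assumes "0 \<le> p"
  shows "norm (x - z) powr p \<le> 2 powr p * (norm (x - y) powr p + norm (y - z) powr p)"
proof -
  have "norm (x - z) \<le> norm (x - y) + norm (y - z)" using norm_triangle_ineq[of "x - y" "y - z"] by simp
  then have "norm (x - z) powr p \<le> (norm (x - y) + norm (y - z)) powr p" using assms by (intro powr_mono2) auto
  also have "\<dots> \<le> 2 powr p * (norm (x - y) powr p + norm (y - z) powr p)" using assms by (intro powr_add_le) auto
  finally show ?thesis .
qed

lemma nn_integral_norm_diff_powr_le:
  fixes f g h :: "'a \<Rightarrow> 'b::euclidean_space"
  assumes "0 \<le> p" and [measurable]: "f \<in> borel_measurable M" "g \<in> borel_measurable M" "h \<in> borel_measurable M" "S \<in> sets M"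
  shows "(\<integral>\<^sup>+x\<in>S. ennreal (norm (f x - h x) powr p) \<partial>M) \<le>
     ennreal (2 powr p) * ((\<integral>\<^sup>+x\<in>S. ennreal (norm (f x - g x) powr p) \<partial>M) + (\<integral>\<^sup>+x\<in>S. ennreal (norm (g x - h x) powr p) \<partial>M))"
proof -
  have "(\<integral>\<^sup>+x\<in>S. ennreal (norm (f x - h x) powr p) \<partial>M) \<le> (\<integral>\<^sup>+x. ennreal (2 powr p) *
     (ennreal (norm (f x - g x) powr p) * indicator S x + ennreal (norm (g x - h x) powr p) * indicator S x) \<partial>M)"
    using norm_diff_powr_le[OF assms(1)]
    by (intro nn_integral_mono) (auto simp: indicator_def simp flip: ennreal_plus ennreal_mult intro!: ennreal_leI)
  also have "\<dots> = ennreal (2 powr p) * ((\<integral>\<^sup>+x\<in>S. ennreal (norm (f x - g x) powr p) \<partial>M) + (\<integral>\<^sup>+x\<in>S. ennreal (norm (g x - h x) powr p) \<partial>M))"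
    by (simp add: nn_integral_cmult nn_integral_add)
  finally show ?thesis .
qed

text \<open>Segments of constant length: the far value is v (y + a), and since y + a stays in G, the
  error of \<open>u k\<close> there is, after a shift, part of its error on G.\<close>

lemma translation_estimate:
  fixes v :: "real^'n \<Rightarrow> real^'n"
  assumes p: "1 < p" and \<alpha>: "0 \<le> \<alpha>" "\<alpha> < (p - 1) / p" and "open G"
    and [measurable]: "S \<in> sets borel" and "0 < \<kappa>"
    and seg: "\<And>y t. y \<in> S \<Longrightarrow> 0 \<le> t \<Longrightarrow> t < 1 \<Longrightarrow>
       y + t *\<^sub>R a \<in> G \<and> \<kappa> * (1 - t) \<le> infdist (y + t *\<^sub>R a) (frontier G)"
    and fin: "\<And>y. y \<in> S \<Longrightarrow> y + a \<in> G"
    and app: "smooth_approx G v V u"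
  shows "(\<integral>\<^sup>+y\<in>S. ennreal (norm (v (y + a) - v y) powr p) \<partial>lborel)
     \<le> ennreal (norm a powr p * line_const p \<alpha> \<kappa> 1) * weighted_energy p \<alpha> G V"
proof -
  have [measurable]: "G \<in> sets borel" using \<open>open G\<close> by simp
  have [measurable]: "v \<in> borel_measurable borel" using app by (simp add: smooth_approx_def)
  have [measurable]: "u k \<in> borel_measurable borel" for k
    using app by (intro borel_measurable_continuous_onI)
      (auto simp: smooth_approx_def intro!: continuous_at_imp_continuous_on differentiable_imp_continuous_within)
  have lim: "(\<lambda>k. \<integral>\<^sup>+x\<in>G. ennreal (norm (u k x - v x)) \<partial>lborel) \<longlonglongrightarrow> 0"
    using app by (simp add: smooth_approx_def)
  have "(\<integral>\<^sup>+y\<in>S. ennreal (norm (u k (y + 1 *\<^sub>R a) - v (y + a))) \<partial>lborel) \<le> (\<integral>\<^sup>+x\<in>G. ennreal (norm (u k x - v x)) \<partial>lborel)" for k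
  proof -
    have "(\<integral>\<^sup>+y\<in>S. ennreal (norm (u k (y + 1 *\<^sub>R a) - v (y + a))) \<partial>lborel)
        \<le> (\<integral>\<^sup>+y. ennreal (norm (u k (y + a) - v (y + a))) * indicator G (y + a) \<partial>lborel)"
      using fin by (intro nn_integral_mono) (auto simp: indicator_def)
    also have "\<dots> = (\<integral>\<^sup>+x\<in>G. ennreal (norm (u k x - v x)) \<partial>lborel)"
      by (rule nn_integral_lborel_shift) measurable
    finally show ?thesis .
  qed
  then have lim': "(\<lambda>k. \<integral>\<^sup>+y\<in>S. ennreal (norm (u k (y + 1 *\<^sub>R a) - v (y + a))) \<partial>lborel) \<longlonglongrightarrow> 0"
    by (intro tendsto_sandwich[OF _ _ tendsto_const lim]) auto
  have "S \<subseteq> G" using seg[of _ 0] by auto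
  then have "(\<integral>\<^sup>+y\<in>S. ennreal (norm (v (y + a) - v y) powr p) \<partial>lborel)
     \<le> ennreal (norm a powr p * line_const p \<alpha> \<kappa> 1 * 1) * weighted_energy p \<alpha> G V"
    by (intro line_estimate[OF p \<alpha> \<open>open G\<close> _ _ _ _ _ _ \<open>0 < \<kappa>\<close> _ app, where l="\<lambda>_. 1"] lim')
       (use seg in auto)
  then show ?thesis by simp
qed

text \<open>The constant \<open>c\<close> is required to lie in \<open>W\<close>, which later is the span of the normals.\<close>

definition poincare_on :: "real \<Rightarrow> real \<Rightarrow> (real^'n) set \<Rightarrow> (real^'n) set \<Rightarrow> (real^'n) set \<Rightarrow> bool" where
  "poincare_on p \<alpha> G W S \<longleftrightarrow> (\<exists>C>0. \<forall>v V u. smooth_approx G v V u \<longrightarrow>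
     (AE x in lborel. x \<in> G \<longrightarrow> v x \<in> W) \<longrightarrow> weighted_energy p \<alpha> G V < \<infinity> \<longrightarrow>
     (\<exists>c\<in>W. (\<integral>\<^sup>+x\<in>S. ennreal (norm (v x - c) powr p) \<partial>lborel) \<le> ennreal C * weighted_energy p \<alpha> G V))"

lemma poincare_on_subset: "poincare_on p \<alpha> G W T \<Longrightarrow> S \<subseteq> T \<Longrightarrow> poincare_on p \<alpha> G W S"
proof -
  assume "poincare_on p \<alpha> G W T" "S \<subseteq> T"
  moreover have "(\<integral>\<^sup>+x\<in>S. f x \<partial>lborel) \<le> (\<integral>\<^sup>+x\<in>T. f x \<partial>lborel)" for f :: "real^'a \<Rightarrow> ennreal"
    using \<open>S \<subseteq> T\<close> by (intro nn_integral_mono) (auto simp: indicator_def)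
  ultimately show ?thesis unfolding poincare_on_def by (meson order_trans)
qed

text \<open>Serves to pick the constant as a value v z instead of a mean: it then lies in W,
  whatever the shape of W, because v z does so for almost every z.\<close>

lemma exists_le_average:
  fixes \<Phi> :: "'a \<Rightarrow> ennreal"
  assumes [measurable]: "\<Phi> \<in> borel_measurable M" "B \<in> sets M"
    and B: "0 < emeasure M B" "emeasure M B < \<infinity>" and a: "a < \<infinity>"
    and le: "(\<integral>\<^sup>+z\<in>B. \<Phi> z \<partial>M) \<le> a * emeasure M B" and P: "AE z in M. z \<in> B \<longrightarrow> P z"
  shows "\<exists>z\<in>B. P z \<and> \<Phi> z \<le> a"
proof (rule ccontr)
  assume na: "\<not> ?thesis"
  have "AE z in M. z \<in> B \<longrightarrow> a < \<Phi> z" using P by eventually_elim (use na in \<open>auto simp: not_le\<close>)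
  then have ae: "AE z in M. a * indicator B z \<le> \<Phi> z * indicator B z"
    and ae2: "AE z in M. z \<in> B \<longrightarrow> \<not> \<Phi> z * indicator B z \<le> a * indicator B z"
    by (eventually_elim, auto simp: indicator_def)+
  have I: "(\<integral>\<^sup>+z. a * indicator B z \<partial>M) = a * emeasure M B" by (simp add: nn_integral_cmult_indicator)
  have "\<not> (AE z in M. \<Phi> z * indicator B z \<le> a * indicator B z)"
  proof
    assume "AE z in M. \<Phi> z * indicator B z \<le> a * indicator B z"
    then have "AE z in M. z \<notin> B" using ae2 by eventually_elim auto
    then have "emeasure M {z \<in> space M. z \<in> B} = 0" by (rule emeasure_eq_0_AE)
    moreover have "{z \<in> space M. z \<in> B} = B" using sets.sets_into_space[OF assms(2)] by auto
    ultimately show False using B by simp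
  qed
  then have "(\<integral>\<^sup>+z. a * indicator B z \<partial>M) < (\<integral>\<^sup>+z. \<Phi> z * indicator B z \<partial>M)"
    using a B(2) ae by (intro nn_integral_less) (auto simp: I ennreal_mult_eq_top_iff)
  then show False using le by (simp add: I)
qed

text \<open>Averaging over z the integral of |v y - v z|^p reduces the claim to translations: with z
  = y + h the double integral becomes an integral over |h| < 2 \<rho> of translation estimates. The
  ball is convex and stays at distance \<rho> from the frontier, so the weight is harmless on the
  segments involved.\<close>

lemma poincare_on_ball:
  fixes x :: "real^'n" and W :: "(real^'n) set"
  assumes p: "1 < p" and \<alpha>: "0 \<le> \<alpha>" "\<alpha> < (p - 1) / p" and "open G" and fr: "frontier G \<noteq> {}"
    and \<rho>: "0 < \<rho>" "ball x (2 * \<rho>) \<subseteq> G"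
  shows "poincare_on p \<alpha> G W (ball x \<rho>)"
proof -
  define B where "B = ball x \<rho>"
  have [measurable]: "B \<in> sets borel" by (simp add: B_def)
  define K where "K = (2 * \<rho>) powr p * line_const p \<alpha> \<rho> 1"
  have lc: "0 < line_const p \<alpha> \<rho> 1" using line_const_pos[OF p \<alpha>(2) \<rho>(1)] by simp
  have K: "K > 0" using \<rho> lc by (simp add: K_def)
  define m where "m = measure lborel B"
  have m: "0 < m" "emeasure lborel B = ennreal m"
    using \<rho> emeasure_lborel_ball_finite[of x \<rho>] unfolding m_def B_def
    by (simp_all add: content_ball_pos emeasure_eq_ennreal_measure)
  \<comment> \<open>Differences of two points of \<open>B\<close> lie in this ball.\<close>
  define m2 where "m2 = measure lborel (ball (0 :: real^'n) (2 * \<rho>))"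
  have m2: "0 < m2" "emeasure lborel (ball (0 :: real^'n) (2 * \<rho>)) = ennreal m2"
    using \<rho> emeasure_lborel_ball_finite[of "0 :: real^'n" "2 * \<rho>"] unfolding m2_def
    by (simp_all add: content_ball_pos emeasure_eq_ennreal_measure)
  have BG: "B \<subseteq> G" using \<rho> by (auto simp: B_def)
  have dist: "\<rho> \<le> infdist z (frontier G)" if z: "z \<in> B" for z
    unfolding infdist_def using fr
  proof (simp, intro cINF_greatest)
    fix w assume "w \<in> frontier G"
    then have "w \<notin> G" using \<open>open G\<close> by (auto simp: frontier_def interior_open)
    then have "w \<notin> ball x (2 * \<rho>)" using \<rho> by blast
    then show "\<rho> \<le> dist z w" using z dist_triangle[of x w z] by (simp add: B_def)
  qed auto
  show ?thesis unfolding poincare_on_def B_def[symmetric]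
  proof (intro exI[of _ "K * m2 / m"] conjI allI impI)
    show "0 < K * m2 / m" using K m m2 by simp
    fix v V u
    assume app: "smooth_approx G v V u" and W: "AE x in lborel. x \<in> G \<longrightarrow> v x \<in> W"
      and E: "weighted_energy p \<alpha> G V < \<infinity>"
    let ?E = "weighted_energy p \<alpha> G V"
    have [measurable]: "v \<in> borel_measurable borel" using app by (simp add: smooth_approx_def)
    define \<Phi> where "\<Phi> z = (\<integral>\<^sup>+y\<in>B. ennreal (norm (v y - v z) powr p) \<partial>lborel)" for z
    have \<Phi>m: "\<Phi> \<in> borel_measurable lborel" unfolding \<Phi>_def by measurable
    have shift: "(\<integral>\<^sup>+y. ennreal (norm (v y - v (y + h)) powr p) * indicator B y * indicator B (y + h) \<partial>lborel)
        \<le> ennreal K * ?E * indicator (ball 0 (2 * \<rho>)) h" for h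
    proof (cases "h \<in> ball 0 (2 * \<rho>)")
      case True
      define S where "S = {y \<in> B. y + h \<in> B}"
      have "S = B \<inter> (\<lambda>y. y + h) -` B" by (auto simp: S_def)
      also have "open \<dots>" unfolding B_def by (intro open_Int open_ball open_vimage continuous_intros)
      finally have Sm: "S \<in> sets borel" by simp
      have "(\<integral>\<^sup>+y\<in>S. ennreal (norm (v (y + h) - v y) powr p) \<partial>lborel) \<le> ennreal (norm h powr p * line_const p \<alpha> \<rho> 1) * ?E"
      proof (rule translation_estimate[OF p \<alpha> \<open>open G\<close> Sm \<rho>(1) _ _ app])
        fix y :: "real^'n" and t :: real assume y: "y \<in> S" and t: "0 \<le> t" "t < 1"
        have "(1 - t) *\<^sub>R y + t *\<^sub>R (y + h) \<in> B"
          using y t by (intro convexD) (auto simp: S_def B_def)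
        then have "y + t *\<^sub>R h \<in> B" by (simp add: algebra_simps)
        moreover have "\<rho> * (1 - t) \<le> \<rho>" using t \<rho> by (simp add: algebra_simps)
        ultimately show "y + t *\<^sub>R h \<in> G \<and> \<rho> * (1 - t) \<le> infdist (y + t *\<^sub>R h) (frontier G)"
          using BG dist by (meson order_trans subsetD)
      qed (use BG in \<open>auto simp: S_def\<close>)
      also have "\<dots> \<le> ennreal K * ?E"
        unfolding K_def using True p lc by (intro mult_right_mono ennreal_leI mult_right_mono powr_mono2) auto
      also have "(\<integral>\<^sup>+y\<in>S. ennreal (norm (v (y + h) - v y) powr p) \<partial>lborel)
         = (\<integral>\<^sup>+y. ennreal (norm (v y - v (y + h)) powr p) * indicator B y * indicator B (y + h) \<partial>lborel)"
        by (intro nn_integral_cong) (simp add: S_def indicator_def norm_minus_commute)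
      finally show ?thesis using True by simp
    next
      case False
      have "indicator B y * indicator B (y + h) = (0 :: ennreal)" for y
      proof -
        have "norm h \<le> dist x y + dist x (y + h)"
          using dist_triangle[of y "y + h" x] by (simp add: dist_norm norm_minus_commute)
        then show ?thesis using False by (auto simp: indicator_def B_def)
      qed
      then have "(\<integral>\<^sup>+y. ennreal (norm (v y - v (y + h)) powr p) * indicator B y * indicator B (y + h) \<partial>lborel) = (\<integral>\<^sup>+(y::real^'n). 0 \<partial>lborel)"
        by (intro nn_integral_cong) (simp only: mult.assoc mult_zero_right)
      then show ?thesis by simp
    qed
    have "(\<integral>\<^sup>+z\<in>B. \<Phi> z \<partial>lborel) = (\<integral>\<^sup>+z. (\<integral>\<^sup>+y. ennreal (norm (v y - v z) powr p) * indicator B y * indicator B z \<partial>lborel) \<partial>lborel)"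
      unfolding \<Phi>_def by (simp add: nn_integral_multc)
    also have "\<dots> = (\<integral>\<^sup>+y. (\<integral>\<^sup>+z. ennreal (norm (v y - v z) powr p) * indicator B y * indicator B z \<partial>lborel) \<partial>lborel)"
      by (rule lborel_pair.Fubini') measurable
    also have "\<dots> = (\<integral>\<^sup>+y. (\<integral>\<^sup>+h. ennreal (norm (v y - v (y + h)) powr p) * indicator B y * indicator B (y + h) \<partial>lborel) \<partial>lborel)"
    proof (rule nn_integral_cong)
      fix y
      define F where "F z = ennreal (norm (v y - v z) powr p) * indicator B y * indicator B z" for z
      have "(\<integral>\<^sup>+h. F (h + y) \<partial>lborel) = (\<integral>\<^sup>+z. F z \<partial>lborel)"
        by (rule nn_integral_lborel_shift) (unfold F_def, measurable)
      then show "(\<integral>\<^sup>+z. ennreal (norm (v y - v z) powr p) * indicator B y * indicator B z \<partial>lborel) =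
        (\<integral>\<^sup>+h. ennreal (norm (v y - v (y + h)) powr p) * indicator B y * indicator B (y + h) \<partial>lborel)"
        by (simp only: F_def add.commute)
    qed
    also have "\<dots> = (\<integral>\<^sup>+h. (\<integral>\<^sup>+y. ennreal (norm (v y - v (y + h)) powr p) * indicator B y * indicator B (y + h) \<partial>lborel) \<partial>lborel)"
      by (rule lborel_pair.Fubini') measurable
    also have "\<dots> \<le> (\<integral>\<^sup>+h. ennreal K * ?E * indicator (ball (0 :: real^'n) (2 * \<rho>)) h \<partial>lborel)"
      by (intro nn_integral_mono shift)
    also have "\<dots> = ennreal K * ?E * ennreal m2" by (simp add: nn_integral_cmult_indicator m2)
    also have "\<dots> = ennreal (K * m2 / m * m) * ?E"
      using K m m2 by (simp add: ennreal_mult' ac_simps)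
    also have "\<dots> = ennreal (K * m2 / m) * ?E * emeasure lborel B"
      using K m m2 by (subst ennreal_mult) (auto simp: ac_simps)
    finally have le: "(\<integral>\<^sup>+z\<in>B. \<Phi> z \<partial>lborel) \<le> ennreal (K * m2 / m) * ?E * emeasure lborel B" .
    have "\<exists>z\<in>B. v z \<in> W \<and> \<Phi> z \<le> ennreal (K * m2 / m) * ?E"
    proof (rule exists_le_average[OF \<Phi>m _ _ _ _ le])
      show "AE z in lborel. z \<in> B \<longrightarrow> v z \<in> W" using W by eventually_elim (use BG in auto)
    qed (use E m in \<open>auto simp: ennreal_mult_less_top\<close>)
    then show "\<exists>c\<in>W. (\<integral>\<^sup>+x\<in>B. ennreal (norm (v x - c) powr p) \<partial>lborel) \<le> ennreal (K * m2 / m) * ?E"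
      unfolding \<Phi>_def by blast
  qed
qed

lemma boundary_chart_neg_height:
  assumes ch: "boundary_chart G x e h M r" and y: "y \<in> ball x r" and neg: "h y < 0"
  shows "y \<in> G \<and> (1 / M) * (- h y) \<le> infdist y (frontier G)"
  using assms by (auto simp: boundary_chart_def field_simps)

text \<open>A shift by s against the axis moves the boundary piece into a ball deep inside G, where
  the inequality is known. On the way back the point with parameter t has depth at least (1 - t) s,
  because its far end is still below the graph; this is the distance condition of the translation
  estimate with \<kappa> = s / M.\<close>

lemma poincare_on_boundary:
  fixes G W :: "(real^'n) set"
  assumes p: "1 < p" and \<alpha>: "0 \<le> \<alpha>" "\<alpha> < (p - 1) / p" and "open G" and x: "x \<in> frontier G"
    and ch: "boundary_chart G x e h M r"
  shows "\<exists>\<rho>>0. poincare_on p \<alpha> G W (G \<inter> ball x \<rho>)"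
proof -
  have e: "norm e = 1" and M: "1 \<le> M" and r: "0 < r" and hx: "h x = 0"
    and lip: "\<And>y z. \<bar>h y - h z\<bar> \<le> M * norm (y - z)" and sh: "\<And>y t. h (y + t *\<^sub>R e) = h y + t"
    and G: "\<And>y. y \<in> ball x r \<Longrightarrow> y \<in> G \<longleftrightarrow> h y < 0"
    using ch by (auto simp: boundary_chart_def)
  \<comment> \<open>This makes s = r / 2. Heights vary by at most 2 M \<rho> on the ball of radius 2
    \<rho> about \<open>c\<close>, which is less than its depth s = 4 M \<rho>, and s + 2 \<rho> < r
    keeps everything in the chart.\<close>
  define \<rho> where "\<rho> = r / (8 * M)"
  have \<rho>: "0 < \<rho>" using r M by (simp add: \<rho>_def)
  define s where "s = 4 * M * \<rho>"
  have s: "0 < s" "s + 2 * \<rho> < r"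
  proof -
    show "0 < s" using \<rho> M by (simp add: s_def)
    have "8 * (M * \<rho>) = r" using M by (simp add: \<rho>_def)
    moreover have "\<rho> \<le> M * \<rho>" using M \<rho> by simp
    ultimately show "s + 2 * \<rho> < r" unfolding s_def mult.assoc using \<rho> by linarith
  qed
  define c where "c = x - s *\<^sub>R e"
  have "ball c (2 * \<rho>) \<subseteq> G"
  proof
    fix z assume z: "z \<in> ball c (2 * \<rho>)"
    have "dist x z \<le> dist x c + dist c z" by (rule dist_triangle)
    then have "z \<in> ball x r" using z s e by (simp add: c_def dist_norm)
    moreover have "h c = - s" using sh[of x "-s"] hx by (simp add: c_def)
    moreover have "h z - h c \<le> M * (2 * \<rho>)"
    proof -
      have "M * norm (z - c) \<le> M * (2 * \<rho>)" using z M by (intro mult_left_mono) (auto simp: dist_norm norm_minus_commute)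
      then show ?thesis using lip[of z c] by simp
    qed
    moreover have "0 < M * \<rho>" using M \<rho> by simp
    ultimately show "z \<in> G" using G[of z] by (simp add: s_def)
  qed
  then have "poincare_on p \<alpha> G W (ball c \<rho>)"
    using x by (intro poincare_on_ball p \<alpha> \<open>open G\<close> \<rho>) auto
  then obtain C where C: "C > 0" and PC: "\<And>v V u. smooth_approx G v V u \<Longrightarrow> AE x in lborel. x \<in> G \<longrightarrow> v x \<in> W \<Longrightarrow>
     weighted_energy p \<alpha> G V < \<infinity> \<Longrightarrow>
     \<exists>d\<in>W. (\<integral>\<^sup>+x\<in>ball c \<rho>. ennreal (norm (v x - d) powr p) \<partial>lborel) \<le> ennreal C * weighted_energy p \<alpha> G V"
    unfolding poincare_on_def by blast
  define a where "a = s *\<^sub>R e"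
  define T where "T = G \<inter> ball x \<rho>"
  define S where "S = {y. y + a \<in> T}"
  have oT: "open T" using \<open>open G\<close> by (auto simp: T_def)
  then have "open S" unfolding S_def by (intro open_vimage[unfolded vimage_def] continuous_intros)
  then have [measurable]: "S \<in> sets borel" "T \<in> sets borel" using oT by auto
  have SB: "S \<subseteq> ball c \<rho>" by (auto simp: S_def T_def c_def a_def dist_norm algebra_simps)
  define K where "K = norm a powr p * line_const p \<alpha> (s / M) 1"
  have K: "0 \<le> K" using line_const_pos[OF p \<alpha>(2), of "s / M" 1] s M by (simp add: K_def)
  have "poincare_on p \<alpha> G W T" unfolding poincare_on_def
  proof (intro exI[of _ "2 powr p * (K + C)"] conjI allI impI)
    show "0 < 2 powr p * (K + C)" using K C by simp
    fix v V u
    assume app: "smooth_approx G v V u" and W: "AE x in lborel. x \<in> G \<longrightarrow> v x \<in> W"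
      and E: "weighted_energy p \<alpha> G V < \<infinity>"
    let ?E = "weighted_energy p \<alpha> G V"
    have [measurable]: "v \<in> borel_measurable borel" using app by (simp add: smooth_approx_def)
    obtain d where d: "d \<in> W" "(\<integral>\<^sup>+x\<in>ball c \<rho>. ennreal (norm (v x - d) powr p) \<partial>lborel) \<le> ennreal C * ?E"
      using PC[OF app W E] by blast
    have "(\<integral>\<^sup>+y\<in>S. ennreal (norm (v (y + a) - v y) powr p) \<partial>lborel) \<le> ennreal K * ?E"
      unfolding K_def
    proof (rule translation_estimate[OF p \<alpha> \<open>open G\<close> _ _ _ _ app])
      fix y :: "real^'n" and t :: real assume y: "y \<in> S" and t: "0 \<le> t" "t < 1"
      have yT: "y + a \<in> G" "y + a \<in> ball x \<rho>" using y by (auto simp: S_def T_def)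
      define z where "z = y + t *\<^sub>R a"
      have z: "z = (y + a) + (- ((1 - t) * s)) *\<^sub>R e" by (simp add: z_def a_def algebra_simps)
      have t1: "0 < (1 - t) * s" "(1 - t) * s \<le> s" using t s by (auto simp: mult_le_cancel_right1)
      have "dist x z \<le> dist x (y + a) + dist (y + a) z" by (rule dist_triangle)
      also have "dist (y + a) z = (1 - t) * s" unfolding z dist_norm using e t s by simp
      finally have zr: "z \<in> ball x r" using yT(2) t1 s \<rho> unfolding mem_ball by linarith
      have "y + a \<in> ball x r" using yT s \<rho> by simp
      then have "h (y + a) < 0" using G yT by blast
      then have hz: "h z \<le> - ((1 - t) * s)" unfolding z sh by simp
      have "z \<in> G \<and> (1 / M) * (- h z) \<le> infdist z (frontier G)"
        using hz t1 by (intro boundary_chart_neg_height[OF ch zr]) linarith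
      moreover have "(1 / M) * ((1 - t) * s) \<le> (1 / M) * (- h z)" using hz M by (intro mult_left_mono) auto
      ultimately show "y + t *\<^sub>R a \<in> G \<and> s / M * (1 - t) \<le> infdist (y + t *\<^sub>R a) (frontier G)"
        by (simp add: z_def[symmetric] mult.commute)
    next
      show "y + a \<in> G" if "y \<in> S" for y using that by (auto simp: S_def T_def)
    qed (use s M in auto)
    moreover have "(\<integral>\<^sup>+y\<in>S. ennreal (norm (v y - d) powr p) \<partial>lborel) \<le> ennreal C * ?E"
      using SB by (intro order_trans[OF _ d(2)] nn_integral_mono) (auto simp: indicator_def)
    ultimately have "ennreal (2 powr p) * ((\<integral>\<^sup>+y\<in>S. ennreal (norm (v (y + a) - v y) powr p) \<partial>lborel)
         + (\<integral>\<^sup>+y\<in>S. ennreal (norm (v y - d) powr p) \<partial>lborel)) \<le> ennreal (2 powr p) * (ennreal K * ?E + ennreal C * ?E)"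
      by (intro mult_left_mono add_mono) auto
    moreover have "(\<integral>\<^sup>+y\<in>S. ennreal (norm (v (y + a) - d) powr p) \<partial>lborel)
       \<le> ennreal (2 powr p) * ((\<integral>\<^sup>+y\<in>S. ennreal (norm (v (y + a) - v y) powr p) \<partial>lborel)
         + (\<integral>\<^sup>+y\<in>S. ennreal (norm (v y - d) powr p) \<partial>lborel))"
      using p by (intro nn_integral_norm_diff_powr_le) auto
    moreover have "(\<integral>\<^sup>+y\<in>S. ennreal (norm (v (y + a) - d) powr p) \<partial>lborel) = (\<integral>\<^sup>+x\<in>T. ennreal (norm (v x - d) powr p) \<partial>lborel)"
    proof -
      have "(\<integral>\<^sup>+y\<in>S. ennreal (norm (v (y + a) - d) powr p) \<partial>lborel)
          = (\<integral>\<^sup>+y. ennreal (norm (v (y + a) - d) powr p) * indicator T (y + a) \<partial>lborel)"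
        by (intro nn_integral_cong) (simp add: S_def indicator_def)
      also have "\<dots> = (\<integral>\<^sup>+x\<in>T. ennreal (norm (v x - d) powr p) \<partial>lborel)"
        by (rule nn_integral_lborel_shift) measurable
      finally show ?thesis .
    qed
    moreover have "ennreal (2 powr p) * (ennreal K * ?E + ennreal C * ?E) = ennreal (2 powr p * (K + C)) * ?E"
      using K C by (simp add: ennreal_mult' distrib_right mult.assoc)
    ultimately show "\<exists>c\<in>W. (\<integral>\<^sup>+x\<in>T. ennreal (norm (v x - c) powr p) \<partial>lborel) \<le> ennreal (2 powr p * (K + C)) * ?E"
      using d(1) by (intro bexI[of _ d]) (auto intro: order_trans)
  qed
  then show ?thesis using \<rho> by (auto simp: T_def)
qed

text \<open>On the overlap both constants are close to v, so |d - c|^p times the measure of the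
  overlap is controlled by the energy; c can then replace d on T at the cost of the measure of
  T.\<close>

lemma poincare_on_Un:
  fixes G W :: "(real^'n) set"
  assumes "0 \<le> p" and S: "poincare_on p \<alpha> G W S" and T: "poincare_on p \<alpha> G W T"
    and [measurable]: "S \<in> sets borel" "T \<in> sets borel"
    and ST: "emeasure lborel (S \<inter> T) > 0" and bT: "emeasure lborel T < \<infinity>"
  shows "poincare_on p \<alpha> G W (S \<union> T)"
proof -
  obtain C D where C: "C > 0" "D > 0"
    and PC: "\<And>v V u. smooth_approx G v V u \<Longrightarrow> AE x in lborel. x \<in> G \<longrightarrow> v x \<in> W \<Longrightarrow>
     weighted_energy p \<alpha> G V < \<infinity> \<Longrightarrow>
     \<exists>c\<in>W. (\<integral>\<^sup>+x\<in>S. ennreal (norm (v x - c) powr p) \<partial>lborel) \<le> ennreal C * weighted_energy p \<alpha> G V"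
    and PD: "\<And>v V u. smooth_approx G v V u \<Longrightarrow> AE x in lborel. x \<in> G \<longrightarrow> v x \<in> W \<Longrightarrow>
     weighted_energy p \<alpha> G V < \<infinity> \<Longrightarrow>
     \<exists>c\<in>W. (\<integral>\<^sup>+x\<in>T. ennreal (norm (v x - c) powr p) \<partial>lborel) \<le> ennreal D * weighted_energy p \<alpha> G V"
    using S T unfolding poincare_on_def by blast
  define m where "m = measure lborel (S \<inter> T)"
  define n where "n = measure lborel T"
  have fin: "emeasure lborel (S \<inter> T) < \<infinity>"
    using bT by (intro le_less_trans[OF emeasure_mono bT]) auto
  have m1: "emeasure lborel (S \<inter> T) = ennreal m"
    unfolding m_def using fin by (intro emeasure_eq_ennreal_measure) simp
  then have "m > 0" using ST by simp
  note m = m1 this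
  have n: "emeasure lborel T = ennreal n" "n \<ge> 0"
    using bT by (auto simp: n_def emeasure_eq_ennreal_measure)
  define L where "L = 2 powr p * (C + D) / m"
  have L: "L > 0" using C m by (simp add: L_def)
  define B where "B = C + 2 powr p * (D + L * n)"
  show ?thesis unfolding poincare_on_def
  proof (intro exI[of _ B] conjI allI impI)
    show "0 < B" using C L n by (simp add: B_def add_pos_nonneg)
    fix v V u
    assume app: "smooth_approx G v V u" and W: "AE x in lborel. x \<in> G \<longrightarrow> v x \<in> W"
      and E: "weighted_energy p \<alpha> G V < \<infinity>"
    obtain E where E: "weighted_energy p \<alpha> G V = ennreal E" "E \<ge> 0" and fin: "weighted_energy p \<alpha> G V < \<infinity>"
      using E by (cases "weighted_energy p \<alpha> G V") auto
    have [measurable]: "v \<in> borel_measurable borel" using app by (simp add: smooth_approx_def)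
    obtain c where c: "c \<in> W" "(\<integral>\<^sup>+x\<in>S. ennreal (norm (v x - c) powr p) \<partial>lborel) \<le> ennreal (C * E)"
      using PC[OF app W fin] C E by (auto simp: ennreal_mult)
    obtain d where d: "d \<in> W" "(\<integral>\<^sup>+x\<in>T. ennreal (norm (v x - d) powr p) \<partial>lborel) \<le> ennreal (D * E)"
      using PD[OF app W fin] C E by (auto simp: ennreal_mult)
    have cd: "norm (d - c) powr p \<le> L * E"
    proof -
      have "ennreal (norm (d - c) powr p) * ennreal m = (\<integral>\<^sup>+x\<in>S \<inter> T. ennreal (norm (d - c) powr p) \<partial>lborel)"
        by (simp add: nn_integral_cmult_indicator m)
      also have "\<dots> \<le> ennreal (2 powr p) * ((\<integral>\<^sup>+x\<in>S \<inter> T. ennreal (norm (d - v x) powr p) \<partial>lborel)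
          + (\<integral>\<^sup>+x\<in>S \<inter> T. ennreal (norm (v x - c) powr p) \<partial>lborel))"
        using \<open>0 \<le> p\<close> by (intro nn_integral_norm_diff_powr_le) auto
      also have "\<dots> \<le> ennreal (2 powr p) * (ennreal (D * E) + ennreal (C * E))"
        by (intro mult_left_mono add_mono order_trans[OF _ d(2)] order_trans[OF _ c(2)] nn_integral_mono)
           (auto simp: indicator_def norm_minus_commute)
      also have "\<dots> = ennreal (2 powr p * (C + D) * E)"
        using C E by (simp add: algebra_simps flip: ennreal_plus ennreal_mult)
      finally have "norm (d - c) powr p * m \<le> 2 powr p * (C + D) * E"
        using m C E by (simp flip: ennreal_mult add: ennreal_le_iff)
      then show ?thesis using m by (simp add: L_def field_simps)
    qed
    have "(\<integral>\<^sup>+x\<in>T. ennreal (norm (v x - c) powr p) \<partial>lborel) \<le> ennreal (2 powr p) *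
        ((\<integral>\<^sup>+x\<in>T. ennreal (norm (v x - d) powr p) \<partial>lborel) + (\<integral>\<^sup>+x\<in>T. ennreal (norm (d - c) powr p) \<partial>lborel))"
      using \<open>0 \<le> p\<close> by (intro nn_integral_norm_diff_powr_le) auto
    also have "\<dots> \<le> ennreal (2 powr p) * (ennreal (D * E) + ennreal (L * E) * ennreal n)"
      using cd d by (intro mult_left_mono add_mono) (auto simp: nn_integral_cmult_indicator n intro!: mult_right_mono ennreal_leI)
    also have "\<dots> = ennreal (2 powr p * (D + L * n) * E)"
      using C E L n by (simp add: algebra_simps flip: ennreal_plus ennreal_mult)
    finally have T': "(\<integral>\<^sup>+x\<in>T. ennreal (norm (v x - c) powr p) \<partial>lborel) \<le> ennreal (2 powr p * (D + L * n) * E)" .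
    have "(\<integral>\<^sup>+x\<in>S \<union> T. ennreal (norm (v x - c) powr p) \<partial>lborel)
        \<le> (\<integral>\<^sup>+x. ennreal (norm (v x - c) powr p) * indicator S x + ennreal (norm (v x - c) powr p) * indicator T x \<partial>lborel)"
      by (intro nn_integral_mono) (auto simp: indicator_def)
    also have "\<dots> = (\<integral>\<^sup>+x\<in>S. ennreal (norm (v x - c) powr p) \<partial>lborel) + (\<integral>\<^sup>+x\<in>T. ennreal (norm (v x - c) powr p) \<partial>lborel)"
      by (rule nn_integral_add) measurable
    also have "\<dots> \<le> ennreal (C * E) + ennreal (2 powr p * (D + L * n) * E)" by (intro add_mono c T')
    also have "\<dots> = ennreal B * weighted_energy p \<alpha> G V"
      using C E L n by (simp add: B_def algebra_simps flip: ennreal_plus ennreal_mult)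
    finally show "\<exists>c\<in>W. (\<integral>\<^sup>+x\<in>S \<union> T. ennreal (norm (v x - c) powr p) \<partial>lborel) \<le> ennreal B * weighted_energy p \<alpha> G V"
      using c(1) by blast
  qed
qed

text \<open>The local inequalities are propagated over the closure of G, not only over G, so that
  compactness leaves finitely many pieces to be glued.\<close>

lemma poincare_on_domain:
  fixes G W :: "(real^'n) set"
  assumes p: "1 < p" and \<alpha>: "0 \<le> \<alpha>" "\<alpha> < (p - 1) / p" and G: "bounded_lipschitz_domain G"
  shows "poincare_on p \<alpha> G W G"
proof -
  have oG: "open G" and cG: "connected G" and bG: "bounded G" and "G \<noteq> {}"
    using G by (auto simp: bounded_lipschitz_domain_def)
  have fr: "frontier G = closure G - G" using oG by (simp add: frontier_def interior_open)
  have frne: "frontier G \<noteq> {}"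
    using frontier_eq_empty[of G] \<open>G \<noteq> {}\<close> bG not_bounded_UNIV by auto
  let ?P = "poincare_on p \<alpha> G W"
  have local: "\<exists>U. open U \<and> x \<in> U \<and> ?P (G \<inter> U)" if x: "x \<in> closure G" for x
  proof (cases "x \<in> G")
    case True
    then obtain r where r: "0 < r" "ball x r \<subseteq> G" using oG open_contains_ball by blast
    have "?P (ball x (r / 2))" using r by (intro poincare_on_ball p \<alpha> oG frne) auto
    then have "?P (G \<inter> ball x (r / 2))" by (rule poincare_on_subset) auto
    then show ?thesis using r by (intro exI[of _ "ball x (r / 2)"]) auto
  next
    case False
    then have xf: "x \<in> frontier G" using x fr by blast
    obtain e h M r where "boundary_chart G x e h M r" using boundary_chart_exists[OF G xf] by blast
    from poincare_on_boundary[OF p \<alpha> oG xf this] obtain \<rho> where "\<rho> > 0" "?P (G \<inter> ball x \<rho>)" by blast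
    then show ?thesis by (intro exI[of _ "ball x \<rho>"]) auto
  qed
  have glue: "?P (S \<union> T)" if ST: "open S" "open T" "S \<inter> T \<noteq> {}" "T \<subseteq> G" "?P S" "?P T" for S T
  proof (rule poincare_on_Un)
    show "emeasure lborel (S \<inter> T) > 0"
    proof -
      obtain y where y: "y \<in> S \<inter> T" using ST(3) by blast
      obtain \<rho> where \<rho>: "\<rho> > 0" "ball y \<rho> \<subseteq> S \<inter> T"
        using openE[OF open_Int[OF ST(1,2)] y] by blast
      have "0 < emeasure lborel (ball y \<rho>)" using \<rho> by (simp add: emeasure_ball)
      also have "\<dots> \<le> emeasure lborel (S \<inter> T)" using \<rho> that by (intro emeasure_mono) auto
      finally show ?thesis .
    qed
    show "emeasure lborel T < \<infinity>"
      using that bG by (intro emeasure_bounded_finite) (auto intro: bounded_subset)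
  qed (use that p in auto)
  obtain x0 where x0: "x0 \<in> G" using \<open>G \<noteq> {}\<close> by blast
  \<comment> \<open>Every \<open>S\<close> contains x0, so that any two of them overlap when a
    finite subcover is glued in the end. A point of the frontier is reached through the part of G
    near it.\<close>
  define Q where "Q x \<longleftrightarrow> (\<exists>U S. open U \<and> x \<in> U \<and> open S \<and> x0 \<in> S \<and> S \<subseteq> G \<and> ?P S \<and> G \<inter> U \<subseteq> S)" for x
  have Q: "Q b" if b: "b \<in> closure G" for b
  proof (rule connected_induction_simple[where S="closure G" and P=Q and a=x0 and b=b])
    show "connected (closure G)" using cG by (rule connected_imp_connected_closure)
    show x0': "x0 \<in> closure G" using x0 closure_subset by blast
    obtain U where "open U" "x0 \<in> U" "?P (G \<inter> U)" using local[OF x0'] by blast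
    then show "Q x0" unfolding Q_def using x0 oG by (intro exI[of _ U] exI[of _ "G \<inter> U"]) auto
    fix a assume "a \<in> closure G"
    from local[OF this] obtain U where U: "open U" "a \<in> U" "?P (G \<inter> U)" by blast
    show "\<exists>T. openin (top_of_set (closure G)) T \<and> a \<in> T \<and> (\<forall>x\<in>T. \<forall>y\<in>T. Q x \<longrightarrow> Q y)"
    proof (intro exI[of _ "closure G \<inter> U"] conjI ballI impI)
      fix x y assume x: "x \<in> closure G \<inter> U" and y: "y \<in> closure G \<inter> U" and "Q x"
      then obtain U' S where S: "open U'" "x \<in> U'" "open S" "x0 \<in> S" "S \<subseteq> G" "?P S" "G \<inter> U' \<subseteq> S"
        unfolding Q_def by blast
      \<comment> \<open>x lies in the closure of G and in both neighbourhoods, so G meets their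
        intersection: the pieces overlap even if x is on the frontier.\<close>
      have "G \<inter> (U \<inter> U') \<noteq> {}"
        using x S U open_Int_closure_eq_empty[of "U \<inter> U'" G] by blast
      then have "?P (S \<union> (G \<inter> U))" using S U oG by (intro glue) auto
      then show "Q y" unfolding Q_def using S U y oG by (intro exI[of _ U] exI[of _ "S \<union> (G \<inter> U)"]) auto
    qed (use U \<open>a \<in> closure G\<close> in auto)
  qed (use b in auto)
  have "\<forall>b\<in>closure G. \<exists>U S. open U \<and> b \<in> U \<and> open S \<and> x0 \<in> S \<and> S \<subseteq> G \<and> ?P S \<and> G \<inter> U \<subseteq> S"
    using Q unfolding Q_def by blast
  then obtain U S where US: "\<And>b. b \<in> closure G \<Longrightarrow> open (U b) \<and> b \<in> U b \<and> open (S b) \<and> x0 \<in> S b \<and> S b \<subseteq> G \<and> ?P (S b) \<and> G \<inter> U b \<subseteq> S b"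
    by metis
  have "compact (closure G)" using bG by (simp add: compact_closure)
  then obtain F where F: "F \<subseteq> closure G" "finite F" "closure G \<subseteq> (\<Union>b\<in>F. U b)"
    by (rule compactE_image[where f=U and C="closure G"]) (use US in auto)
  have "?P (\<Union>b\<in>F'. S b)" if "finite F'" "F' \<noteq> {}" "F' \<subseteq> closure G" for F'
    using that
  proof (induction F' rule: finite_ne_induct)
    case (insert b F')
    have "?P ((\<Union>b\<in>F'. S b) \<union> S b)"
      using insert US by (intro glue) (auto simp: ex_in_conv[symmetric] subset_iff)
    then show ?case by (simp add: Un_commute)
  qed (use US in auto)
  moreover have "F \<noteq> {}" using F x0 closure_subset by fastforce
  ultimately have "?P (\<Union>b\<in>F. S b)" using F by blast
  moreover have "G \<subseteq> (\<Union>b\<in>F. S b)"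
  proof
    fix x assume "x \<in> G"
    then obtain b where b: "b \<in> F" "x \<in> U b" using F(3) closure_subset by blast
    then have "x \<in> S b" using US[of b] F(1) \<open>x \<in> G\<close> by blast
    then show "x \<in> (\<Union>b\<in>F. S b)" using b by blast
  qed
  ultimately show ?thesis by (rule poincare_on_subset)
qed

section \<open>The trace condition\<close>

text \<open>Let \<pi> y be the frontier point above y. Where g \<bullet> \<nu> vanishes, c \<bullet>
  \<nu> x = (c - g (\<pi> y)) \<bullet> \<nu> (\<pi> y) - c \<bullet> (\<nu> (\<pi> y) - \<nu> x).
  The first term is bounded by way of v y, the second by continuity of \<nu>; averaging over the
  layer removes y. The remainder with \<epsilon> still contains c and is absorbed later.\<close>

lemma trace_estimate:
  fixes G A :: "(real^'n) set" and \<nu> :: "real^'n \<Rightarrow> real^'n"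
  assumes dim: "CARD('n) \<ge> 2" and p: "1 < p" and \<alpha>: "0 \<le> \<alpha>" "\<alpha> < (p - 1) / p"
    and G: "bounded_lipschitz_domain G" and A: "openin (top_of_set (frontier G)) A"
    and cont: "continuous_on A \<nu>" and x: "x \<in> A" and \<epsilon>: "0 < \<epsilon>"
  shows "\<exists>C>0. \<forall>v V u g c. smooth_approx G v V u \<longrightarrow> g \<in> borel_measurable borel \<longrightarrow>
     (\<lambda>k. \<integral>\<^sup>+y\<in>frontier G. ennreal (norm (u k y - g y)) \<partial>hausdorff_measure (real CARD('n) - 1)) \<longlonglongrightarrow> 0 \<longrightarrow>
     (AE y in hausdorff_measure (real CARD('n) - 1). y \<in> A \<longrightarrow> g y \<bullet> \<nu> y = 0) \<longrightarrow>
     ennreal (\<bar>c \<bullet> \<nu> x\<bar> powr p) \<le> ennreal C * ((\<integral>\<^sup>+y\<in>G. ennreal (norm (v y - c) powr p) \<partial>lborel)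
       + weighted_energy p \<alpha> G V) + ennreal ((2 * \<epsilon> * norm c) powr p)"
proof -
  let ?H = "hausdorff_measure (real CARD('n) - 1) :: (real^'n) measure"
  have oG: "open G" and bG: "bounded G" using G by (auto simp: bounded_lipschitz_domain_def)
  have [measurable]: "G \<in> sets borel" using oG by simp
  have dim': "2 \<le> DIM(real^'n)" using dim by simp
  obtain T where T: "open T" "A = frontier G \<inter> T" using A by (auto simp: openin_open)
  then have xf: "x \<in> frontier G" "x \<in> T" using x by auto
  obtain e h M r where ch: "boundary_chart G x e h M r" using boundary_chart_exists[OF G xf(1)] by blast
  then have e: "norm e = 1" and M: "1 \<le> M" and r: "0 < r" and hx: "h x = 0"
    and lip: "\<And>y z. \<bar>h y - h z\<bar> \<le> M * norm (y - z)" and sh: "\<And>y t. h (y + t *\<^sub>R e) = h y + t"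
    and inG: "\<And>y. y \<in> ball x r \<Longrightarrow> y \<in> G \<longleftrightarrow> h y < 0"
    and inF: "\<And>y. y \<in> ball x r \<Longrightarrow> y \<in> frontier G \<longleftrightarrow> h y = 0"
    by (auto simp: boundary_chart_def)
  have "M-lipschitz_on UNIV h" using lip M by (auto simp: lipschitz_on_def dist_norm)
  then have hc: "continuous_on UNIV h" by (rule lipschitz_on_continuous_on)
  obtain \<delta> where \<delta>: "0 < \<delta>" "\<And>z. z \<in> A \<Longrightarrow> dist z x < \<delta> \<Longrightarrow> dist (\<nu> z) (\<nu> x) < \<epsilon>"
    using cont x \<epsilon> by (auto simp: continuous_on_iff) metis
  obtain r1 where r1: "0 < r1" "ball x r1 \<subseteq> T" using T(1) xf(2) open_contains_ball by blast
  define r0 where "r0 = min r (min r1 \<delta>)"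
  have r0: "0 < r0" "r0 \<le> r" "r0 \<le> r1" "r0 \<le> \<delta>" using r r1 \<delta> by (auto simp: r0_def)
  \<comment> \<open>A point of G within \<rho> of x lies at most M \<rho> below the graph, so its
    vertical path stays within \<rho> + M \<rho> = r0 of x.\<close>
  define \<rho> where "\<rho> = r0 / (1 + M)"
  have "(1 + M) * \<rho> = r0" "0 < \<rho>" using r0 M by (simp_all add: \<rho>_def)
  then have \<rho>: "0 < \<rho>" "\<rho> + M * \<rho> = r0" by (simp_all add: distrib_right)
  define S where "S = G \<inter> ball x \<rho>"
  define l where "l y = - h y" for y
  have [measurable]: "l \<in> borel_measurable borel"
    unfolding l_def[abs_def] using hc by (intro borel_measurable_continuous_onI continuous_intros)
  have oS: "open S" using oG by (auto simp: S_def)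
  then have [measurable]: "S \<in> sets borel" by simp
  have SG: "S \<subseteq> G" by (auto simp: S_def)
  have near: "y + t *\<^sub>R e \<in> ball x r0" if "y \<in> S" "0 \<le> t" "t \<le> l y" for y t
  proof -
    have "dist x y < \<rho>" using that by (simp add: S_def)
    then have "M * norm (y - x) \<le> M * \<rho>" using M by (intro mult_left_mono) (auto simp: dist_norm norm_minus_commute)
    then have "t \<le> M * \<rho>" using lip[of y x] hx that by (simp add: l_def)
    moreover have "dist x (y + t *\<^sub>R e) \<le> dist x y + dist y (y + t *\<^sub>R e)" by (rule dist_triangle)
    moreover have "dist y (y + t *\<^sub>R e) = t" using that e by (simp add: dist_norm)
    ultimately show ?thesis using \<open>dist x y < \<rho>\<close> \<rho> by simp
  qed
  have \<rho>r: "\<rho> \<le> r" using \<rho> r0 M by (smt (verit) mult_nonneg_nonneg)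
  have lS: "0 \<le> l y \<and> l y \<le> M * \<rho>" if y: "y \<in> S" for y
  proof -
    have d: "dist x y < \<rho>" "y \<in> G" using y by (auto simp: S_def)
    then have "h y < 0" using inG[of y] \<rho>r by simp
    moreover have "M * norm (y - x) \<le> M * \<rho>" using M d by (intro mult_left_mono) (auto simp: dist_norm norm_minus_commute)
    ultimately show ?thesis using lip[of y x] hx by (simp add: l_def)
  qed
  have seg: "y + t *\<^sub>R e \<in> G \<and> 1 / M * (l y - t) \<le> infdist (y + t *\<^sub>R e) (frontier G)"
    if "y \<in> S" "0 \<le> t" "t < l y" for y t
  proof -
    have "y + t *\<^sub>R e \<in> ball x r" using near[of y t] that r0 by auto
    moreover have "- h (y + t *\<^sub>R e) = l y - t" by (simp add: sh l_def)
    ultimately show ?thesis using boundary_chart_neg_height[OF ch, of "y + t *\<^sub>R e"] that by simp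
  qed
  define \<pi> where "\<pi> y = y + l y *\<^sub>R e" for y
  have \<pi>m [measurable]: "\<pi> \<in> borel_measurable borel" unfolding \<pi>_def[abs_def] by measurable
  have \<pi>: "\<pi> y \<in> frontier G \<and> \<pi> y \<in> A \<and> dist (\<nu> (\<pi> y)) (\<nu> x) < \<epsilon>" if y: "y \<in> S" for y
  proof -
    have b: "\<pi> y \<in> ball x r0" using near[of y "l y"] lS[OF y] y by (simp add: \<pi>_def)
    have "h (\<pi> y) = 0" unfolding \<pi>_def sh l_def by simp
    then have "\<pi> y \<in> frontier G" using inF[of "\<pi> y"] r0 b by simp
    moreover have "\<pi> y \<in> T" using b r1 r0 by auto
    ultimately have "\<pi> y \<in> A" using T by blast
    then show ?thesis using \<open>\<pi> y \<in> frontier G\<close> \<delta>(2)[of "\<pi> y"] b r0 by (simp add: dist_commute)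
  qed
  define m where "m = measure lborel S"
  have "S \<noteq> {}"
  proof -
    have "x \<in> closure G" using xf(1) by (simp add: frontier_def)
    then obtain y where "y \<in> G" "dist y x < \<rho>" using \<rho> by (auto simp: closure_approachable)
    then show ?thesis by (auto simp: S_def dist_commute)
  qed
  have mfin: "emeasure lborel S = ennreal m"
    unfolding m_def using emeasure_bounded_finite[OF bounded_subset[OF bG SG]]
    by (intro emeasure_eq_ennreal_measure) simp
  have m: "0 < m"
  proof -
    obtain y where y: "y \<in> S" using \<open>S \<noteq> {}\<close> by blast
    obtain s where s: "s > 0" "ball y s \<subseteq> S" using openE[OF oS y] by blast
    have "0 < emeasure lborel (ball y s)" using s by (simp add: emeasure_ball)
    also have "\<dots> \<le> emeasure lborel S" using s by (intro emeasure_mono) auto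
    finally show ?thesis by (simp add: mfin)
  qed
  define K where "K = norm e powr p * line_const p \<alpha> (1 / M) (M * \<rho>) * (M * \<rho>)"
  have K: "0 \<le> K" using line_const_pos[OF p \<alpha>(2), of "1 / M" "M * \<rho>"] M \<rho> by (simp add: K_def)
  define N where "N = norm (\<nu> x) + \<epsilon>"
  have N: "0 < N" using \<epsilon> by (simp add: N_def add_nonneg_pos)
  \<comment> \<open>\<open>4 powr p\<close> comes from splitting the power of a sum twice,
    \<open>N\<close> bounds the normals near x, \<open>1 + K\<close> pays for the passage from c
    through v to the trace, and \<open>m\<close> comes from averaging over \<open>S\<close>.\<close>
  define C where "C = 4 powr p * N powr p * (1 + K) / m"
  have C: "0 < C" using K N m by (simp add: C_def)
  have main: "ennreal (\<bar>c \<bullet> \<nu> x\<bar> powr p) \<le> ennreal C * ((\<integral>\<^sup>+y\<in>G. ennreal (norm (v y - c) powr p) \<partial>lborel)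
       + weighted_energy p \<alpha> G V) + ennreal ((2 * \<epsilon> * norm c) powr p)"
    if app: "smooth_approx G v V u" and g[measurable]: "g \<in> borel_measurable borel"
      and lim: "(\<lambda>k. \<integral>\<^sup>+y\<in>frontier G. ennreal (norm (u k y - g y)) \<partial>?H) \<longlonglongrightarrow> 0"
      and ae: "AE y in ?H. y \<in> A \<longrightarrow> g y \<bullet> \<nu> y = 0" for v V u g c
  proof -
    let ?E = "weighted_energy p \<alpha> G V"
    let ?C = "ennreal (projection_const DIM(real^'n) (M * \<rho>))"
    have [measurable]: "v \<in> borel_measurable borel" using app by (simp add: smooth_approx_def)
    have [measurable]: "u k \<in> borel_measurable borel" for k
      using app by (intro borel_measurable_continuous_onI)
        (auto simp: smooth_approx_def intro!: continuous_at_imp_continuous_on differentiable_imp_continuous_within)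
    have R: "0 \<le> M * \<rho>" using M \<rho> by simp
    have le0: "(\<integral>\<^sup>+y\<in>S. ennreal (norm (u k (y + l y *\<^sub>R e) - g (\<pi> y))) \<partial>lborel)
       \<le> ?C * (\<integral>\<^sup>+y\<in>frontier G. ennreal (norm (u k y - g y)) \<partial>?H)" for k
      using nn_integral_projection_le[OF e R dim' lS, where S=S and F="frontier G" and g="\<lambda>z. ennreal (norm (u k z - g z))"] \<pi>
      by (simp add: \<pi>_def)
    have lim0: "(\<lambda>k. ?C * (\<integral>\<^sup>+y\<in>frontier G. ennreal (norm (u k y - g y)) \<partial>?H)) \<longlonglongrightarrow> 0"
      using tendsto_mult_ennreal[OF tendsto_const[of ?C] lim] by simp
    have lim': "(\<lambda>k. \<integral>\<^sup>+y\<in>S. ennreal (norm (u k (y + l y *\<^sub>R e) - g (\<pi> y))) \<partial>lborel) \<longlonglongrightarrow> 0"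
      by (rule tendsto_sandwich[OF _ _ tendsto_const lim0]) (use le0 in \<open>auto intro!: always_eventually\<close>)
    have est: "(\<integral>\<^sup>+y\<in>S. ennreal (norm (g (\<pi> y) - v y) powr p) \<partial>lborel) \<le> ennreal K * ?E"
      unfolding K_def
      by (rule line_estimate[OF p \<alpha> oG _ SG _ _ lS _ _ seg app lim']) (use M \<rho> in auto)
    \<comment> \<open>Hausdorff null sets pull back under \<pi> to Lebesgue null sets, so the trace
      condition holds at \<pi> y for almost every y in the layer.\<close>
    obtain Z where Z: "{y \<in> space ?H. \<not> (y \<in> A \<longrightarrow> g y \<bullet> \<nu> y = 0)} \<subseteq> Z" "Z \<in> sets ?H" "emeasure ?H Z = 0"
      using ae by (rule AE_E)
    have [measurable]: "Z \<in> sets borel" using Z(2) by simp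
    have "emeasure lborel {y \<in> S. y + l y *\<^sub>R e \<in> Z} \<le> ?C * hausdorff_outer (real DIM(real^'n) - 1) Z"
      by (rule emeasure_projection_le_hausdorff[OF e R dim' lS])
    also have "hausdorff_outer (real DIM(real^'n) - 1) Z = 0"
      using Z(3) emeasure_hausdorff_measure[of Z "real DIM(real^'n) - 1"] by simp
    finally have "emeasure lborel {y \<in> S. \<pi> y \<in> Z} = 0" by (simp add: \<pi>_def)
    then have "{y \<in> S. \<pi> y \<in> Z} \<in> null_sets lborel" by (auto simp: null_sets_def)
    then have "AE y in lborel. y \<notin> {y \<in> S. \<pi> y \<in> Z}" by (rule AE_not_in)
    then have pt: "AE y in lborel. ennreal (\<bar>c \<bullet> \<nu> x\<bar> powr p) * indicator S y
        \<le> ennreal (4 powr p * N powr p) * (ennreal (norm (v y - c) powr p) * indicator S y + ennreal (norm (g (\<pi> y) - v y) powr p) * indicator S y)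
          + ennreal ((2 * \<epsilon> * norm c) powr p) * indicator S y"
    proof eventually_elim
      case (elim y)
      show ?case
      proof (cases "y \<in> S")
        case True
        then have "\<pi> y \<notin> Z" using elim by simp
        then have g0: "g (\<pi> y) \<bullet> \<nu> (\<pi> y) = 0" using Z(1) \<pi>[OF True] by auto
        have n: "norm (\<nu> (\<pi> y) - \<nu> x) < \<epsilon>" using \<pi>[OF True] by (simp add: dist_norm)
        have nN: "norm (\<nu> (\<pi> y)) \<le> N" using n norm_triangle_sub[of "\<nu> (\<pi> y)" "\<nu> x"] by (simp add: N_def)
        have "c \<bullet> \<nu> x = (c - g (\<pi> y)) \<bullet> \<nu> (\<pi> y) - c \<bullet> (\<nu> (\<pi> y) - \<nu> x)"
          by (simp add: inner_diff_left inner_diff_right g0)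
        then have "\<bar>c \<bullet> \<nu> x\<bar> \<le> \<bar>(c - g (\<pi> y)) \<bullet> \<nu> (\<pi> y)\<bar> + \<bar>c \<bullet> (\<nu> (\<pi> y) - \<nu> x)\<bar>" by simp
        also have "\<dots> \<le> norm (c - g (\<pi> y)) * norm (\<nu> (\<pi> y)) + norm c * norm (\<nu> (\<pi> y) - \<nu> x)"
          by (intro add_mono Cauchy_Schwarz_ineq2)
        also have "\<dots> \<le> norm (c - g (\<pi> y)) * N + norm c * \<epsilon>"
          using n nN by (intro add_mono mult_left_mono) auto
        finally have "\<bar>c \<bullet> \<nu> x\<bar> powr p \<le> (norm (c - g (\<pi> y)) * N + norm c * \<epsilon>) powr p"
          using p by (intro powr_mono2) auto
        also have "\<dots> \<le> 2 powr p * ((norm (c - g (\<pi> y)) * N) powr p + (norm c * \<epsilon>) powr p)"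
          using p N \<epsilon> by (intro powr_add_le) auto
        also have "(norm (c - g (\<pi> y)) * N) powr p \<le> 2 powr p * (norm (c - v y) powr p + norm (v y - g (\<pi> y)) powr p) * N powr p"
          using norm_diff_powr_le[of p c "g (\<pi> y)" "v y"] p N by (simp add: powr_mult mult_right_mono)
        also have "2 powr p * (2 powr p * (norm (c - v y) powr p + norm (v y - g (\<pi> y)) powr p) * N powr p + (norm c * \<epsilon>) powr p)
           = 4 powr p * N powr p * (norm (v y - c) powr p + norm (g (\<pi> y) - v y) powr p) + (2 * \<epsilon> * norm c) powr p"
        proof -
          have "(2::real) powr p * 2 powr p = 4 powr p" using powr_mult[of 2 2 p] by simp
          moreover have "2 powr p * (norm c * \<epsilon>) powr p = (2 * \<epsilon> * norm c) powr p"
            using \<epsilon> by (simp add: powr_mult ac_simps)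
          moreover have "2 powr p * (2 powr p * X * N powr p + Y) = (2 powr p * 2 powr p) * N powr p * X + 2 powr p * Y" for X Y
            by (simp add: algebra_simps)
          ultimately show ?thesis by (simp only: norm_minus_commute[of c "v y"] norm_minus_commute[of "v y" "g (\<pi> y)"])
        qed
        finally have "ennreal (\<bar>c \<bullet> \<nu> x\<bar> powr p) \<le> ennreal (4 powr p * N powr p * (norm (v y - c) powr p + norm (g (\<pi> y) - v y) powr p) + (2 * \<epsilon> * norm c) powr p)"
          using p by (intro ennreal_leI) (simp add: mult_left_mono)
        then show ?thesis using True by (simp flip: ennreal_plus ennreal_mult)
      qed simp
    qed
    have L: "(\<integral>\<^sup>+y. ennreal (\<bar>c \<bullet> \<nu> x\<bar> powr p) * indicator S y \<partial>lborel) = ennreal m * ennreal (\<bar>c \<bullet> \<nu> x\<bar> powr p)"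
      by (subst nn_integral_cmult_indicator) (simp_all add: mfin mult.commute)
    have "(\<integral>\<^sup>+y. ennreal (\<bar>c \<bullet> \<nu> x\<bar> powr p) * indicator S y \<partial>lborel)
       \<le> (\<integral>\<^sup>+y. ennreal (4 powr p * N powr p) * (ennreal (norm (v y - c) powr p) * indicator S y + ennreal (norm (g (\<pi> y) - v y) powr p) * indicator S y)
          + ennreal ((2 * \<epsilon> * norm c) powr p) * indicator S y \<partial>lborel)"
      by (rule nn_integral_mono_AE[OF pt])
    also have "\<dots> = ennreal (4 powr p * N powr p) * ((\<integral>\<^sup>+y\<in>S. ennreal (norm (v y - c) powr p) \<partial>lborel)
        + (\<integral>\<^sup>+y\<in>S. ennreal (norm (g (\<pi> y) - v y) powr p) \<partial>lborel)) + ennreal ((2 * \<epsilon> * norm c) powr p) * ennreal m"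
      by (simp add: nn_integral_add nn_integral_cmult nn_integral_cmult_indicator mfin)
    also have "\<dots> \<le> ennreal (4 powr p * N powr p) * ((\<integral>\<^sup>+y\<in>G. ennreal (norm (v y - c) powr p) \<partial>lborel)
        + ennreal K * ?E) + ennreal ((2 * \<epsilon> * norm c) powr p) * ennreal m"
      using SG by (intro add_mono mult_left_mono est nn_integral_mono) (auto simp: indicator_def)
    also have "\<dots> \<le> ennreal (4 powr p * N powr p) * (ennreal (1 + K) * ((\<integral>\<^sup>+y\<in>G. ennreal (norm (v y - c) powr p) \<partial>lborel)
        + ?E)) + ennreal ((2 * \<epsilon> * norm c) powr p) * ennreal m"
    proof (intro add_mono mult_left_mono order_refl)
      let ?I = "\<integral>\<^sup>+y\<in>G. ennreal (norm (v y - c) powr p) \<partial>lborel"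
      have "1 * ?I + ennreal K * ?E \<le> ennreal (1 + K) * ?I + ennreal (1 + K) * ?E"
        using K by (intro add_mono mult_right_mono) auto
      then show "?I + ennreal K * ?E \<le> ennreal (1 + K) * (?I + ?E)" by (simp add: distrib_left)
    qed auto
    finally have le: "ennreal m * ennreal (\<bar>c \<bullet> \<nu> x\<bar> powr p) \<le> ennreal (4 powr p * N powr p) * (ennreal (1 + K) * ((\<integral>\<^sup>+y\<in>G. ennreal (norm (v y - c) powr p) \<partial>lborel)
        + ?E)) + ennreal ((2 * \<epsilon> * norm c) powr p) * ennreal m"
      unfolding L .
    have "ennreal (1 / m) * (ennreal m * ennreal (\<bar>c \<bullet> \<nu> x\<bar> powr p)) \<le> ennreal (1 / m) * (ennreal (4 powr p * N powr p) * (ennreal (1 + K) * ((\<integral>\<^sup>+y\<in>G. ennreal (norm (v y - c) powr p) \<partial>lborel)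
        + ?E)) + ennreal ((2 * \<epsilon> * norm c) powr p) * ennreal m)"
      by (rule mult_left_mono[OF le]) simp
    also have "ennreal (1 / m) * (ennreal m * ennreal (\<bar>c \<bullet> \<nu> x\<bar> powr p)) = ennreal (\<bar>c \<bullet> \<nu> x\<bar> powr p)"
      using m by (simp flip: ennreal_mult)
    also have "ennreal (1 / m) * (ennreal (4 powr p * N powr p) * (ennreal (1 + K) * ((\<integral>\<^sup>+y\<in>G. ennreal (norm (v y - c) powr p) \<partial>lborel)
        + ?E)) + ennreal ((2 * \<epsilon> * norm c) powr p) * ennreal m) = ennreal C * ((\<integral>\<^sup>+y\<in>G. ennreal (norm (v y - c) powr p) \<partial>lborel) + ?E)
        + ennreal ((2 * \<epsilon> * norm c) powr p)"
    proof -
      have 1: "ennreal (1 / m) * (ennreal (4 powr p * N powr p) * ennreal (1 + K)) = ennreal C"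
        using m K by (simp add: C_def del: ennreal_plus flip: ennreal_mult)
      have 2: "ennreal (1 / m) * (ennreal ((2 * \<epsilon> * norm c) powr p) * ennreal m) = ennreal ((2 * \<epsilon> * norm c) powr p)"
        using m by (simp flip: ennreal_mult)
      show ?thesis unfolding distrib_left[of "ennreal (1 / m)"] 2 1[symmetric] by (simp only: mult.assoc)
    qed
    finally show ?thesis .
  qed
  show ?thesis using C main by blast
qed

text \<open>The sum of the |c \<bullet> b| is positive on the unit sphere of the span, since a
  vector of the span orthogonal to all of B is orthogonal to itself. Compactness gives a positive
  minimum, and some b carries its share of it.\<close>

lemma span_coercive:
  fixes B :: "(real^'n) set"
  assumes "finite B"
  shows "\<exists>\<mu>>0. \<forall>c\<in>span B. c \<noteq> 0 \<longrightarrow> (\<exists>b\<in>B. \<mu> * norm c \<le> \<bar>c \<bullet> b\<bar>)"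
proof -
  define f where "f c = (\<Sum>b\<in>B. \<bar>c \<bullet> b\<bar>)" for c
  let ?K = "sphere 0 1 \<inter> span B"
  have "compact ?K" by (intro compact_Int_closed compact_sphere closed_span)
  have "\<exists>\<mu>>0. \<forall>c\<in>?K. \<mu> \<le> f c"
  proof (cases "?K = {}")
    case False
    have "continuous_on ?K f" unfolding f_def[abs_def] by (intro continuous_intros)
    then obtain c where c: "c \<in> ?K" "\<And>d. d \<in> ?K \<Longrightarrow> f c \<le> f d"
      using continuous_attains_inf[OF \<open>compact ?K\<close> False] by blast
    have "0 \<le> f c" by (auto simp: f_def sum_nonneg)
    moreover have "f c \<noteq> 0"
    proof
      assume "f c = 0"
      then have "\<And>b. b \<in> B \<Longrightarrow> c \<bullet> b = 0"
        using assms by (simp add: f_def sum_nonneg_eq_0_iff)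
      then have "orthogonal c c" using c(1) by (intro orthogonal_to_span[of c B]) (auto simp: orthogonal_def)
      then show False using c(1) by (auto simp: orthogonal_self)
    qed
    ultimately show ?thesis using c by (intro exI[of _ "f c"]) auto
  qed (auto intro: exI[of _ 1])
  then obtain \<mu> where \<mu>: "\<mu> > 0" "\<And>c. c \<in> ?K \<Longrightarrow> \<mu> \<le> f c" by blast
  \<comment> \<open>One more than the cardinality makes the bound on the sum strict and the
    denominator positive for empty \<open>B\<close>.\<close>
  define n where "n = real (card B) + 1"
  have "\<exists>b\<in>B. \<mu> / n * norm c \<le> \<bar>c \<bullet> b\<bar>" if c: "c \<in> span B" "c \<noteq> 0" for c
  proof (rule ccontr)
    assume "\<not> ?thesis"
    then have less: "\<And>b. b \<in> B \<Longrightarrow> \<bar>c \<bullet> b\<bar> \<le> \<mu> / n * norm c" by force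
    have "c /\<^sub>R norm c \<in> ?K" using c by (auto intro: span_scale)
    then have "\<mu> \<le> f (c /\<^sub>R norm c)" by (rule \<mu>)
    also have "\<dots> = f c / norm c" by (simp add: f_def abs_mult divide_inverse sum_distrib_left mult.commute)
    finally have "\<mu> * norm c \<le> f c" using c by (simp add: field_simps)
    also have "f c \<le> (\<Sum>b\<in>B. \<mu> / n * norm c)" unfolding f_def by (rule sum_mono) (rule less)
    also have "\<dots> = real (card B) / n * (\<mu> * norm c)" by simp
    also have "\<dots> < 1 * (\<mu> * norm c)" using \<mu> c by (intro mult_strict_right_mono) (auto simp: n_def)
    finally show False by simp
  qed
  then show ?thesis using \<mu>(1) by (intro exI[of _ "\<mu> / n"]) (auto simp: n_def add_nonneg_pos)
qed

text \<open>The energy controls v - c by Poincare and each c \<bullet> b by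
  \<open>trace_estimate\<close>, the latter up to a multiple of |c| that coercivity absorbs.\<close>

lemma normal_trace_inequality:
  fixes G A :: "(real^'n) set" and \<nu> :: "real^'n \<Rightarrow> real^'n"
  assumes dim: "CARD('n) \<ge> 2" and p: "1 < p" and \<alpha>: "0 \<le> \<alpha>" "\<alpha> < (p - 1) / p"
    and G: "bounded_lipschitz_domain G" and A: "openin (top_of_set (frontier G)) A"
    and cont: "continuous_on A \<nu>"
  shows "\<exists>C>0. \<forall>v V u g. smooth_approx G v V u \<longrightarrow> g \<in> borel_measurable borel \<longrightarrow>
     (AE x in lborel. x \<in> G \<longrightarrow> v x \<in> span (\<nu> ` A)) \<longrightarrow> weighted_energy p \<alpha> G V < \<infinity> \<longrightarrow>
     (\<lambda>k. \<integral>\<^sup>+y\<in>frontier G. ennreal (norm (u k y - g y)) \<partial>hausdorff_measure (real CARD('n) - 1)) \<longlonglongrightarrow> 0 \<longrightarrow>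
     (AE y in hausdorff_measure (real CARD('n) - 1). y \<in> A \<longrightarrow> g y \<bullet> \<nu> y = 0) \<longrightarrow>
     (\<integral>\<^sup>+y\<in>G. ennreal (norm (v y) powr p) \<partial>lborel) \<le> ennreal C * weighted_energy p \<alpha> G V"
proof -
  let ?H = "hausdorff_measure (real CARD('n) - 1) :: (real^'n) measure"
  have oG: "open G" and bG: "bounded G" using G by (auto simp: bounded_lipschitz_domain_def)
  have [measurable]: "G \<in> sets borel" using oG by simp
  \<comment> \<open>The basis is taken among the normals themselves: each b is \<nu> x for some x in
    A, so \<open>trace_estimate\<close> is invoked at finitely many points.\<close>
  obtain B where B: "B \<subseteq> \<nu> ` A" "independent B" "\<nu> ` A \<subseteq> span B"
    by (rule maximal_independent_subset)
  have finB: "finite B" using B(2) by (rule independent_imp_finite)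
  have W: "span (\<nu> ` A) = span B"
    using B by (intro subset_antisym span_minimal span_mono subspace_span) auto
  obtain \<mu> where \<mu>: "\<mu> > 0" "\<And>c. c \<in> span B \<Longrightarrow> c \<noteq> 0 \<Longrightarrow> \<exists>b\<in>B. \<mu> * norm c \<le> \<bar>c \<bullet> b\<bar>"
    using span_coercive[OF finB] by blast
  let ?tr = "\<lambda>b C. \<forall>v V u g c. smooth_approx G v V u \<longrightarrow> g \<in> borel_measurable borel \<longrightarrow>
     (\<lambda>k. \<integral>\<^sup>+y\<in>frontier G. ennreal (norm (u k y - g y)) \<partial>?H) \<longlonglongrightarrow> 0 \<longrightarrow>
     (AE y in ?H. y \<in> A \<longrightarrow> g y \<bullet> \<nu> y = 0) \<longrightarrow>
     ennreal (\<bar>c \<bullet> b\<bar> powr p) \<le> ennreal C * ((\<integral>\<^sup>+y\<in>G. ennreal (norm (v y - c) powr p) \<partial>lborel)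
       + weighted_energy p \<alpha> G V) + ennreal ((2 * (\<mu> / 4) * norm c) powr p)"
  have "\<exists>C>0. ?tr b C" if bB: "b \<in> B" for b
  proof -
    obtain x where x: "x \<in> A" "b = \<nu> x" using bB B(1) by blast
    show ?thesis unfolding x(2)
      by (rule trace_estimate[OF dim p \<alpha> G A cont x(1)]) (use \<mu> in simp)
  qed
  then obtain D where D: "\<And>b. b \<in> B \<Longrightarrow> D b > 0" "\<And>b. b \<in> B \<Longrightarrow> ?tr b (D b)"
    using bchoice[of B "\<lambda>b C. C > 0 \<and> ?tr b C"] by blast
  define C1 where "C1 = (\<Sum>b\<in>B. D b) + 1"
  have "0 \<le> (\<Sum>b\<in>B. D b)" using D(1) by (intro sum_nonneg less_imp_le)
  then have C1: "0 < C1" by (simp add: C1_def)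
  have DC: "D b \<le> C1" if "b \<in> B" for b
  proof -
    have "D b \<le> (\<Sum>b\<in>B. D b)" using that finB D(1) by (intro member_le_sum) (auto intro: less_imp_le)
    then show ?thesis by (simp add: C1_def)
  qed
  obtain CP where CP: "CP > 0" "\<And>v V u. smooth_approx G v V u \<Longrightarrow> AE x in lborel. x \<in> G \<longrightarrow> v x \<in> span B \<Longrightarrow>
     weighted_energy p \<alpha> G V < \<infinity> \<Longrightarrow>
     \<exists>c\<in>span B. (\<integral>\<^sup>+x\<in>G. ennreal (norm (v x - c) powr p) \<partial>lborel) \<le> ennreal CP * weighted_energy p \<alpha> G V"
    using poincare_on_domain[OF p \<alpha> G, of "span B"] unfolding poincare_on_def by blast
  \<comment> \<open>With \<epsilon> = \<mu> / 4 the remainder is (\<mu> / 2 * |c|)^p, strictly below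
    the coercive term (\<mu> * |c|)^p for c \<noteq> 0; \<theta> is the gap.\<close>
  define \<theta> where "\<theta> = \<mu> powr p - (\<mu> / 2) powr p"
  have \<theta>: "0 < \<theta>" using \<mu>(1) p powr_less_mono2[of p "\<mu> / 2" \<mu>] by (simp add: \<theta>_def)
  define C2 where "C2 = C1 * (CP + 1) / \<theta>"
  have C2: "0 < C2" using C1 CP \<theta> by (simp add: C2_def)
  define n where "n = measure lborel G"
  have n: "0 \<le> n" "emeasure lborel G = ennreal n"
    unfolding n_def using emeasure_bounded_finite[OF bG] by (auto intro: emeasure_eq_ennreal_measure)
  define C where "C = 2 powr p * (CP + C2 * n)"
  have C: "0 < C" using CP C2 n by (simp add: C_def add_pos_nonneg)
  have "(\<integral>\<^sup>+y\<in>G. ennreal (norm (v y) powr p) \<partial>lborel) \<le> ennreal C * weighted_energy p \<alpha> G V"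
    if app: "smooth_approx G v V u" and g: "g \<in> borel_measurable borel"
      and v: "AE x in lborel. x \<in> G \<longrightarrow> v x \<in> span (\<nu> ` A)" and fin: "weighted_energy p \<alpha> G V < \<infinity>"
      and lim: "(\<lambda>k. \<integral>\<^sup>+y\<in>frontier G. ennreal (norm (u k y - g y)) \<partial>?H) \<longlonglongrightarrow> 0"
      and ae: "AE y in ?H. y \<in> A \<longrightarrow> g y \<bullet> \<nu> y = 0" for v V u g
  proof -
    have [measurable]: "v \<in> borel_measurable borel" using app by (simp add: smooth_approx_def)
    obtain E where E: "weighted_energy p \<alpha> G V = ennreal E" "E \<ge> 0"
      using fin by (cases "weighted_energy p \<alpha> G V") auto
    obtain c where c: "c \<in> span B" and cI: "(\<integral>\<^sup>+x\<in>G. ennreal (norm (v x - c) powr p) \<partial>lborel) \<le> ennreal (CP * E)"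
      using CP(2)[OF app v[unfolded W] fin] CP(1) E by (auto simp: ennreal_mult)
    have cE: "norm c powr p \<le> C2 * E"
    proof (cases "c = 0")
      case True
      then show ?thesis using C2 E by simp
    next
      case False
      then obtain b where b: "b \<in> B" "\<mu> * norm c \<le> \<bar>c \<bullet> b\<bar>" using \<mu>(2) c by blast
      have "ennreal ((\<mu> * norm c) powr p) \<le> ennreal (\<bar>c \<bullet> b\<bar> powr p)"
        using b p \<mu> by (intro ennreal_leI powr_mono2) auto
      also have "\<dots> \<le> ennreal (D b) * ((\<integral>\<^sup>+y\<in>G. ennreal (norm (v y - c) powr p) \<partial>lborel)
         + weighted_energy p \<alpha> G V) + ennreal ((2 * (\<mu> / 4) * norm c) powr p)"
        using D(2)[OF b(1)] app g lim ae by blast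
      also have "\<dots> \<le> ennreal C1 * (ennreal (CP * E) + ennreal E) + ennreal ((\<mu> / 2 * norm c) powr p)"
        using DC[OF b(1)] cI E by (intro add_mono mult_mono ennreal_leI) auto
      also have "\<dots> = ennreal (C1 * (CP * E + E) + (\<mu> / 2 * norm c) powr p)"
        using C1 CP E by (simp flip: ennreal_plus ennreal_mult)
      finally have "(\<mu> * norm c) powr p \<le> C1 * (CP * E + E) + (\<mu> / 2 * norm c) powr p"
        using C1 CP E by (subst (asm) ennreal_le_iff) auto
      moreover have "(\<mu> * norm c) powr p = \<mu> powr p * norm c powr p" "(\<mu> / 2 * norm c) powr p = (\<mu> / 2) powr p * norm c powr p"
        using \<mu>(1) by (simp_all only: powr_mult norm_ge_zero)
      ultimately have "\<theta> * norm c powr p \<le> C1 * (CP + 1) * E"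
        by (simp add: \<theta>_def algebra_simps)
      then show ?thesis using \<theta> by (simp add: C2_def field_simps)
    qed
    have "(\<integral>\<^sup>+y\<in>G. ennreal (norm (v y - 0) powr p) \<partial>lborel) \<le> ennreal (2 powr p) *
        ((\<integral>\<^sup>+y\<in>G. ennreal (norm (v y - c) powr p) \<partial>lborel) + (\<integral>\<^sup>+y\<in>G. ennreal (norm (c - 0) powr p) \<partial>lborel))"
      using p by (intro nn_integral_norm_diff_powr_le) auto
    also have "(\<integral>\<^sup>+y\<in>G. ennreal (norm (c - 0) powr p) \<partial>lborel) = ennreal (norm c powr p) * ennreal n"
      by (subst nn_integral_cmult_indicator) (simp_all add: n)
    also have "ennreal (2 powr p) * ((\<integral>\<^sup>+y\<in>G. ennreal (norm (v y - c) powr p) \<partial>lborel) + ennreal (norm c powr p) * ennreal n)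
       \<le> ennreal (2 powr p) * (ennreal (CP * E) + ennreal (C2 * E) * ennreal n)"
      using cE by (intro mult_left_mono add_mono cI mult_right_mono ennreal_leI) auto
    also have "\<dots> = ennreal C * weighted_energy p \<alpha> G V"
      using CP C2 E n by (simp add: C_def algebra_simps flip: ennreal_plus ennreal_mult)
    finally show ?thesis by simp
  qed
  then show ?thesis using C by blast
qed

section \<open>Uniqueness of the weak Jacobian\<close>

text \<open>Derivatives of \<open>exp (- c / t)\<close> are polynomials in \<open>1 / t\<close> times the function itself, so this family is
  closed under differentiation. Smooth bumps on boxes increase to indicators as \<open>c\<close> decreases to 0.\<close>

definition flat_exp :: "real \<Rightarrow> real poly \<Rightarrow> real \<Rightarrow> real" where
  "flat_exp c q t = (if 0 < t then poly q (1 / t) * exp (- (c / t)) else 0)"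

lemma poly_times_exp_tendsto_0:
  fixes c :: real
  assumes "0 < c"
  shows "((\<lambda>s. poly q s * exp (- (c * s))) \<longlongrightarrow> 0) at_top"
proof -
  have "((\<lambda>s. s ^ i * exp (- (c * s))) \<longlongrightarrow> 0) at_top" for i
  proof -
    have "filterlim (\<lambda>s. c * s) at_top at_top"
      using assms by (intro filterlim_tendsto_pos_mult_at_top[OF tendsto_const]) (auto simp: filterlim_ident)
    from filterlim_compose[OF tendsto_power_div_exp_0[of i] this]
    have "((\<lambda>s. (1 / c ^ i) * ((c * s) ^ i / exp (c * s))) \<longlongrightarrow> (1 / c ^ i) * 0) at_top"
      by (intro tendsto_mult tendsto_const)
    then show ?thesis using assms by (simp add: power_mult_distrib exp_minus field_simps)
  qed
  then have "((\<lambda>s. \<Sum>i\<le>degree q. coeff q i * (s ^ i * exp (- (c * s)))) \<longlongrightarrow> (\<Sum>i\<le>degree q. coeff q i * 0)) at_top"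
    by (intro tendsto_sum tendsto_mult tendsto_const)
  then show ?thesis by (simp add: poly_altdef sum_distrib_right mult.assoc)
qed

lemma flat_exp_tendsto_0:
  assumes "0 < c" shows "(flat_exp c q \<longlongrightarrow> 0) (at 0)"
proof -
  have "((\<lambda>t. poly q (inverse t) * exp (- (c * inverse t))) \<longlongrightarrow> 0) (at_right 0)"
    by (rule filterlim_compose[OF poly_times_exp_tendsto_0[OF assms] filterlim_inverse_at_top_right])
  moreover have "eventually (\<lambda>t. poly q (inverse t) * exp (- (c * inverse t)) = flat_exp c q t) (at_right 0)"
    by (auto simp: eventually_at_right_field flat_exp_def field_simps intro!: exI[of _ 1])
  ultimately have "(flat_exp c q \<longlongrightarrow> 0) (at_right 0)" by (rule Lim_transform_eventually)
  moreover have "(flat_exp c q \<longlongrightarrow> 0) (at_left 0)"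
    by (rule Lim_transform_eventually[OF tendsto_const])
       (auto simp: eventually_at_left_field flat_exp_def intro!: exI[of _ "-1"])
  ultimately show ?thesis by (simp add: filterlim_split_at)
qed

text \<open>With s = 1 / t one has ds/dt = - s^2, so the t-derivative of q(s) exp (- c s) is s^2 (c
  q(s) - q'(s)) exp (- c s).\<close>

definition flat_deriv :: "real \<Rightarrow> real poly \<Rightarrow> real poly" where
  "flat_deriv c q = monom 1 2 * (smult c q - pderiv q)"

lemma flat_exp_has_derivative:
  assumes c: "0 < c"
  shows "(flat_exp c q has_real_derivative flat_exp c (flat_deriv c q) t) (at t)"
proof -
  consider "t > 0" | "t < 0" | "t = 0" by linarith
  then show ?thesis
  proof cases
    case 1
    have "((\<lambda>t. poly q (1 / t) * exp (- (c / t))) has_real_derivative flat_exp c (flat_deriv c q) t) (at t)"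
      using 1 by (auto intro!: derivative_eq_intros DERIV_chain2[OF poly_DERIV]
          simp: flat_exp_def flat_deriv_def poly_monom power2_eq_square field_simps)
    then show ?thesis
      by (rule has_field_derivative_transform_within_open[where S="{0<..}"]) (use 1 in \<open>auto simp: flat_exp_def\<close>)
  next
    case 2
    have "((\<lambda>t. 0) has_real_derivative flat_exp c (flat_deriv c q) t) (at t)"
      using 2 by (simp add: flat_exp_def)
    then show ?thesis
      by (rule has_field_derivative_transform_within_open[where S="{..<0}"]) (use 2 in \<open>auto simp: flat_exp_def\<close>)
  next
    case 3
    \<comment> \<open>The difference quotient at 0 belongs to the same family: dividing by h
      multiplies the polynomial by its variable 1 / h, which gives \<open>pCons 0 q\<close>.\<close>
    have "(flat_exp c (pCons 0 q) \<longlongrightarrow> 0) (at 0)" by (rule flat_exp_tendsto_0[OF c])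
    moreover have "flat_exp c (pCons 0 q) = (\<lambda>h. (flat_exp c q (0 + h) - flat_exp c q 0) / h)"
      by (auto simp: flat_exp_def fun_eq_iff)
    ultimately have "(flat_exp c q has_real_derivative 0) (at 0)" by (simp add: DERIV_def)
    then show ?thesis using 3 by (simp add: flat_exp_def)
  qed
qed

section \<open>Smoothness of the box bumps\<close>

lemma Ck_imp_continuous: "Ck k f \<Longrightarrow> continuous_on UNIV f"
  by (cases k) (auto intro!: continuous_at_imp_continuous_on differentiable_imp_continuous_within)

lemma Ck_SucD: "Ck (Suc k) f \<Longrightarrow> Ck k f"
proof (induction k arbitrary: f)
  case 0
  then show ?case using Ck_imp_continuous[OF 0] by (simp only: Ck.simps)
next
  case (Suc k)
  then show ?case by (metis Ck.simps(2))
qed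

lemma Ck_const: "Ck k (\<lambda>x. r)"
  by (induction k arbitrary: r) (auto simp: frechet_derivative_const)

lemma Ck_add: "Ck k f \<Longrightarrow> Ck k g \<Longrightarrow> Ck k (\<lambda>x. f x + g x)"
proof (induction k arbitrary: f g)
  case (Suc k)
  then have d: "f differentiable (at x)" "g differentiable (at x)" for x by auto
  have "frechet_derivative (\<lambda>x. f x + g x) (at x) = (\<lambda>h. frechet_derivative f (at x) h + frechet_derivative g (at x) h)" for x
    using d[of x] by (intro frechet_derivative_at[symmetric] has_derivative_add) (auto simp: frechet_derivative_works[symmetric])
  then show ?case using Suc d by auto
qed (auto intro: continuous_intros)

lemma Ck_mult: "Ck k f \<Longrightarrow> Ck k g \<Longrightarrow> Ck k (\<lambda>x. f x * g x)"
proof (induction k arbitrary: f g)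
  case (Suc k)
  then have d: "f differentiable (at x)" "g differentiable (at x)" for x by auto
  have "frechet_derivative (\<lambda>x. f x * g x) (at x) = (\<lambda>h. f x * frechet_derivative g (at x) h + frechet_derivative f (at x) h * g x)" for x
    using d[of x] by (intro frechet_derivative_at[symmetric] has_derivative_mult) (auto simp: frechet_derivative_works[symmetric])
  then show ?case using Suc d Ck_SucD[OF Suc.prems(1)] Ck_SucD[OF Suc.prems(2)] by (auto intro!: Ck_add)
qed (auto intro: continuous_intros)

lemma Ck_prod:
  "finite I \<Longrightarrow> (\<And>i. i \<in> I \<Longrightarrow> Ck k (f i)) \<Longrightarrow> Ck k (\<lambda>x. \<Prod>i\<in>I. f i x)"
  by (induction I rule: finite_induct) (auto intro: Ck_mult Ck_const)

lemma Ck_flat_exp: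
  assumes "0 < c" shows "Ck k (\<lambda>x :: real^'n. flat_exp c q (a * x $ i + b))"
proof (induction k arbitrary: q)
  have D: "((\<lambda>x :: real^'n. flat_exp c q (a * x $ i + b)) has_derivative (\<lambda>h. a * h $ i * flat_exp c (flat_deriv c q) (a * x $ i + b))) (at x)" for q x
  proof -
    have "((\<lambda>x :: real^'n. a * x $ i + b) has_derivative (\<lambda>h. a * h $ i)) (at x)"
      by (auto intro!: derivative_eq_intros bounded_linear_imp_has_derivative bounded_linear_vec_nth)
    from has_derivative_compose[OF this flat_exp_has_derivative[OF assms, THEN has_field_derivative_imp_has_derivative]]
    show ?thesis by (simp add: mult.commute)
  qed
  {
    case 0
    have "(\<lambda>x :: real^'n. flat_exp c q (a * x $ i + b)) differentiable (at x)" for x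
      using D unfolding differentiable_def by blast
    then show ?case
      by (auto intro!: continuous_at_imp_continuous_on differentiable_imp_continuous_within)
  next
    case (Suc k)
    have "(\<lambda>x :: real^'n. flat_exp c q (a * x $ i + b)) differentiable (at x)" for x
      using D unfolding differentiable_def by blast
    \<comment> \<open>The scalar \<open>a * axis j 1 $ i\<close> vanishes for j \<noteq> i; absorbed
      into the polynomial, it keeps every partial derivative in the family, so the induction needs
      no case split on j.\<close>
    moreover have "frechet_derivative (\<lambda>x :: real^'n. flat_exp c q (a * x $ i + b)) (at x) (axis j 1)
        = flat_exp c (smult (a * axis j 1 $ i) (flat_deriv c q)) (a * x $ i + b)" for x j
      unfolding frechet_derivative_at[OF D, symmetric] by (simp add: flat_exp_def)
    ultimately show ?case using Suc by simp
  }
qed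

text \<open>The arguments are written as \<open>1 * x $ i + - a $ i\<close> and
  \<open>- 1 * x $ i + b $ i\<close> to match the affine form in \<open>Ck_flat_exp\<close>.\<close>

definition box_bump :: "real \<Rightarrow> real^'n \<Rightarrow> real^'n \<Rightarrow> real^'n \<Rightarrow> real" where
  "box_bump c a b x = (\<Prod>i\<in>UNIV. flat_exp c 1 (1 * x $ i + - a $ i) * flat_exp c 1 (- 1 * x $ i + b $ i))"

lemma smooth_box_bump: "0 < c \<Longrightarrow> smooth (box_bump c a b)"
  unfolding smooth_def box_bump_def[abs_def] by (intro allI Ck_prod Ck_mult Ck_flat_exp) auto

lemma box_bump_eq_0: "x \<notin> box a b \<Longrightarrow> box_bump c a b x = 0"
proof -
  assume "x \<notin> box a b"
  then obtain i where "\<not> (a $ i < x $ i \<and> x $ i < b $ i)" by (auto simp: mem_box_cart)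
  then show ?thesis
    unfolding box_bump_def by (intro prod_zero) (auto intro!: bexI[of _ i] simp: flat_exp_def)
qed

lemma flat_exp_one_bounds: "0 < c \<Longrightarrow> 0 \<le> flat_exp c 1 t \<and> flat_exp c 1 t \<le> 1"
  by (simp add: flat_exp_def)

lemma box_bump_bounds: 
  assumes "0 < c" shows "0 \<le> box_bump c a b x \<and> box_bump c a b x \<le> 1"
  unfolding box_bump_def using flat_exp_one_bounds[OF assms]
  by (auto intro!: prod_nonneg prod_le_1 mult_nonneg_nonneg mult_le_one)

lemma box_bump_tendsto_1:
  assumes "x \<in> box a b"
  shows "(\<lambda>k. box_bump (1 / (real k + 1)) a b x) \<longlonglongrightarrow> 1"
proof -
  have s: "(\<lambda>k. 1 / (real k + 1)) \<longlonglongrightarrow> 0"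
    using lim_inverse_n'[THEN LIMSEQ_Suc] by (simp add: add.commute)
  have one: "(\<lambda>k. flat_exp (1 / (real k + 1)) 1 t) \<longlonglongrightarrow> 1" if "0 < t" for t
  proof -
    have "(\<lambda>k. exp (- (1 / (real k + 1) / t))) \<longlonglongrightarrow> exp (- (0 / t))"
      using that by (intro tendsto_exp tendsto_minus tendsto_divide s tendsto_const) auto
    then show ?thesis using that by (simp add: flat_exp_def)
  qed
  have "(\<lambda>k. box_bump (1 / (real k + 1)) a b x) \<longlonglongrightarrow> (\<Prod>i\<in>(UNIV::'a set). 1 * 1)"
    unfolding box_bump_def using assms
    by (intro tendsto_prod tendsto_mult one) (auto simp: mem_box_cart)
  then show ?thesis by simp
qed

lemma test_function_box_bump:
  assumes "0 < c" "cbox a b \<subseteq> G"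
  shows "test_function G (box_bump c a b)"
proof -
  have "closure {x. box_bump c a b x \<noteq> 0} \<subseteq> cbox a b"
    using box_bump_eq_0 box_subset_cbox by (intro closure_minimal) (blast, rule closed_cbox)
  then show ?thesis unfolding test_function_def
    using smooth_box_bump[OF assms(1)] assms(2)
    by (auto simp: compact_closure intro: bounded_subset[OF bounded_cbox] dest: subset_trans[OF closure_subset])
qed

section \<open>The fundamental lemma of the calculus of variations\<close>

lemma set_integrable_times_test_function:
  assumes f: "locally_integrable G f" and \<phi>: "test_function G \<phi>"
  shows "set_integrable lebesgue G (\<lambda>x. f x * \<phi> x)"
proof -
  define K where "K = closure {x. \<phi> x \<noteq> 0}"
  have K: "compact K" "K \<subseteq> G" using \<phi> by (auto simp: test_function_def K_def)
  have c: "continuous_on UNIV \<phi>" using \<phi> by (auto simp: test_function_def smooth_def dest: spec[of _ 0])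
  have out: "\<phi> x = 0" if "x \<notin> K" for x using that closure_subset[of "{x. \<phi> x \<noteq> 0}"] by (auto simp: K_def)
  have fK: "integrable lebesgue (\<lambda>x. indicator K x *\<^sub>R f x)"
    using f K by (auto simp: locally_integrable_def set_integrable_def)
  have "bounded (\<phi> ` K)"
    using K c by (intro compact_imp_bounded compact_continuous_image) (auto intro: continuous_on_subset)
  then obtain B where B: "\<And>x. x \<in> K \<Longrightarrow> \<bar>\<phi> x\<bar> \<le> B" by (auto simp: bounded_iff)
  have [measurable]: "\<phi> \<in> borel_measurable lebesgue"
    using borel_measurable_continuous_onI[OF c] by (simp add: measurable_completion)
  have "integrable lebesgue (\<lambda>x. (indicator K x *\<^sub>R f x) * \<phi> x)"
  proof (rule Bochner_Integration.integrable_bound)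
    show "integrable lebesgue (\<lambda>x. B * norm (indicator K x *\<^sub>R f x))" using fK by auto
    show "AE x in lebesgue. norm (indicator K x *\<^sub>R f x * \<phi> x) \<le> norm (B * norm (indicator K x *\<^sub>R f x))"
    proof (intro AE_I2)
      fix x
      show "norm (indicator K x *\<^sub>R f x * \<phi> x) \<le> norm (B * norm (indicator K x *\<^sub>R f x))"
        using mult_left_mono[OF B[of x], of "\<bar>f x\<bar>"] B[of x] by (auto simp: indicator_def abs_mult mult.commute)
    qed
  qed (use fK in \<open>auto intro!: borel_measurable_times\<close>)
  moreover have "(\<lambda>x. (indicator K x *\<^sub>R f x) * \<phi> x) = (\<lambda>x. indicator G x *\<^sub>R (f x * \<phi> x))"
    using out K by (auto simp: fun_eq_iff indicator_def)
  ultimately show ?thesis by (simp add: set_integrable_def)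
qed

text \<open>As \<open>ennreal\<close> truncates at 0, the densities are the positive and the
  negative part of g. The two measures are finite and agree on boxes, which are stable under
  intersection and generate the Borel sets; so the measures coincide, and with them the
  densities.\<close>

lemma AE_zero_of_box_integrals:
  fixes g :: "'a::euclidean_space \<Rightarrow> real"
  assumes g: "integrable lborel g" and 0: "\<And>a b. (LINT x|lborel. indicator (box a b) x * g x) = 0"
  shows "AE x in lborel. g x = 0"
proof -
  have [measurable]: "g \<in> borel_measurable borel" using g by auto
  define M N where "M = density lborel (\<lambda>x. ennreal (g x))" and "N = density lborel (\<lambda>x. ennreal (- g x))"
  have fin: "(\<integral>\<^sup>+x. ennreal (s * g x) \<partial>lborel) \<noteq> \<infinity>" if "\<bar>s\<bar> = 1" for s
  proof -
    have "(\<integral>\<^sup>+x. ennreal (s * g x) \<partial>lborel) \<le> (\<integral>\<^sup>+x. ennreal (norm (g x)) \<partial>lborel)"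
      using that by (intro nn_integral_mono ennreal_leI) (auto simp: abs_if split: if_splits)
    also have "\<dots> < \<infinity>" using g by (simp add: integrable_iff_bounded)
    finally show ?thesis by simp
  qed
  have "M = N"
  proof (rule measure_eqI_generator_eq[where E="range (\<lambda>(a, b). box a b)" and A="\<lambda>n. box (- (real n) *\<^sub>R One) (real n *\<^sub>R One)" and \<Omega>=UNIV])
    show "Int_stable (range (\<lambda>(a, b). box a b :: 'a set))"
      by (auto simp: Int_stable_def box_Int_box)
    show "sets M = sigma_sets UNIV (range (\<lambda>(a, b). box a b))" "sets N = sigma_sets UNIV (range (\<lambda>(a, b). box a b))"
      by (simp_all add: M_def N_def borel_eq_box)
    show "emeasure M X = emeasure N X" if XE: "X \<in> range (\<lambda>(a, b). box a b)" for X
    proof -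
      obtain t where "X = (case t of (a, b) \<Rightarrow> box a b)" using XE by (rule rangeE)
      then have X: "X = box (fst t) (snd t)" by (simp add: case_prod_beta)
      define a b where "a = fst t" and "b = snd t"
      note X = X[folded a_def b_def]
      let ?f = "\<lambda>x. indicator (box a b) x * g x"
      have int: "integrable lborel ?f"
        using integrable_mult_indicator[OF _ g, of "box a b"] by simp
      have fins: "(\<integral>\<^sup>+x. ennreal (?f x) \<partial>lborel) \<noteq> \<infinity>" "(\<integral>\<^sup>+x. ennreal (- ?f x) \<partial>lborel) \<noteq> \<infinity>"
        using int by (auto simp: real_integrable_def)
      have e0: "enn2real (\<integral>\<^sup>+x. ennreal (?f x) \<partial>lborel) = enn2real (\<integral>\<^sup>+x. ennreal (- ?f x) \<partial>lborel)"
        using 0[of a b] real_lebesgue_integral_def[OF int] by simp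
      have e1: "ennreal (enn2real (\<integral>\<^sup>+x. ennreal (?f x) \<partial>lborel)) = (\<integral>\<^sup>+x. ennreal (?f x) \<partial>lborel)"
        using fins(1) by (intro ennreal_enn2real) (simp add: less_top)
      have e2: "ennreal (enn2real (\<integral>\<^sup>+x. ennreal (- ?f x) \<partial>lborel)) = (\<integral>\<^sup>+x. ennreal (- ?f x) \<partial>lborel)"
        using fins(2) by (intro ennreal_enn2real) (simp add: less_top)
      have "(\<integral>\<^sup>+x. ennreal (?f x) \<partial>lborel) = (\<integral>\<^sup>+x. ennreal (- ?f x) \<partial>lborel)"
        by (rule trans[OF sym[OF e1[unfolded e0]] e2])
      moreover have "(\<integral>\<^sup>+x. ennreal (?f x) \<partial>lborel) = emeasure M X"
        unfolding M_def X by (subst emeasure_density) (auto intro!: nn_integral_cong simp: indicator_def)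
      moreover have "(\<integral>\<^sup>+x. ennreal (- ?f x) \<partial>lborel) = emeasure N X"
        unfolding N_def X by (subst emeasure_density) (auto intro!: nn_integral_cong simp: indicator_def)
      ultimately show ?thesis by simp
    qed
    show "(\<Union>n. box (- (real n) *\<^sub>R One) (real n *\<^sub>R One)) = (UNIV :: 'a set)"
      using UN_box_eq_UNIV by simp
    show "emeasure M (box (- (real n) *\<^sub>R One) (real n *\<^sub>R One)) \<noteq> \<infinity>" for n
    proof -
      have "emeasure M (box (- (real n) *\<^sub>R One) (real n *\<^sub>R One)) \<le> emeasure M (space M)" by (rule emeasure_space)
      also have "\<dots> = (\<integral>\<^sup>+x. ennreal (1 * g x) \<partial>lborel)" by (simp add: M_def emeasure_density)
      finally show ?thesis using fin[of 1] by (metis abs_one infinity_ennreal_def top.extremum_unique)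
    qed
  qed auto
  then have "AE x in lborel. ennreal (g x) = ennreal (- g x)"
    unfolding M_def N_def using fin[of 1] by (subst (asm) finite_density_unique) auto
  then show ?thesis
  proof eventually_elim
    case (elim x)
    \<comment> \<open>Positive and negative part are never both nonzero, so their equality makes
      both vanish.\<close>
    moreover have "ennreal (g x) = 0 \<or> ennreal (- g x) = 0" by (cases "g x \<ge> 0") (auto simp: ennreal_neg)
    ultimately have "ennreal (g x) = 0" "ennreal (- g x) = 0" by auto
    then show ?case unfolding ennreal_eq_0_iff by simp
  qed
qed

text \<open>Box bumps are test functions when the closed box lies in G, and dominated convergence
  turns the hypothesis into vanishing integrals over boxes. G is a countable union of closed boxes,
  so the exceptional sets stay null.\<close>

lemma AE_zero_of_test_functions:
  fixes f :: "real^'n \<Rightarrow> real"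
  assumes "open G" and f: "locally_integrable G f"
    and 0: "\<And>\<phi>. test_function G \<phi> \<Longrightarrow> (LINT x:G|lebesgue. f x * \<phi> x) = 0"
  shows "AE x in lebesgue. x \<in> G \<longrightarrow> f x = 0"
proof -
  have box0: "(LINT x:box a b|lebesgue. f x) = 0" if ab: "cbox a b \<subseteq> G" for a b
  proof -
    let ?\<phi> = "\<lambda>k. box_bump (1 / (real k + 1)) a b"
    have fK: "integrable lebesgue (\<lambda>x. indicator (cbox a b) x *\<^sub>R f x)"
      using f ab by (auto simp: locally_integrable_def set_integrable_def)
    have I: "integrable lebesgue (\<lambda>x. indicator G x *\<^sub>R (f x * ?\<phi> k x))" for k
      using set_integrable_times_test_function[OF f test_function_box_bump[OF _ ab]] by (simp add: set_integrable_def)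
    have "integrable lebesgue (\<lambda>x. indicator (box a b) x *\<^sub>R (indicator (cbox a b) x *\<^sub>R f x))"
      by (intro integrable_mult_indicator fK) auto
    also have "(\<lambda>x. indicator (box a b) x *\<^sub>R (indicator (cbox a b) x *\<^sub>R f x)) = (\<lambda>x. indicator (box a b) x *\<^sub>R f x)"
      using box_subset_cbox[of a b] by (auto simp: fun_eq_iff indicator_def)
    finally have fB: "integrable lebesgue (\<lambda>x. indicator (box a b) x *\<^sub>R f x)" .
    have "(\<lambda>k. LINT x|lebesgue. indicator G x *\<^sub>R (f x * ?\<phi> k x)) \<longlonglongrightarrow> (LINT x|lebesgue. indicator (box a b) x *\<^sub>R f x)"
    proof (rule integral_dominated_convergence[where w="\<lambda>x. norm (indicator (cbox a b) x *\<^sub>R f x)"])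
      show "AE x in lebesgue. (\<lambda>k. indicator G x *\<^sub>R (f x * ?\<phi> k x)) \<longlonglongrightarrow> indicator (box a b) x *\<^sub>R f x"
      proof (intro AE_I2)
        fix x
        show "(\<lambda>k. indicator G x *\<^sub>R (f x * ?\<phi> k x)) \<longlonglongrightarrow> indicator (box a b) x *\<^sub>R f x"
        proof (cases "x \<in> box a b")
          case True
          then have "x \<in> G" using ab box_subset_cbox by blast
          then show ?thesis using tendsto_mult[OF tendsto_const[of "f x"] box_bump_tendsto_1[OF True]] True by simp
        qed (simp add: box_bump_eq_0)
      qed
      show "AE x in lebesgue. norm (indicator G x *\<^sub>R (f x * ?\<phi> k x)) \<le> norm (indicator (cbox a b) x *\<^sub>R f x)" for k
      proof (intro AE_I2)
        fix x
        have "\<bar>f x\<bar> * \<bar>?\<phi> k x\<bar> \<le> \<bar>f x\<bar> * 1"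
          using box_bump_bounds[of "1 / (real k + 1)" a b x] by (intro mult_left_mono) auto
        moreover have "x \<notin> cbox a b \<Longrightarrow> ?\<phi> k x = 0" using box_bump_eq_0 box_subset_cbox by blast
        ultimately show "norm (indicator G x *\<^sub>R (f x * ?\<phi> k x)) \<le> norm (indicator (cbox a b) x *\<^sub>R f x)"
          by (auto simp: indicator_def abs_mult)
      qed
    qed (use I fK fB in auto)
    moreover have "(LINT x|lebesgue. indicator G x *\<^sub>R (f x * ?\<phi> k x)) = 0" for k
      using 0[OF test_function_box_bump[OF _ ab]] by (simp add: set_lebesgue_integral_def)
    ultimately show ?thesis by (simp add: set_lebesgue_integral_def LIMSEQ_const_iff)
  qed
  have cbox: "AE x in lebesgue. x \<in> cbox A B \<longrightarrow> f x = 0" if AB: "cbox A B \<subseteq> G" for A B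
  proof -
    let ?g = "\<lambda>x. indicator (box A B) x *\<^sub>R f x"
    have fK: "integrable lebesgue (\<lambda>x. indicator (cbox A B) x *\<^sub>R f x)"
      using f AB by (auto simp: locally_integrable_def set_integrable_def)
    have "integrable lebesgue (\<lambda>x. indicator (box A B) x *\<^sub>R (indicator (cbox A B) x *\<^sub>R f x))"
      by (intro integrable_mult_indicator fK) auto
    also have "(\<lambda>x. indicator (box A B) x *\<^sub>R (indicator (cbox A B) x *\<^sub>R f x)) = ?g"
      using box_subset_cbox[of A B] by (auto simp: fun_eq_iff indicator_def)
    finally have gi: "integrable lebesgue ?g" .
    then obtain g where [measurable]: "g \<in> borel_measurable lborel" and gg: "AE x in lborel. ?g x = g x"
      using completion_ex_borel_measurable_real[of ?g lborel] by auto
    have gg': "AE x in lebesgue. ?g x = g x" using gg by (rule AE_completion)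
    have "integrable lebesgue g"
      using gi gg' by (subst integrable_cong_AE[of _ _ ?g]) (auto simp: measurable_completion)
    then have g1: "integrable lborel g" by (simp add: integrable_completion)
    have "(LINT x|lborel. indicator (box a b) x * g x) = 0" for a b
    proof -
      obtain c d where cd: "box a b \<inter> box A B = box c d" using box_Int_box by blast
      \<comment> \<open>An empty open box does not determine its corners, so the closed box with
        these corners may leave G; the integral over the empty box is 0 anyway.\<close>
      have "cbox c d \<subseteq> G \<or> box c d = {}"
      proof (cases "box c d = {}")
        case False
        then have "cbox c d = closure (box c d)" by (simp add: closure_box)
        also have "\<dots> \<subseteq> cbox A B" using cd box_subset_cbox[of A B] by (intro closure_minimal) auto
        finally show ?thesis using AB by auto
      qed auto
      have "(LINT x|lborel. indicator (box a b) x * g x) = (LINT x|lebesgue. indicator (box a b) x * g x)"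
        by (rule integral_completion[symmetric]) measurable
      also have "\<dots> = (LINT x|lebesgue. indicator (box c d) x *\<^sub>R f x)"
      proof (rule integral_cong_AE)
        show "(\<lambda>x. indicator (box a b) x * g x) \<in> borel_measurable lebesgue"
          by (rule measurable_completion) measurable
        have "(\<lambda>x. indicator (box a b) x *\<^sub>R ?g x) \<in> borel_measurable lebesgue"
          using integrable_mult_indicator[OF _ gi, of "box a b"] by auto
        also have "(\<lambda>x. indicator (box a b) x *\<^sub>R ?g x) = (\<lambda>x. indicator (box c d) x *\<^sub>R f x)"
          unfolding cd[symmetric] by (auto simp: indicator_def fun_eq_iff)
        finally show "(\<lambda>x. indicator (box c d) x *\<^sub>R f x) \<in> borel_measurable lebesgue" .
        show "AE x in lebesgue. indicator (box a b) x * g x = indicator (box c d) x *\<^sub>R f x"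
          using gg' unfolding cd[symmetric] by eventually_elim (auto simp: indicator_def)
      qed
      also have "\<dots> = 0" using box0[of c d] \<open>cbox c d \<subseteq> G \<or> box c d = {}\<close> by (auto simp: set_lebesgue_integral_def)
      finally show ?thesis .
    qed
    then have "AE x in lborel. g x = 0" by (rule AE_zero_of_box_integrals[OF g1])
    then have "AE x in lebesgue. g x = 0" by (rule AE_completion)
    moreover have "AE x in lebesgue. x \<notin> cbox A B - box A B"
      using negligible_frontier_interval[of A B] by (intro AE_not_in) (simp add: negligible_iff_null_sets)
    ultimately show ?thesis using gg' by eventually_elim (auto simp: indicator_def)
  qed
  obtain D where D: "countable D" "\<And>X. X \<in> D \<Longrightarrow> \<exists>a b. X = cbox a b" "\<Union>D = G" and sub: "D \<subseteq> Pow G"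
    using open_countable_Union_open_cbox[OF \<open>open G\<close>] by metis
  have "AE x in lebesgue. \<forall>X\<in>D. x \<in> X \<longrightarrow> f x = 0"
    unfolding AE_ball_countable[OF D(1)]
  proof
    fix X assume X: "X \<in> D"
    then obtain a b where "X = cbox a b" using D(2) by blast
    then show "AE x in lebesgue. x \<in> X \<longrightarrow> f x = 0" using cbox[of a b] X sub by blast
  qed
  then show ?thesis by eventually_elim (use D(3) in blast)
qed

text \<open>Weighted integrability is known for one weak Jacobian of v and smooth approximation for
  another; this identifies them with the one in the inequality.\<close>

lemma weak_jacobian_unique:
  assumes "open G" and 1: "weak_jacobian G v V" and 2: "weak_jacobian G v V'"
  shows "AE x in lebesgue. x \<in> G \<longrightarrow> V x = V' x"
proof -
  have "AE x in lebesgue. x \<in> G \<longrightarrow> V x $ i $ j - V' x $ i $ j = 0" for i j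
  proof (rule AE_zero_of_test_functions[OF \<open>open G\<close>])
    have l: "locally_integrable G (\<lambda>x. V x $ i $ j)" "locally_integrable G (\<lambda>x. V' x $ i $ j)"
      using 1 2 by (auto simp: weak_jacobian_def)
    then show "locally_integrable G (\<lambda>x. V x $ i $ j - V' x $ i $ j)"
      by (auto simp: locally_integrable_def intro: set_integral_diff)
    fix \<phi> assume \<phi>: "test_function G \<phi>"
    have "(LINT x:G|lebesgue. (V x $ i $ j - V' x $ i $ j) * \<phi> x)
       = (LINT x:G|lebesgue. V x $ i $ j * \<phi> x) - (LINT x:G|lebesgue. V' x $ i $ j * \<phi> x)"
      unfolding left_diff_distrib
      by (intro set_integral_diff set_integrable_times_test_function l \<phi>)
    also have "\<dots> = 0" using 1 2 \<phi> by (simp add: weak_jacobian_def)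
    finally show "(LINT x:G|lebesgue. (V x $ i $ j - V' x $ i $ j) * \<phi> x) = 0" .
  qed
  then have "AE x in lebesgue. \<forall>i j. x \<in> G \<longrightarrow> V x $ i $ j - V' x $ i $ j = 0"
    unfolding AE_all_countable by blast
  then show ?thesis by eventually_elim (simp add: vec_eq_iff)
qed

section \<open>The main inequality\<close>

lemma sum_powr_le:
  fixes a :: "'i \<Rightarrow> real"
  assumes "finite I" "\<And>i. i \<in> I \<Longrightarrow> 0 \<le> a i" "0 < p"
  shows "(\<Sum>i\<in>I. a i) powr p \<le> real (card I) powr p * (\<Sum>i\<in>I. a i powr p)"
proof (cases "I = {}")
  case False
  define m where "m = Max (a ` I)"
  have "m \<in> a ` I" unfolding m_def using assms(1) False by (intro Max_in) auto
  then obtain k where k: "k \<in> I" "m = a k" by blast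
  have "a i \<le> m" if "i \<in> I" for i unfolding m_def using that assms(1) by (intro Max_ge) auto
  then have "(\<Sum>i\<in>I. a i) \<le> real (card I) * m" by (intro sum_bounded_above) auto
  then have "(\<Sum>i\<in>I. a i) powr p \<le> (real (card I) * m) powr p"
    using assms by (intro powr_mono2 sum_nonneg) auto
  also have "\<dots> = real (card I) powr p * m powr p" using assms k by (simp add: powr_mult)
  also have "m powr p \<le> (\<Sum>i\<in>I. a i powr p)" unfolding k(2) using assms k by (intro member_le_sum) auto
  finally show ?thesis by (simp add: mult_left_mono)
qed simp

lemma norm_le_sum_norm_cart:
  fixes x :: "'a::real_normed_vector^'n"
  shows "norm x \<le> (\<Sum>i\<in>UNIV. norm (x $ i))"
  unfolding norm_vec_def by (rule L2_set_le_sum) simp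

text \<open>Passes from the Euclidean matrix norm in \<open>weighted_energy\<close> to the entrywise
  norm of the statement; the dimension factors go into the final constant.\<close>

lemma norm_matrix_powr_le:
  fixes A :: "real^'n^'m"
  assumes "0 < p" "0 \<le> w"
  shows "(w * norm A) powr p \<le> real CARD('m) powr p * real CARD('n) powr p *
     (\<Sum>i\<in>UNIV. \<Sum>j\<in>UNIV. \<bar>w * A $ i $ j\<bar> powr p)"
proof -
  have "w * norm A \<le> w * (\<Sum>i\<in>UNIV. norm (A $ i))"
    using assms(2) by (intro mult_left_mono norm_le_sum_norm_cart)
  then have "(w * norm A) powr p \<le> (\<Sum>i\<in>UNIV. w * norm (A $ i)) powr p"
    using assms by (intro powr_mono2) (auto simp: sum_distrib_left)
  also have "\<dots> \<le> real CARD('m) powr p * (\<Sum>i\<in>UNIV. (w * norm (A $ i)) powr p)"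
    using assms by (intro sum_powr_le) auto
  also have "(w * norm (A $ i)) powr p \<le> real CARD('n) powr p * (\<Sum>j\<in>UNIV. \<bar>w * A $ i $ j\<bar> powr p)" for i
  proof -
    have "w * norm (A $ i) \<le> w * (\<Sum>j\<in>UNIV. norm (A $ i $ j))"
      using assms(2) by (intro mult_left_mono norm_le_sum_norm_cart)
    then have "(w * norm (A $ i)) powr p \<le> (\<Sum>j\<in>UNIV. \<bar>w * A $ i $ j\<bar>) powr p"
      using assms by (intro powr_mono2) (auto simp: sum_distrib_left abs_mult)
    also have "\<dots> \<le> real CARD('n) powr p * (\<Sum>j\<in>UNIV. \<bar>w * A $ i $ j\<bar> powr p)"
      using assms by (intro sum_powr_le) auto
    finally show ?thesis .
  qed
  then have "real CARD('m) powr p * (\<Sum>i\<in>UNIV. (w * norm (A $ i)) powr p)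
     \<le> real CARD('m) powr p * (\<Sum>i\<in>UNIV. real CARD('n) powr p * (\<Sum>j\<in>UNIV. \<bar>w * A $ i $ j\<bar> powr p))"
    by (intro mult_left_mono sum_mono) auto
  finally show ?thesis by (simp add: sum_distrib_left mult.assoc)
qed

lemma borel_measurable_vec_lambda:
  fixes f :: "'i::finite \<Rightarrow> 'a \<Rightarrow> 'b::euclidean_space"
  assumes "\<And>i. f i \<in> borel_measurable M"
  shows "(\<lambda>x. \<chi> i. f i x) \<in> borel_measurable M"
proof (rule borel_measurable_euclidean_space[THEN iffD2, OF ballI])
  fix b :: "'b^'i" assume "b \<in> Basis"
  then obtain i c where "b = axis i c" by (auto simp: Basis_vec_def)
  then show "(\<lambda>x. (\<chi> i. f i x) \<bullet> b) \<in> borel_measurable M"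
    using assms[of i] by (simp add: inner_axis)
qed

text \<open>The segment estimates compose functions with shifts and shears and rely on Borel
  measurability for this; a Borel function on the whole space that agrees almost everywhere on G
  serves as a substitute.\<close>

lemma borel_representative:
  fixes f :: "real^'n \<Rightarrow> real"
  assumes "open G" and f: "f \<in> borel_measurable (lebesgue_on G)"
  shows "\<exists>f'\<in>borel_measurable borel. AE x in lborel. x \<in> G \<longrightarrow> f x = f' x"
proof -
  have "G \<in> sets lebesgue" using \<open>open G\<close> by (intro sets_completionI_sets) simp
  then have "(\<lambda>x. indicator G x *\<^sub>R f x) \<in> borel_measurable lebesgue"
    using f by (subst borel_measurable_restrict_space_iff[symmetric]) auto
  then obtain f' where "f' \<in> borel_measurable lborel" "AE x in lborel. indicator G x *\<^sub>R f x = f' x"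
    using completion_ex_borel_measurable_real by blast
  moreover from this have "AE x in lborel. x \<in> G \<longrightarrow> f x = f' x"
    by (auto elim: eventually_mono)
  ultimately show ?thesis by auto
qed

lemma borel_representative_family:
  fixes f :: "'i \<Rightarrow> real^'n \<Rightarrow> real"
  assumes "open G" and f: "\<And>i. f i \<in> borel_measurable (lebesgue_on G)"
  shows "\<exists>f'. (\<forall>i. f' i \<in> borel_measurable borel) \<and> (\<forall>i. AE x in lborel. x \<in> G \<longrightarrow> f i x = f' i x)"
proof -
  have "\<forall>i. \<exists>f'. f' \<in> borel_measurable borel \<and> (AE x in lborel. x \<in> G \<longrightarrow> f i x = f' x)"
    using borel_representative[OF \<open>open G\<close> f] unfolding Bex_def by (rule allI)
  from choice[OF this] show ?thesis by (simp only: all_conj_distrib)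
qed

lemma smooth_imp_differentiable:
  assumes "smooth f" shows "f differentiable (at x)"
    and "continuous_on UNIV (\<lambda>x. frechet_derivative f (at x) (axis j 1))"
proof -
  have "Ck (Suc 0) f" using assms by (simp add: smooth_def)
  then show "f differentiable (at x)" "continuous_on UNIV (\<lambda>x. frechet_derivative f (at x) (axis j 1))" by auto
qed

lemma smooth_components:
  fixes u :: "real^'n \<Rightarrow> real^'m"
  assumes "\<And>i. smooth (\<lambda>x. u x $ i)"
  shows "u differentiable (at x)" and "continuous_on UNIV (\<lambda>x. jacobian u (at x))"
proof -
  have D: "(u has_derivative (\<lambda>h. \<chi> i. frechet_derivative (\<lambda>x. u x $ i) (at x) h)) (at x)" for x
  proof (subst has_derivative_componentwise_within, intro ballI)
    fix b :: "real^'m" assume "b \<in> Basis"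
    then obtain i where b: "b = axis i 1" by (auto simp: Basis_vec_def)
    show "((\<lambda>x. u x \<bullet> b) has_derivative (\<lambda>h. (\<chi> i. frechet_derivative (\<lambda>x. u x $ i) (at x) h) \<bullet> b)) (at x)"
      using smooth_imp_differentiable(1)[OF assms[of i], of x]
      by (simp add: b inner_axis frechet_derivative_works)
  qed
  then show "u differentiable (at x)" by (auto simp: differentiable_def)
  have "jacobian u (at x) = (\<chi> i j. frechet_derivative (\<lambda>x. u x $ i) (at x) (axis j 1))" for x
    unfolding jacobian_def frechet_derivative_at[OF D, symmetric] by (simp add: matrix_def vec_eq_iff)
  then show "continuous_on UNIV (\<lambda>x. jacobian u (at x))"
    by (simp add: continuous_on_vec_lambda smooth_imp_differentiable(2)[OF assms])
qed

lemma nn_integral_eq_LINT_lebesgue_on: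
  fixes f :: "real^'n \<Rightarrow> real"
  assumes "open G" and int: "integrable (lebesgue_on G) f" and nn: "\<And>x. 0 \<le> f x"
  shows "(\<integral>\<^sup>+x\<in>G. ennreal (f x) \<partial>lborel) = ennreal (LINT x|lebesgue_on G. f x)"
proof -
  have "G \<in> sets lebesgue" using \<open>open G\<close> by (intro sets_completionI_sets) simp
  then have "(\<integral>\<^sup>+x. ennreal (f x) \<partial>lebesgue_on G) = (\<integral>\<^sup>+x\<in>G. ennreal (f x) \<partial>lborel)"
    by (subst nn_integral_restrict_space) (simp_all add: nn_integral_completion)
  moreover have "(\<integral>\<^sup>+x. ennreal (f x) \<partial>lebesgue_on G) = ennreal (LINT x|lebesgue_on G. f x)"
    using int nn by (intro nn_integral_eq_integral) auto
  ultimately show ?thesis by simp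
qed

lemma measurable_lebesgue_on_AE:
  fixes f g :: "real^'n \<Rightarrow> real"
  assumes "open G" and f: "f \<in> borel_measurable (lebesgue_on G)" and ae: "AE x in lebesgue. x \<in> G \<longrightarrow> f x = g x"
  shows "g \<in> borel_measurable (lebesgue_on G)"
proof -
  have G: "G \<in> sets lebesgue" using \<open>open G\<close> by (intro sets_completionI_sets) simp
  then have "(\<lambda>x. indicator G x *\<^sub>R f x) \<in> borel_measurable lebesgue"
    using f by (subst borel_measurable_restrict_space_iff[symmetric]) auto
  moreover have "AE x in lebesgue. indicator G x *\<^sub>R f x = indicator G x *\<^sub>R g x"
    using ae by eventually_elim (auto simp: indicator_def)
  ultimately have "(\<lambda>x. indicator G x *\<^sub>R g x) \<in> borel_measurable lebesgue"
    by (rule borel_measurable_AE)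
  then show ?thesis using G by (subst borel_measurable_restrict_space_iff) auto
qed

theorem theorem3p5:
  fixes G A :: "(real^'n) set" and \<nu> :: "real^'n \<Rightarrow> real^'n" and p \<alpha> :: real
  assumes "CARD('n) \<ge> 2"
    and "1 \<le> p" and "0 \<le> \<alpha>" and "\<alpha> < (p - 1) / p"
    and "bounded_lipschitz_domain G"
    and "openin (top_of_set (frontier G)) A"
    and "emeasure (hausdorff_measure (real CARD('n) - 1)) A > 0"
    and "AE x in hausdorff_measure (real CARD('n) - 1). x \<in> A \<longrightarrow> exterior_unit_normal G x (\<nu> x)"
    and "continuous_on A \<nu>"
  shows "\<exists>\<eta>>0. \<forall>v V g.
      v \<in> weighted_sobolev p \<alpha> G \<longrightarrow>
      weak_jacobian G v V \<longrightarrow>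
      (AE x in lebesgue_on G. v x \<in> span (\<nu> ` A)) \<longrightarrow>
      has_trace G v g \<longrightarrow>
      (AE x in hausdorff_measure (real CARD('n) - 1). x \<in> A \<longrightarrow> g x \<bullet> \<nu> x = 0) \<longrightarrow>
      vector_Lp_norm p G v \<le> inverse \<eta> * weighted_matrix_Lp_norm p \<alpha> G V"
proof -
  let ?H = "hausdorff_measure (real CARD('n) - 1) :: (real^'n) measure"
  \<comment> \<open>For p = 1 the bounds on \<alpha> would read 0 \<le> \<alpha> < 0.\<close>
  have p: "1 < p" using assms(2,3,4) by (cases "p = 1") auto
  have oG: "open G" and bG: "bounded G" and neG: "G \<noteq> {}" using assms(5) by (auto simp: bounded_lipschitz_domain_def)
  have Gl: "G \<in> sets lebesgue" using oG by (intro sets_completionI_sets) simp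
  have frne: "frontier G \<noteq> {}"
    using frontier_eq_empty[of G] neG bG not_bounded_UNIV by auto
  have wpos: "0 < boundary_weight \<alpha> G x" if "x \<in> G" for x
  proof -
    have "x \<notin> frontier G" using that oG by (auto simp: frontier_def interior_open)
    then have "0 < infdist x (frontier G)"
      using frne in_closed_iff_infdist_zero[of "frontier G" x] infdist_nonneg[of x "frontier G"] by force
    then show ?thesis by (simp add: boundary_weight_def)
  qed
  have wnn: "0 \<le> boundary_weight \<alpha> G x" for x by (simp add: boundary_weight_def)
  obtain C where C: "C > 0" and main: "\<And>v V u g. smooth_approx G v V u \<Longrightarrow> g \<in> borel_measurable borel \<Longrightarrow>
     AE x in lborel. x \<in> G \<longrightarrow> v x \<in> span (\<nu> ` A) \<Longrightarrow> weighted_energy p \<alpha> G V < \<infinity> \<Longrightarrow>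
     (\<lambda>k. \<integral>\<^sup>+y\<in>frontier G. ennreal (norm (u k y - g y)) \<partial>?H) \<longlonglongrightarrow> 0 \<Longrightarrow>
     AE y in ?H. y \<in> A \<longrightarrow> g y \<bullet> \<nu> y = 0 \<Longrightarrow>
     (\<integral>\<^sup>+y\<in>G. ennreal (norm (v y) powr p) \<partial>lborel) \<le> ennreal C * weighted_energy p \<alpha> G V"
    using normal_trace_inequality[OF assms(1) p assms(3,4,5,6,9)] by blast
  define n where "n = real CARD('n)"
  have n: "n > 0" by (simp add: n_def)
  \<comment> \<open>\<open>n powr p * n powr p\<close> compares the matrix norms; the outer
    \<open>n\<close> sums over the components of v, each of which is bounded by the full
    norm.\<close>
  define K where "K = n * (C * (n powr p * n powr p))"
  have K: "K > 0" using n C by (simp add: K_def)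
  have est: "vector_Lp_norm p G v \<le> inverse (K powr (- (1 / p))) * weighted_matrix_Lp_norm p \<alpha> G V"
    if v: "v \<in> weighted_sobolev p \<alpha> G" and V: "weak_jacobian G v V"
      and span: "AE x in lebesgue_on G. v x \<in> span (\<nu> ` A)" and tr: "has_trace G v g"
      and g0: "AE x in ?H. x \<in> A \<longrightarrow> g x \<bullet> \<nu> x = 0" for v V g
  proof -
    have vm: "(\<lambda>x. v x $ i) \<in> borel_measurable (lebesgue_on G)"
      and vi: "integrable (lebesgue_on G) (\<lambda>x. \<bar>v x $ i\<bar> powr p)" for i
      using v by (auto simp: weighted_sobolev_def in_Lp_def)
    \<comment> \<open>\<open>V2\<close> carries the weighted integrability and \<open>V3\<close>
      below the approximation; both agree with \<open>V\<close> almost everywhere in G.\<close>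
    obtain V2 where V2: "weak_jacobian G v V2"
      and V2L: "\<And>i j. in_Lp p G (\<lambda>x. boundary_weight \<alpha> G x * V2 x $ i $ j)"
      using v by (auto simp: weighted_sobolev_def)
    obtain V3 u where gm: "g \<in> borel_measurable borel" and V3: "weak_jacobian G v V3"
      and u: "\<And>k i. smooth (\<lambda>x. u k x $ i)"
      and l1: "(\<lambda>k. \<integral>\<^sup>+x\<in>G. ennreal (norm (u k x - v x)) \<partial>lebesgue) \<longlonglongrightarrow> 0"
      and l2: "(\<lambda>k. \<integral>\<^sup>+x\<in>G. ennreal (norm (jacobian (u k) (at x) - V3 x)) \<partial>lebesgue) \<longlonglongrightarrow> 0"
      and l3: "(\<lambda>k. \<integral>\<^sup>+x\<in>frontier G. ennreal (norm (u k x - g x)) \<partial>?H) \<longlonglongrightarrow> 0"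
      using tr unfolding has_trace_def by blast
    have VV2: "AE x in lebesgue. x \<in> G \<longrightarrow> V2 x = V x" by (rule weak_jacobian_unique[OF oG V2 V])
    have VV3: "AE x in lebesgue. x \<in> G \<longrightarrow> V x = V3 x" by (rule weak_jacobian_unique[OF oG V V3])
    have wVm: "(\<lambda>x. boundary_weight \<alpha> G x * V x $ i $ j) \<in> borel_measurable (lebesgue_on G)" for i j
    proof (rule measurable_lebesgue_on_AE[OF oG])
      show "(\<lambda>x. boundary_weight \<alpha> G x * V2 x $ i $ j) \<in> borel_measurable (lebesgue_on G)"
        using V2L[of i j] by (simp add: in_Lp_def)
      show "AE x in lebesgue. x \<in> G \<longrightarrow> boundary_weight \<alpha> G x * V2 x $ i $ j = boundary_weight \<alpha> G x * V x $ i $ j"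
        using VV2 by eventually_elim auto
    qed
    have wVi: "integrable (lebesgue_on G) (\<lambda>x. \<bar>boundary_weight \<alpha> G x * V x $ i $ j\<bar> powr p)" for i j
    proof -
      have V2i: "integrable (lebesgue_on G) (\<lambda>x. \<bar>boundary_weight \<alpha> G x * V2 x $ i $ j\<bar> powr p)"
        using V2L[of i j] by (simp add: in_Lp_def)
      have ae: "AE x in lebesgue_on G. \<bar>boundary_weight \<alpha> G x * V2 x $ i $ j\<bar> powr p = \<bar>boundary_weight \<alpha> G x * V x $ i $ j\<bar> powr p"
      proof -
        have "AE x in lebesgue. x \<in> G \<longrightarrow> \<bar>boundary_weight \<alpha> G x * V2 x $ i $ j\<bar> powr p = \<bar>boundary_weight \<alpha> G x * V x $ i $ j\<bar> powr p"
          using VV2 by eventually_elim auto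
        then show ?thesis using Gl by (subst AE_restrict_space_iff) auto
      qed
      have "(\<lambda>x. \<bar>boundary_weight \<alpha> G x * V x $ i $ j\<bar> powr p) \<in> borel_measurable (lebesgue_on G)"
        using measurable_compose[OF wVm[of i j], of "\<lambda>t. \<bar>t\<bar> powr p" borel] by simp
      then show ?thesis using ae by (rule integrable_cong_AE_imp[OF V2i])
    qed
    \<comment> \<open>Measurability has been transferred for the weighted entries; the weight is
      positive in G and can be divided out.\<close>
    have Vm: "(\<lambda>x. V x $ i $ j) \<in> borel_measurable (lebesgue_on G)" for i j
    proof -
      have "boundary_weight \<alpha> G \<in> borel_measurable (lebesgue_on G)"
        by (intro measurable_restrict_space1 measurable_completion) measurable
      with wVm[of i j] have "(\<lambda>x. boundary_weight \<alpha> G x * V x $ i $ j / boundary_weight \<alpha> G x) \<in> borel_measurable (lebesgue_on G)"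
        by (rule borel_measurable_divide)
      then show ?thesis
        by (rule measurable_lebesgue_on_AE[OF oG]) (use wpos in \<open>auto simp: less_imp_neq[symmetric]\<close>)
    qed
    from borel_representative_family[where f="\<lambda>i x. v x $ i", OF oG vm] obtain v'
      where v': "\<forall>i. v' i \<in> borel_measurable borel" "\<forall>i. AE x in lborel. x \<in> G \<longrightarrow> v x $ i = v' i x"
      by (elim exE conjE)
    \<comment> \<open>Indexing by pairs turns the matrix entries into one family, so that a single
      choice yields all representatives.\<close>
    from borel_representative_family[where f="\<lambda>q x. V x $ fst q $ snd q", OF oG Vm] obtain V''
      where V'': "\<forall>q. V'' q \<in> borel_measurable borel" "\<forall>q. AE x in lborel. x \<in> G \<longrightarrow> V x $ fst q $ snd q = V'' q x"
      by (elim exE conjE)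
    define V' where "V' i j = V'' (i, j)" for i j
    have V': "V' i j \<in> borel_measurable borel" "AE x in lborel. x \<in> G \<longrightarrow> V x $ i $ j = V' i j x" for i j
      using spec[OF V''(1), of "(i, j)"] spec[OF V''(2), of "(i, j)"] by (simp_all only: V'_def fst_conv snd_conv)
    define v0 where "v0 x = (\<chi> i. v' i x)" for x
    define V0 :: "real^'n \<Rightarrow> real^'n^'n" where "V0 x = (\<chi> i j. V' i j x)" for x
    have v0m: "v0 \<in> borel_measurable borel" and V0m: "V0 \<in> borel_measurable borel"
      using v'(1) V'(1) by (auto simp: v0_def[abs_def] V0_def[abs_def] intro!: borel_measurable_vec_lambda)
    have "AE x in lborel. \<forall>i. x \<in> G \<longrightarrow> v x $ i = v' i x" unfolding AE_all_countable using v'(2) by blast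
    then have v0: "AE x in lborel. x \<in> G \<longrightarrow> v x = v0 x" by eventually_elim (simp add: v0_def vec_eq_iff)
    have "AE x in lborel. \<forall>i j. x \<in> G \<longrightarrow> V x $ i $ j = V' i j x" unfolding AE_all_countable using V'(2) by blast
    then have V0: "AE x in lborel. x \<in> G \<longrightarrow> V x = V0 x" by eventually_elim (simp add: V0_def vec_eq_iff)
    have "AE x in lborel. x \<in> G \<longrightarrow> V x = V3 x" using VV3 by (simp add: AE_completion_iff)
    then have V03: "AE x in lborel. x \<in> G \<longrightarrow> V3 x = V0 x" using V0 by eventually_elim auto
    have i1: "(\<integral>\<^sup>+x\<in>G. ennreal (norm (u k x - v x)) \<partial>lebesgue) = (\<integral>\<^sup>+x\<in>G. ennreal (norm (u k x - v0 x)) \<partial>lborel)" for k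
      unfolding nn_integral_completion
      by (rule nn_integral_cong_AE) (use v0 in \<open>eventually_elim, auto simp: indicator_def\<close>)
    have i2: "(\<integral>\<^sup>+x\<in>G. ennreal (norm (jacobian (u k) (at x) - V3 x)) \<partial>lebesgue) = (\<integral>\<^sup>+x\<in>G. ennreal (norm (jacobian (u k) (at x) - V0 x)) \<partial>lborel)" for k
      unfolding nn_integral_completion
      by (rule nn_integral_cong_AE) (use V03 in \<open>eventually_elim, auto simp: indicator_def\<close>)
    have app: "smooth_approx G v0 V0 u"
      unfolding smooth_approx_def using v0m V0m l1 l2 smooth_components[of "u k" for k, OF u] by (simp add: i1 i2)
    have "AE x in lebesgue. x \<in> G \<longrightarrow> v x \<in> span (\<nu> ` A)" using span Gl by (simp add: AE_restrict_space_iff)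
    then have "AE x in lborel. x \<in> G \<longrightarrow> v x \<in> span (\<nu> ` A)" by (simp add: AE_completion_iff)
    then have sp: "AE x in lborel. x \<in> G \<longrightarrow> v0 x \<in> span (\<nu> ` A)" using v0 by eventually_elim auto
    define I where "I i j = (LINT x|lebesgue_on G. \<bar>boundary_weight \<alpha> G x * V x $ i $ j\<bar> powr p)" for i j
    have Inn: "0 \<le> I i j" for i j by (simp add: I_def)
    have wm: "weighted_matrix_Lp_norm p \<alpha> G V = (\<Sum>i\<in>UNIV. \<Sum>j\<in>UNIV. I i j) powr (1 / p)"
      using p Inn by (simp add: weighted_matrix_Lp_norm_def Lp_norm_def I_def powr_powr)
    have E: "weighted_energy p \<alpha> G V0 \<le> ennreal (n powr p * n powr p * (\<Sum>i\<in>UNIV. \<Sum>j\<in>UNIV. I i j))"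
    proof -
      have Iij: "(\<integral>\<^sup>+x\<in>G. ennreal (\<bar>boundary_weight \<alpha> G x * V' i j x\<bar> powr p) \<partial>lborel) = ennreal (I i j)" for i j
      proof -
        have "(\<integral>\<^sup>+x\<in>G. ennreal (\<bar>boundary_weight \<alpha> G x * V' i j x\<bar> powr p) \<partial>lborel) = (\<integral>\<^sup>+x\<in>G. ennreal (\<bar>boundary_weight \<alpha> G x * V x $ i $ j\<bar> powr p) \<partial>lborel)"
          by (rule nn_integral_cong_AE) (use V'(2)[of i j] in \<open>eventually_elim, auto simp: indicator_def\<close>)
        then show ?thesis unfolding I_def by (simp add: nn_integral_eq_LINT_lebesgue_on[OF oG wVi])
      qed
      have "weighted_energy p \<alpha> G V0 \<le> (\<integral>\<^sup>+x. ennreal (n powr p * n powr p) *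
          (\<Sum>i\<in>UNIV. \<Sum>j\<in>UNIV. ennreal (\<bar>boundary_weight \<alpha> G x * V' i j x\<bar> powr p) * indicator G x) \<partial>lborel)"
        unfolding weighted_energy_def
      proof (intro nn_integral_mono)
        fix x
        have "(boundary_weight \<alpha> G x * norm (V0 x)) powr p \<le> n powr p * n powr p * (\<Sum>i\<in>UNIV. \<Sum>j\<in>UNIV. \<bar>boundary_weight \<alpha> G x * V' i j x\<bar> powr p)"
          using norm_matrix_powr_le[of p "boundary_weight \<alpha> G x" "V0 x"] p wnn by (simp add: n_def V0_def)
        then have "ennreal ((boundary_weight \<alpha> G x * norm (V0 x)) powr p) \<le> ennreal (n powr p * n powr p) * (\<Sum>i\<in>UNIV. \<Sum>j\<in>UNIV. ennreal (\<bar>boundary_weight \<alpha> G x * V' i j x\<bar> powr p))"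
          by (simp add: ennreal_leI sum_nonneg flip: ennreal_mult)
        then show "ennreal ((boundary_weight \<alpha> G x * norm (V0 x)) powr p) * indicator G x \<le> ennreal (n powr p * n powr p) *
          (\<Sum>i\<in>UNIV. \<Sum>j\<in>UNIV. ennreal (\<bar>boundary_weight \<alpha> G x * V' i j x\<bar> powr p) * indicator G x)"
          by (simp add: indicator_def)
      qed
      also have "\<dots> = ennreal (n powr p * n powr p) * (\<Sum>i\<in>UNIV. \<Sum>j\<in>UNIV. (\<integral>\<^sup>+x\<in>G. ennreal (\<bar>boundary_weight \<alpha> G x * V' i j x\<bar> powr p) \<partial>lborel))"
      proof -
        have [measurable]: "G \<in> sets borel" using oG by simp
        note V'(1)[measurable]
        define F where "F i j x = ennreal (\<bar>boundary_weight \<alpha> G x * V' i j x\<bar> powr p) * indicator G x" for i j x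
        have [measurable]: "F i j \<in> borel_measurable borel" for i j
          unfolding F_def[abs_def] by measurable
        show ?thesis unfolding F_def[symmetric] by (simp add: nn_integral_cmult nn_integral_sum)
      qed
      also have "\<dots> = ennreal (n powr p * n powr p * (\<Sum>i\<in>UNIV. \<Sum>j\<in>UNIV. I i j))"
        unfolding Iij using Inn by (simp add: sum_nonneg ennreal_mult)
      finally show ?thesis .
    qed
    have "(\<integral>\<^sup>+y\<in>G. ennreal (norm (v0 y) powr p) \<partial>lborel) \<le> ennreal C * weighted_energy p \<alpha> G V0"
      by (rule main[OF app gm sp _ l3 g0]) (use E in \<open>auto intro: le_less_trans\<close>)
    also have "\<dots> \<le> ennreal C * ennreal (n powr p * n powr p * (\<Sum>i\<in>UNIV. \<Sum>j\<in>UNIV. I i j))"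
      by (intro mult_left_mono E) simp
    finally have v0e: "(\<integral>\<^sup>+y\<in>G. ennreal (norm (v0 y) powr p) \<partial>lborel) \<le> ennreal (C * (n powr p * n powr p) * (\<Sum>i\<in>UNIV. \<Sum>j\<in>UNIV. I i j))"
      using C Inn by (simp add: sum_nonneg mult.assoc flip: ennreal_mult)
    have vn: "(LINT x|lebesgue_on G. \<bar>v x $ i\<bar> powr p) \<le> C * (n powr p * n powr p) * (\<Sum>i\<in>UNIV. \<Sum>j\<in>UNIV. I i j)" for i
    proof -
      have "ennreal (LINT x|lebesgue_on G. \<bar>v x $ i\<bar> powr p) = (\<integral>\<^sup>+x\<in>G. ennreal (\<bar>v x $ i\<bar> powr p) \<partial>lborel)"
        by (rule nn_integral_eq_LINT_lebesgue_on[OF oG vi, symmetric]) simp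
      also have "\<dots> \<le> (\<integral>\<^sup>+y\<in>G. ennreal (norm (v0 y) powr p) \<partial>lborel)"
      proof (rule nn_integral_mono_AE)
        show "AE x in lborel. ennreal (\<bar>v x $ i\<bar> powr p) * indicator G x \<le> ennreal (norm (v0 x) powr p) * indicator G x"
          using v0
        proof eventually_elim
          case (elim x)
          have "\<bar>v0 x $ i\<bar> powr p \<le> norm (v0 x) powr p" using p by (intro powr_mono2 component_le_norm_cart) auto
          then show ?case using elim by (auto simp: indicator_def intro: ennreal_leI)
        qed
      qed
      also note v0e
      finally show ?thesis using C Inn by (subst (asm) ennreal_le_iff) (auto intro!: mult_nonneg_nonneg sum_nonneg)
    qed
    have "vector_Lp_norm p G v = (\<Sum>i\<in>UNIV. (LINT x|lebesgue_on G. \<bar>v x $ i\<bar> powr p)) powr (1 / p)"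
      using p by (simp add: vector_Lp_norm_def Lp_norm_def powr_powr)
    also have "\<dots> \<le> (K * (\<Sum>i\<in>UNIV. \<Sum>j\<in>UNIV. I i j)) powr (1 / p)"
    proof (rule powr_mono2)
      have "(\<Sum>i\<in>UNIV. (LINT x|lebesgue_on G. \<bar>v x $ i\<bar> powr p)) \<le> (\<Sum>i\<in>(UNIV::'n set). C * (n powr p * n powr p) * (\<Sum>i\<in>UNIV. \<Sum>j\<in>UNIV. I i j))"
        by (intro sum_mono vn)
      then show "(\<Sum>i\<in>UNIV. (LINT x|lebesgue_on G. \<bar>v x $ i\<bar> powr p)) \<le> K * (\<Sum>i\<in>UNIV. \<Sum>j\<in>UNIV. I i j)"
        by (simp add: K_def n_def mult.assoc)
    qed (use p in \<open>auto intro!: sum_nonneg\<close>)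
    also have "\<dots> = K powr (1 / p) * weighted_matrix_Lp_norm p \<alpha> G V"
      using K Inn by (simp add: wm powr_mult sum_nonneg)
    also have "K powr (1 / p) = inverse (K powr (- (1 / p)))" by (simp add: powr_minus)
    finally show ?thesis .
  qed
  show ?thesis
    by (intro exI[of _ "K powr (- (1 / p))"] conjI allI impI est) (use K in auto)
qed

end
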